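(* Let $0\le\beta\le\alpha\le 1$ with $\beta<1$, and let $(\chi,(\psi_i)_{i\in I_\ast})$ be a wave-packet scattering bank subordinate to the covering $\mathcal Q^{(\alpha,\beta)}$ which satisfies the active core condition (AC) and the uniform active-core regularity condition (R). Fix $m\in\{0,1,2,\dots\}$ and $s\ge0$. Let $\omega:(0,1]\to[0,\infty)$ be nondecreasing with $\omega(t)\to0$ as $t\downarrow0$. Suppose that there exists a constant $C<\infty$ such that $$\|\mathsf S_{\chi,1}(L_\tau f)-\mathsf S_{\chi,1}f\|_{\ell^2(L^2)}\le C\,\omega(\|\tau\|_{C^m})\,\|f\|_{H^s}$$ for every $f\in H^s(\mathbb R^2)$ and every $\tau\in C_c^\infty(\mathbb R^2;\mathbb R^2)$, $\tau\neq0$, with $\|\tau\|_{C^m}\le1$ and $\|D\tau\|_{L^\infty}<1$. Then necessarily $$\limsup_{t\downarrow0}\frac{\omega(t)}{t^{s/(1-\beta)}}>0 .$$ In particular, if $0\le s<1-\beta$, there is no constant $C<\infty$ such that $$\|\mathsf S_{\chi,1}(L_\tau f)-\mathsf S_{\chi,1}f\|_{\ell^2(L^2)}\le C\,\|\tau\|_{C^m}\|f\|_{H^s}$$ holds for all $f\in H^s(\mathbb R^2)$ and all $\tau\in C_c^\infty(\mathbb R^2;\mathbb R^2)$ with $\|D\tau\|_{L^\infty}<1$.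
   Context: Notation: $\mathbb N=\{1,2,\dots\}$, $\mathbb N_0=\{0,1,2,\dots\}$; $\widehat f(\xi)=\int_{\mathbb R^2}e^{-2\pi \mathrm i x\cdot\xi}f(x)\,dx$; $\|f\|_{H^s}=\|(1+|\xi|^2)^{s/2}\widehat f\|_{L^2}$; $B_r(x_0)$ is the open ball; $X\asymp Y$ means two-sided bounds with constants independent of $j$. For a vector field $\tau:\mathbb R^2\to\mathbb R^2$, $L_\tau f(x)=f(x-\tau(x))$, $\|\tau\|_{C^m}=\sum_{|\nu|\le m}\|\partial^\nu\tau\|_{L^\infty}$, and $\|D\tau\|_{L^\infty}$ is the essential supremum of the operator norm of $D\tau(x)$. For a countable family $q=(q_p)_p$, $\|q\|_{\ell^2(L^2)}=(\sum_p\|q_p\|_{L^2}^2)^{1/2}$. Covering. Fix $0\le\beta\le\alpha\le1$ and $\varepsilon_0\in(0,1/32)$. Let $Q=(-\varepsilon_0,1+\varepsilon_0)\times(-1-\varepsilon_0,1+\varepsilon_0)$ and $P=[0,1]\times[-1,1]$. For $j\in\mathbb N$ let $m_j^{\max}=\lceil 2^{(1-\alpha)j-1}\rceil$, $\ell_j^{\max}=\lceil 10\cdot2^{(1-\beta)j}\rceil$, $A_j=\mathrm{diag}(2^{\alpha j},2^{\beta j})$, $c_{j,m}=(2^{j-1}+m2^{\alpha j},0)^\top$, and let $R_{j,\ell}$ be the rotation matrix by the angle $\theta_{j,\ell}=2\ell\cdot\frac{\pi}{10}2^{(\beta-1)j}$. Put $I_\ast=\{(j,m,\ell)\in\mathbb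 N\times\mathbb N_0\times\mathbb N_0: m\le m_j^{\max},\ \ell\le\ell_j^{\max}\}$, $I=\{0\}\cup I_\ast$, and for $i=(j,m,\ell)\in I_\ast$, $Q_i=R_{j,\ell}(A_jQ+c_{j,m})$, $P_i=R_{j,\ell}(A_jP+c_{j,m})$; also $Q_0=B_4(0)$, $P_0=B_3(0)$. The covering is $\mathcal Q^{(\alpha,\beta)}=(Q_i)_{i\in I}$. Filter bank. A wave-packet scattering bank subordinate to $\mathcal Q^{(\alpha,\beta)}$ consists of $\chi\in L^1\cap L^2(\mathbb R^2)$ and $\psi_i\in L^1\cap L^2(\mathbb R^2)$, $i\in I_\ast$, with $m_i:=\widehat\psi_i$, such that $|\widehat\chi(\xi)|^2+\sum_{i\in I_\ast}|m_i(\xi)|^2=1$ for a.e. $\xi$, $\operatorname{supp}\widehat\chi\subset Q_0$ and $\operatorname{supp}m_i\subset Q_i$ for all $i\in I_\ast$. First-layer scattering: $\mathsf S_{\chi,1}f=(|f*\psi_i|*\chi)_{i\in I_\ast}$. Active-core system (exists whenever $\beta<1$; one is fixed): $j_0\in\mathbb N$, $r_0>0$, indices $i_j\in I_\ast$, points $\xi_j\in P_{i_j}$ and matrices $M_j\in\mathbb R^{2\times2}$, $j\ge j_0$, with $|\xi_j|\asymp2^j$, $B_{r_0}(\xi_j)\subset P_{i_j}\subset Q_{i_j}$, $\|M_j\|\asymp2^{-(1-\beta)j}$, $\mathrm{Id}-M_j$ invertible, and, for every $0<\rho\le r_0$ and $i\in I$: $Q_i\cap B_\rho(\xi_j)\ne\varnothing$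 implies $Q_i\cap(\mathrm{Id}-M_j)B_\rho(\xi_j)=\varnothing$. (AC): there is $c_{\rm act}>0$ with $|m_{i_j}(\xi)|\ge c_{\rm act}$ for all $\xi\in B_{r_0}(\xi_j)$ and all $j\ge j_0$. (R): there is $C_{\rm reg}<\infty$ with $\sup_{j\ge j_0}\|\nabla m_{i_j}\|_{L^\infty(B_{r_0}(\xi_j))}\le C_{\rm reg}$. *)

theory Defs
  imports "HOL-Analysis.Analysis" "HOL-Probability.Essential_Supremum"
begin

text \<open>
  Elements of $L^p(\mathbb{R}^2)$ are represented by Borel functions and all norms take values in
  \<^typ>\<open>ennreal\<close>, so that a norm bound includes the finiteness of its left-hand side. Euclidean
  norms are used for vectors, operator norms for matrices.
\<close>

section \<open>Function spaces\<close>

definition ennsqrt :: "ennreal \<Rightarrow> ennreal" where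
  "ennsqrt a = (if a = \<infinity> then \<infinity> else ennreal (sqrt (enn2real a)))"

definition L2_norm :: "(real^2 \<Rightarrow> 'b::real_normed_vector) \<Rightarrow> ennreal" where
  "L2_norm f = ennsqrt (\<integral>\<^sup>+ x. ennreal ((norm (f x))\<^sup>2) \<partial>lborel)"

definition L2_space :: "(real^2 \<Rightarrow> complex) set" where
  "L2_space = {f \<in> borel_measurable lborel. L2_norm f < \<infinity>}"

definition Linfty_norm :: "(real^2) set \<Rightarrow> (real^2 \<Rightarrow> 'b::real_normed_vector) \<Rightarrow> ennreal" where
  "Linfty_norm S f = esssup (restrict_space lborel S) (\<lambda>x. ennreal (norm (f x)))"

definition ell2_L2_norm :: "'i set \<Rightarrow> ('i \<Rightarrow> real^2 \<Rightarrow> complex) \<Rightarrow> ennreal" where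
  "ell2_L2_norm A q = ennsqrt (\<Sum>\<^sub>\<infinity>p\<in>A. (L2_norm (q p))\<^sup>2)"

definition fourier :: "(real^2 \<Rightarrow> complex) \<Rightarrow> real^2 \<Rightarrow> complex" where
  "fourier f \<xi> = (LINT x|lborel. cis (- (2 * pi * (x \<bullet> \<xi>))) * f x)"

text \<open>
  On $L^2$ the defining integral need not converge absolutely; the transform is the $L^2$-limit of
  the transforms of the truncations $f \mathbf{1}_{B_n(0)} \in L^1$, which exists by Plancherel's
  theorem and is unique up to null sets. \<^const>\<open>Eps\<close> selects a representative.
\<close>

definition L2_fourier :: "(real^2 \<Rightarrow> complex) \<Rightarrow> real^2 \<Rightarrow> complex" where
  "L2_fourier f = (SOME g. g \<in> L2_space \<and>
     (\<lambda>n. L2_norm (\<lambda>\<xi>. fourier (\<lambda>x. indicator (ball 0 (real n)) x *\<^sub>R f x) \<xi> - g \<xi>))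
       \<longlonglongrightarrow> 0)"

definition Hs_norm :: "real \<Rightarrow> (real^2 \<Rightarrow> complex) \<Rightarrow> ennreal" where
  "Hs_norm s f = L2_norm (\<lambda>\<xi>. ((1 + (norm \<xi>)\<^sup>2) powr (s / 2)) *\<^sub>R L2_fourier f \<xi>)"

text \<open>For \<open>s \<ge> 0\<close>, where $H^s \subseteq L^2$.\<close>

definition Hs_space :: "real \<Rightarrow> (real^2 \<Rightarrow> complex) set" where
  "Hs_space s = {f \<in> L2_space. Hs_norm s f < \<infinity>}"

definition convolution :: "(real^2 \<Rightarrow> complex) \<Rightarrow> (real^2 \<Rightarrow> complex) \<Rightarrow> real^2 \<Rightarrow> complex" where
  "convolution f g x = (LINT y|lborel. f y * g (x - y))"

definition supp :: "(real^2 \<Rightarrow> 'b::zero) \<Rightarrow> (real^2) set" where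
  "supp f = closure {x. f x \<noteq> 0}"

section \<open>Smooth functions and weak gradients\<close>

definition partial_deriv :: "2 \<Rightarrow> (real^2 \<Rightarrow> 'b::real_normed_vector) \<Rightarrow> real^2 \<Rightarrow> 'b" where
  "partial_deriv k f x = frechet_derivative f (at x) (axis k 1)"

definition smooth :: "(real^2 \<Rightarrow> 'b::real_normed_vector) \<Rightarrow> bool" where
  "smooth f \<longleftrightarrow> (\<forall>ks x. foldr partial_deriv ks f differentiable at x)"

definition Cc_infty :: "(real^2 \<Rightarrow> 'b::real_normed_vector) set" where
  "Cc_infty = {f. smooth f \<and> compact (supp f)}"

definition Cm_norm :: "nat \<Rightarrow> (real^2 \<Rightarrow> real^2) \<Rightarrow> ennreal" where
  "Cm_norm m \<tau> = (\<Sum>a\<le>m. \<Sum>b\<le>m - a.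
     Linfty_norm UNIV ((partial_deriv 1 ^^ a) ((partial_deriv 2 ^^ b) \<tau>)))"

definition Dsup_norm :: "(real^2 \<Rightarrow> real^2) \<Rightarrow> ennreal" where
  "Dsup_norm \<tau> = Linfty_norm UNIV (\<lambda>x. onorm (frechet_derivative \<tau> (at x)))"

definition weak_gradient_on ::
    "(real^2) set \<Rightarrow> (real^2 \<Rightarrow> complex) \<Rightarrow> (real^2 \<Rightarrow> complex^2) \<Rightarrow> bool" where
  "weak_gradient_on U u g \<longleftrightarrow>
     (\<forall>K. compact K \<and> K \<subseteq> U \<longrightarrow> set_integrable lborel K u \<and> set_integrable lborel K g) \<and>
     (\<forall>\<phi>\<in>(Cc_infty :: (real^2 \<Rightarrow> real) set). supp \<phi> \<subseteq> U \<longrightarrow>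
        (\<forall>k. (LINT x:U|lborel. partial_deriv k \<phi> x *\<^sub>R u x) =
             - (LINT x:U|lborel. \<phi> x *\<^sub>R (g x $ k))))"

section \<open>The wave-packet covering\<close>

text \<open>A triple $(j,m,\ell)$ indexes a tile of $I_\ast$; in $I$, \<^const>\<open>None\<close> is the index $0$ of
  the low-frequency ball.\<close>

type_synonym tile = "nat \<times> nat \<times> nat"

definition m_max :: "real \<Rightarrow> nat \<Rightarrow> nat" where
  "m_max \<alpha> j = nat \<lceil>2 powr ((1 - \<alpha>) * real j - 1)\<rceil>"

definition l_max :: "real \<Rightarrow> nat \<Rightarrow> nat" where
  "l_max \<beta> j = nat \<lceil>10 * 2 powr ((1 - \<beta>) * real j)\<rceil>"

definition I_star :: "real \<Rightarrow> real \<Rightarrow> tile set" where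
  "I_star \<alpha> \<beta> = {(j, m, l). 1 \<le> j \<and> m \<le> m_max \<alpha> j \<and> l \<le> l_max \<beta> j}"

definition I_full :: "real \<Rightarrow> real \<Rightarrow> tile option set" where
  "I_full \<alpha> \<beta> = insert None (Some ` I_star \<alpha> \<beta>)"

definition A_mat :: "real \<Rightarrow> real \<Rightarrow> nat \<Rightarrow> real^2^2" where
  "A_mat \<alpha> \<beta> j = vector [vector [2 powr (\<alpha> * real j), 0], vector [0, 2 powr (\<beta> * real j)]]"

definition c_vec :: "real \<Rightarrow> nat \<Rightarrow> nat \<Rightarrow> real^2" where
  "c_vec \<alpha> j m = vector [2 powr (real j - 1) + real m * 2 powr (\<alpha> * real j), 0]"

definition theta :: "real \<Rightarrow> nat \<Rightarrow> nat \<Rightarrow> real" where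
  "theta \<beta> j l = 2 * real l * (pi / 10) * 2 powr ((\<beta> - 1) * real j)"

definition R_mat :: "real \<Rightarrow> nat \<Rightarrow> nat \<Rightarrow> real^2^2" where
  "R_mat \<beta> j l = vector [vector [cos (theta \<beta> j l), - sin (theta \<beta> j l)],
                         vector [sin (theta \<beta> j l), cos (theta \<beta> j l)]]"

definition Q_ref :: "real \<Rightarrow> (real^2) set" where
  "Q_ref \<epsilon>\<^sub>0 = box (vector [- \<epsilon>\<^sub>0, - 1 - \<epsilon>\<^sub>0]) (vector [1 + \<epsilon>\<^sub>0, 1 + \<epsilon>\<^sub>0])"

definition P_ref :: "(real^2) set" where
  "P_ref = cbox (vector [0, - 1]) (vector [1, 1])"

definition place :: "real \<Rightarrow> real \<Rightarrow> tile \<Rightarrow> (real^2) set \<Rightarrow> (real^2) set" where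
  "place \<alpha> \<beta> i S = (case i of (j, m, l) \<Rightarrow>
     (\<lambda>x. R_mat \<beta> j l *v (A_mat \<alpha> \<beta> j *v x + c_vec \<alpha> j m)) ` S)"

definition Q_set :: "real \<Rightarrow> real \<Rightarrow> real \<Rightarrow> tile option \<Rightarrow> (real^2) set" where
  "Q_set \<alpha> \<beta> \<epsilon>\<^sub>0 i = (case i of None \<Rightarrow> ball 0 4 | Some t \<Rightarrow> place \<alpha> \<beta> t (Q_ref \<epsilon>\<^sub>0))"

definition P_set :: "real \<Rightarrow> real \<Rightarrow> tile option \<Rightarrow> (real^2) set" where
  "P_set \<alpha> \<beta> i = (case i of None \<Rightarrow> ball 0 3 | Some t \<Rightarrow> place \<alpha> \<beta> t P_ref)"

section \<open>Filter bank and first-layer scattering\<close>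

definition scattering_bank ::
    "real \<Rightarrow> real \<Rightarrow> real \<Rightarrow> (real^2 \<Rightarrow> complex) \<Rightarrow> (tile \<Rightarrow> real^2 \<Rightarrow> complex) \<Rightarrow> bool" where
  "scattering_bank \<alpha> \<beta> \<epsilon>\<^sub>0 chi \<psi> \<longleftrightarrow>
     integrable lborel chi \<and> chi \<in> L2_space \<and>
     (\<forall>i\<in>I_star \<alpha> \<beta>. integrable lborel (\<psi> i) \<and> \<psi> i \<in> L2_space) \<and>
     (AE \<xi> in lborel. (\<lambda>i. (cmod (fourier (\<psi> i) \<xi>))\<^sup>2) summable_on I_star \<alpha> \<beta> \<and>
        (cmod (fourier chi \<xi>))\<^sup>2 + (\<Sum>\<^sub>\<infinity>i\<in>I_star \<alpha> \<beta>. (cmod (fourier (\<psi> i) \<xi>))\<^sup>2) = 1) \<and>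
     supp (fourier chi) \<subseteq> Q_set \<alpha> \<beta> \<epsilon>\<^sub>0 None \<and>
     (\<forall>i\<in>I_star \<alpha> \<beta>. supp (fourier (\<psi> i)) \<subseteq> Q_set \<alpha> \<beta> \<epsilon>\<^sub>0 (Some i))"

definition scattering1 ::
    "(real^2 \<Rightarrow> complex) \<Rightarrow> (tile \<Rightarrow> real^2 \<Rightarrow> complex) \<Rightarrow> (real^2 \<Rightarrow> complex) \<Rightarrow>
      tile \<Rightarrow> real^2 \<Rightarrow> complex" where
  "scattering1 chi \<psi> f i = convolution (\<lambda>x. of_real (cmod (convolution f (\<psi> i) x))) chi"

definition deform :: "(real^2 \<Rightarrow> real^2) \<Rightarrow> (real^2 \<Rightarrow> complex) \<Rightarrow> real^2 \<Rightarrow> complex" where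
  "deform \<tau> f x = f (x - \<tau> x)"

definition scattering_change ::
    "real \<Rightarrow> real \<Rightarrow> (real^2 \<Rightarrow> complex) \<Rightarrow> (tile \<Rightarrow> real^2 \<Rightarrow> complex) \<Rightarrow>
      (real^2 \<Rightarrow> real^2) \<Rightarrow> (real^2 \<Rightarrow> complex) \<Rightarrow> ennreal" where
  "scattering_change \<alpha> \<beta> chi \<psi> \<tau> f = ell2_L2_norm (I_star \<alpha> \<beta>)
     (\<lambda>i x. scattering1 chi \<psi> (deform \<tau> f) i x - scattering1 chi \<psi> f i x)"

section \<open>Active cores\<close>

definition comparable_from :: "nat \<Rightarrow> (nat \<Rightarrow> real) \<Rightarrow> (nat \<Rightarrow> real) \<Rightarrow> bool" where
  "comparable_from j\<^sub>0 X Y \<longleftrightarrow> (\<exists>c>0. \<exists>C>0. \<forall>j\<ge>j\<^sub>0. c * Y j \<le> X j \<and> X j \<le> C * Y j)"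

definition active_core_system ::
    "real \<Rightarrow> real \<Rightarrow> real \<Rightarrow> nat \<Rightarrow> real \<Rightarrow> (nat \<Rightarrow> tile) \<Rightarrow> (nat \<Rightarrow> real^2) \<Rightarrow>
      (nat \<Rightarrow> real^2^2) \<Rightarrow> bool" where
  "active_core_system \<alpha> \<beta> \<epsilon>\<^sub>0 j\<^sub>0 r\<^sub>0 idx \<xi> M \<longleftrightarrow>
     1 \<le> j\<^sub>0 \<and> 0 < r\<^sub>0 \<and>
     comparable_from j\<^sub>0 (\<lambda>j. norm (\<xi> j)) (\<lambda>j. 2 ^ j) \<and>
     comparable_from j\<^sub>0 (\<lambda>j. onorm ((*v) (M j))) (\<lambda>j. 2 powr (- ((1 - \<beta>) * real j))) \<and>
     (\<forall>j\<ge>j\<^sub>0.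
        idx j \<in> I_star \<alpha> \<beta> \<and>
        \<xi> j \<in> P_set \<alpha> \<beta> (Some (idx j)) \<and>
        ball (\<xi> j) r\<^sub>0 \<subseteq> P_set \<alpha> \<beta> (Some (idx j)) \<and>
        P_set \<alpha> \<beta> (Some (idx j)) \<subseteq> Q_set \<alpha> \<beta> \<epsilon>\<^sub>0 (Some (idx j)) \<and>
        invertible (mat 1 - M j) \<and>
        (\<forall>\<rho> i. 0 < \<rho> \<and> \<rho> \<le> r\<^sub>0 \<and> i \<in> I_full \<alpha> \<beta> \<and>
           Q_set \<alpha> \<beta> \<epsilon>\<^sub>0 i \<inter> ball (\<xi> j) \<rho> \<noteq> {} \<longrightarrow>
           Q_set \<alpha> \<beta> \<epsilon>\<^sub>0 i \<inter> (*v) (mat 1 - M j) ` ball (\<xi> j) \<rho> = {}))"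

definition active_core_condition ::
    "nat \<Rightarrow> real \<Rightarrow> (nat \<Rightarrow> tile) \<Rightarrow> (nat \<Rightarrow> real^2) \<Rightarrow> (tile \<Rightarrow> real^2 \<Rightarrow> complex) \<Rightarrow> bool" where
  "active_core_condition j\<^sub>0 r\<^sub>0 idx \<xi> \<psi> \<longleftrightarrow>
     (\<exists>c>0. \<forall>j\<ge>j\<^sub>0. \<forall>\<eta>\<in>ball (\<xi> j) r\<^sub>0. c \<le> cmod (fourier (\<psi> (idx j)) \<eta>))"

text \<open>A multiplier of the bank is a priori only continuous, so its gradient on the core is the
  weak one.\<close>

definition core_regularity_condition ::
    "nat \<Rightarrow> real \<Rightarrow> (nat \<Rightarrow> tile) \<Rightarrow> (nat \<Rightarrow> real^2) \<Rightarrow> (tile \<Rightarrow> real^2 \<Rightarrow> complex) \<Rightarrow> bool" where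
  "core_regularity_condition j\<^sub>0 r\<^sub>0 idx \<xi> \<psi> \<longleftrightarrow>
     (\<exists>C<\<infinity>. \<forall>j\<ge>j\<^sub>0. \<exists>g. weak_gradient_on (ball (\<xi> j) r\<^sub>0) (fourier (\<psi> (idx j))) g \<and>
        Linfty_norm (ball (\<xi> j) r\<^sub>0) g \<le> C)"

end

theory Submission
  imports "HOL-Probability.Characteristic_Functions" Defs
begin

text \<open>
  The bound is tested on Gaussian wave packets \<open>f\<^sub>j(x) = exp(2\<pi>i x \<bullet> \<xi>\<^sub>j) exp(-\<pi>a|x|\<^sup>2)\<close>, whose
  spectrum is concentrated at the centre \<open>\<xi>\<^sub>j\<close> of an active core, and on the deformations
  \<open>\<tau>\<^sub>j(x) = \<eta>(x) M\<^sub>j\<^sup>T x\<close>, where \<open>\<eta>\<close> is a plateau function equal to 1 on the ball of radius \<open>R\<close>.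
  The parameters \<open>a\<close> and \<open>R\<close> are the same at all scales. Hence the \<open>C\<^sup>m\<close>-norm of \<open>\<tau>\<^sub>j\<close> is of order
  \<open>\<parallel>M\<^sub>j\<parallel>\<close>, that is, at most \<open>t\<^sub>j = K 2\<^sup>-\<^sup>(\<^sup>1\<^sup>-\<^sup>\<beta>\<^sup>)\<^sup>j\<close>, while the \<open>H\<^sup>s\<close>-norm of \<open>f\<^sub>j\<close> is at most
  \<open>K 2\<^sup>s\<^sup>j\<close>. The change of the first layer nevertheless stays above a positive constant
  (\<open>scattering_instability\<close>). The assumed estimate therefore forces \<open>\<omega>(t\<^sub>j) 2\<^sup>s\<^sup>j\<close> to stay above a
  positive constant, and \<open>2\<^sup>s\<^sup>j\<close> is \<open>t\<^sub>j\<close> to the power \<open>-s/(1-\<beta>)\<close>, up to a constant. The linear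
  modulus \<open>\<omega>(t) = t\<close> violates this when \<open>s < 1 - \<beta>\<close>.

  The change is bounded below already in the channel \<open>i\<^sub>j\<close> of the core, for the following reasons.
  On the plateau, the deformed packet is \<open>f\<^sub>j\<close> composed with the transpose of \<open>N = Id - M\<^sub>j\<close>, and
  its spectrum is that of \<open>f\<^sub>j\<close> moved by \<open>N\<close>. By the choice of the active core, \<open>N\<close> moves the core
  out of the support of the filter, so that only Gaussian tails pass it
  (\<open>linear_packet_misses_filter\<close>). The truncation matters only outside the ball of radius \<open>R\<close>,
  where both packets are small because \<open>|x - \<tau>\<^sub>j(x)| \<ge> |x|/2\<close>
  (\<open>energy_deformed_minus_linear_packet\<close>). So the deformed signal contributes almost nothing to
  this channel. For the undeformed signal, the bounded weak gradient makes the multiplier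
  Lipschitz near \<open>\<xi>\<^sub>j\<close> with a constant independent of \<open>j\<close>
  (\<open>weak_gradient_imp_lipschitz_from_center\<close>); the filter then acts on a spectrally narrow packet
  almost as multiplication by its value \<open>c\<close> at \<open>\<xi>\<^sub>j\<close> (\<open>packet_filter_error\<close>). The modulus of the
  filtered packet is close to \<open>|c| exp(-\<pi>a|x|\<^sup>2)\<close>. This is a low-frequency function, and \<open>|c|\<close> is
  bounded below. No tile meets the ball of radius 15/16, so the Fourier transform of the low-pass
  filter has modulus 1 there (\<open>bank_chi_eq_1_near_0\<close>) and the averaging almost preserves the norm of this function.

  Only two halves of Plancherel's theorem enter: \<open>energy_fourier_le\<close> for integrable functions and
  \<open>energy_le_energy_fourier\<close> for integrable functions that are continuous and bounded. Both come
  from damping the frequency integral by a Gaussian. All estimates are made for squared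
  \<open>L\<^sup>2\<close>-norms, for which \<open>(x + y)\<^sup>2 \<le> 2x\<^sup>2 + 2y\<^sup>2\<close> replaces Minkowski's inequality.
\<close>

section \<open>Gaussian and Lebesgue integrals in the plane\<close>

text \<open>
  This is the characteristic function of the standard normal distribution, rescaled by
  \<open>sqrt (2\<pi>a)\<close>.
\<close>

lemma gaussian_fourier_1D:
  assumes a: "a > 0"
  shows "has_bochner_integral lborel (\<lambda>x::real. cis (- (2 * pi * (x * t))) * exp (- (pi * a * x\<^sup>2)))
     (exp (- (pi * t\<^sup>2 / a)) / sqrt a)"
proof -
  define c where "c = sqrt (2 * pi * a)"
  have c: "c > 0" "c\<^sup>2 = 2 * pi * a" using a by (auto simp: c_def)
  define u where "u = - (2 * pi * t) / c"
  have int: "integrable std_normal_distribution (\<lambda>x. iexp (u * x))"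
  proof -
    interpret real_distribution std_normal_distribution by (rule real_dist_normal_dist)
    show ?thesis by (rule integrable_const_bound[where B=1]) auto
  qed
  have "char std_normal_distribution u = complex_of_real (exp (- (u^2) / 2))"
    by (simp add: char_std_normal_distribution)
  with int have "has_bochner_integral std_normal_distribution (\<lambda>x. iexp (u * x)) (complex_of_real (exp (- (u^2) / 2)))"
    by (simp add: has_bochner_integral_iff char_def)
  then have 1: "has_bochner_integral lborel (\<lambda>x. std_normal_density x *\<^sub>R iexp (u * x)) (complex_of_real (exp (- (u^2) / 2)))"
    by (simp add: has_bochner_integral_iff integrable_density integral_density)
  then have "has_bochner_integral lborel (\<lambda>x. std_normal_density (0 + c * x) *\<^sub>R iexp (u * (0 + c * x)))
      (complex_of_real (exp (- (u^2) / 2)) /\<^sub>R \<bar>c\<bar>)"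
    using lborel_has_bochner_integral_real_affine_iff[of c "\<lambda>x. std_normal_density x *\<^sub>R iexp (u * x)" _ 0] c by auto
  then have "has_bochner_integral lborel (\<lambda>x. sqrt (2 * pi) *\<^sub>R (std_normal_density (0 + c * x) *\<^sub>R iexp (u * (0 + c * x))))
      (sqrt (2 * pi) *\<^sub>R (complex_of_real (exp (- (u^2) / 2)) /\<^sub>R \<bar>c\<bar>))"
    by (rule has_bochner_integral_scaleR_right)
  moreover have "sqrt (2 * pi) *\<^sub>R (std_normal_density (0 + c * x) *\<^sub>R iexp (u * (0 + c * x))) =
      cis (- (2 * pi * (x * t))) * exp (- (pi * a * x\<^sup>2))" for x
  proof -
    have e: "u * (c * x) = - (2 * pi * (x * t))" using c by (simp add: u_def field_simps)
    have f: "(c * x)\<^sup>2 / 2 = pi * a * x\<^sup>2" using c by (simp add: power_mult_distrib)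
    show ?thesis unfolding std_normal_density_def add_0 e
      by (simp add: f cis_conv_exp scaleR_conv_of_real)
  qed
  moreover have "sqrt (2 * pi) *\<^sub>R (complex_of_real (exp (- (u^2) / 2)) /\<^sub>R \<bar>c\<bar>) = exp (- (pi * t\<^sup>2 / a)) / sqrt a"
  proof -
    have "u\<^sup>2 / 2 = pi * t\<^sup>2 / a" using c a by (simp add: u_def power_divide power_mult_distrib power2_eq_square field_simps)
    moreover have "sqrt (2 * pi) / c = 1 / sqrt a" using a by (simp add: c_def real_sqrt_mult)
    moreover have "sqrt (2 * pi) *\<^sub>R (complex_of_real (exp (- (u^2) / 2)) /\<^sub>R \<bar>c\<bar>) =
        complex_of_real (exp (- (u\<^sup>2 / 2)) * (sqrt (2 * pi) / c))"
      using c by (simp add: scaleR_conv_of_real field_simps)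
    ultimately show ?thesis by simp
  qed
  ultimately show ?thesis by simp
qed

lemma Basis_real_2: "(Basis :: (real^2) set) = {axis 1 1, axis 2 1}"
  by (auto simp: Basis_vec_def UNIV_2)

text \<open>
  Fubini's theorem for the two coordinates, obtained from the description of Lebesgue measure as
  the image of a product measure indexed by the basis.
\<close>

lemma has_bochner_integral_prod_coords:
  fixes f g :: "real \<Rightarrow> complex"
  assumes f: "has_bochner_integral lborel f I" and g: "has_bochner_integral lborel g J"
  shows "has_bochner_integral lborel (\<lambda>x::real^2. f (x $ 1) * g (x $ 2)) (I * J)"
proof -
  interpret P: product_sigma_finite "\<lambda>_::real^2. lborel :: real measure" ..
  define F where "F b = (if b = (axis 1 1 :: real^2) then f else g)" for b
  have [measurable]: "f \<in> borel_measurable borel" "g \<in> borel_measurable borel"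
    using f g by (auto simp: has_bochner_integral_iff dest!: borel_measurable_integrable)
  have F: "integrable lborel (F b)" for b using f g by (auto simp: F_def has_bochner_integral_iff)
  have ne: "axis 1 1 \<noteq> (axis 2 1 :: real^2)" by (simp add: axis_eq_axis)
  have 1: "integrable (\<Pi>\<^sub>M b\<in>Basis. lborel) (\<lambda>y. \<Prod>b\<in>Basis. F b (y b))"
    by (rule P.product_integrable_prod[OF finite_Basis F])
  have 2: "integral\<^sup>L (\<Pi>\<^sub>M b\<in>Basis. lborel) (\<lambda>y. \<Prod>b\<in>Basis. F b (y b)) = (\<Prod>b\<in>Basis. integral\<^sup>L lborel (F b))"
    by (rule P.product_integral_prod[OF finite_Basis F])
  have 3: "has_bochner_integral (\<Pi>\<^sub>M b\<in>(Basis::(real^2) set). lborel) (\<lambda>y. f (y (axis 1 1)) * g (y (axis 2 1))) (I * J)"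
    using 1 2 f g ne by (simp add: has_bochner_integral_iff Basis_real_2 F_def)
  have c: "(\<Sum>b\<in>Basis. y b *\<^sub>R b) $ 1 = y (axis 1 1)" "(\<Sum>b\<in>Basis. y b *\<^sub>R b) $ 2 = y (axis 2 1)" for y :: "real^2 \<Rightarrow> real"
    using ne by (simp_all add: Basis_real_2 axis_def)
  show ?thesis
    by (subst lborel_eq, rule has_bochner_integral_distr) (unfold c, use 3 in auto)
qed

text \<open>
  Two Borel measures agree with Lebesgue measure as soon as they do so on boxes; the preimage of a
  box under an invertible map is its image under the inverse, whose volume is known.
\<close>

lemma lborel_distr_linear:
  fixes T :: "real^'n::{finite,wellorder} \<Rightarrow> real^'n::_"
  assumes T: "linear T" and d: "det (matrix T) \<noteq> 0"
  shows "lborel = density (distr lborel borel T) (\<lambda>_. ennreal \<bar>det (matrix T)\<bar>)"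
proof (rule lborel_eqI)
  have Tm[measurable]: "T \<in> borel_measurable borel"
    using T by (simp add: borel_measurable_continuous_onI linear_continuous_on linear_conv_bounded_linear)
  from d have "invertible (matrix T)" by (simp add: invertible_det_nz)
  then obtain B where B: "B ** matrix T = mat 1" "matrix T ** B = mat 1" by (auto simp: invertible_def)
  have TB: "T (B *v x) = x" "B *v (T x) = x" for x
  proof -
    have w: "T y = matrix T *v y" for y using T by (simp add: matrix_works)
    show "T (B *v x) = x" "B *v (T x) = x" unfolding w matrix_vector_mul_assoc B by simp_all
  qed
  fix l u :: "real^'n::_" assume lu: "\<And>b. b \<in> Basis \<Longrightarrow> l \<bullet> b \<le> u \<bullet> b"
  have vi: "T -` box l u = (*v) B ` box l u" 
  proof safe
    fix x assume "T x \<in> box l u" then show "x \<in> (*v) B ` box l u" using TB(2)[of x] by (metis imageI)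
  qed (simp add: TB)
  have Tb: "T -` box l u \<in> sets borel" using measurable_sets_borel[OF Tm, of "box l u"] by simp
  have lm: "(*v) B ` box l u \<in> lmeasurable" using measurable_linear_image[of "(*v) B" "box l u"] by simp
  have mB: "measure lebesgue ((*v) B ` box l u) = \<bar>det B\<bar> * measure lebesgue (box l u)"
    by (subst measure_linear_image) (auto simp: matrix_of_matrix_vector_mul)
  have "det B * det (matrix T) = 1" unfolding det_mul[symmetric] B(1) by (rule det_I)
  then have dd: "\<bar>det (matrix T)\<bar> * \<bar>det B\<bar> = 1" unfolding abs_mult[symmetric] by (simp add: mult.commute)
  have "\<bar>det (matrix T)\<bar> * measure lebesgue (T -` box l u) = \<bar>det (matrix T)\<bar> * \<bar>det B\<bar> * measure lebesgue (box l u)"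
    unfolding vi mB by (rule mult.assoc[symmetric])
  then have "\<bar>det (matrix T)\<bar> * measure lebesgue (T -` box l u) = measure lebesgue (box l u)"
    unfolding dd by simp
  moreover have "emeasure lborel (T -` box l u) = ennreal (measure lebesgue (T -` box l u))"
  proof -
    have "emeasure lborel (T -` box l u) = emeasure lebesgue (T -` box l u)"
      using Tb by (simp add: emeasure_completion)
    also have "\<dots> = ennreal (measure lebesgue (T -` box l u))"
      using lm unfolding vi[symmetric] by (rule emeasure_eq_measure2)
    finally show ?thesis .
  qed
  ultimately have "ennreal \<bar>det (matrix T)\<bar> * emeasure lborel (T -` box l u) = ennreal (measure lebesgue (box l u))"
    by (simp flip: ennreal_mult)
  then show "emeasure (density (distr lborel borel T) (\<lambda>_. ennreal \<bar>det (matrix T)\<bar>)) (box l u) = (\<Prod>b\<in>Basis. (u - l) \<bullet> b)"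
    using lu by (simp add: emeasure_density_const emeasure_distr)
qed simp

lemma lborel_distr_reflect: "distr lborel borel (\<lambda>x::'a::euclidean_space. t - x) = lborel"
proof -
  have "distr lborel borel (\<lambda>x::'a. t - x) = density (distr lborel borel (\<lambda>x. t + (-1) *\<^sub>R x)) (\<lambda>_. ennreal (\<bar>-1\<bar> ^ DIM('a)))"
    by (simp add: density_1)
  also have "\<dots> = lborel" by (rule lborel_affine[symmetric]) simp
  finally show ?thesis .
qed

lemma integral_lborel_reflect:
  fixes f :: "'a::euclidean_space \<Rightarrow> 'b::{banach, second_countable_topology}"
  assumes [measurable]: "f \<in> borel_measurable borel"
  shows "(LINT y|lborel. f (t - y)) = (LINT y|lborel. f y)"
  by (subst (2) lborel_distr_reflect[of t, symmetric], subst integral_distr) auto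

lemma integrable_lborel_reflect:
  fixes f :: "'a::euclidean_space \<Rightarrow> 'b::{banach, second_countable_topology}"
  assumes f: "integrable lborel f"
  shows "integrable lborel (\<lambda>y. f (t - y))"
proof -
  have [measurable]: "f \<in> borel_measurable borel" using borel_measurable_integrable[OF f] by simp
  have "integrable (distr lborel borel (\<lambda>x. t - x)) f" using f by (simp add: lborel_distr_reflect)
  then show ?thesis by (subst (asm) integrable_distr_eq) auto
qed

lemma integral_lborel_translate:
  fixes f :: "'a::euclidean_space \<Rightarrow> 'b::{banach, second_countable_topology}"
  assumes [measurable]: "f \<in> borel_measurable borel"
  shows "(LINT y|lborel. f (t + y)) = (LINT y|lborel. f y)"
  by (subst (2) lborel_distr_plus[of t, symmetric], subst integral_distr) auto

lemma integrable_lborel_translate: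
  fixes f :: "'a::euclidean_space \<Rightarrow> 'b::{banach, second_countable_topology}"
  assumes f: "integrable lborel f"
  shows "integrable lborel (\<lambda>y. f (t + y))"
proof -
  have [measurable]: "f \<in> borel_measurable borel" using borel_measurable_integrable[OF f] by simp
  have "integrable (distr lborel borel ((+) t)) f" using f by (simp add: lborel_distr_plus)
  then show ?thesis by (subst (asm) integrable_distr_eq) auto
qed

lemma nn_integral_lborel_reflect:
  assumes [measurable]: "f \<in> borel_measurable borel"
  shows "(\<integral>\<^sup>+ y. f (t - y) \<partial>lborel) = (\<integral>\<^sup>+ y. f (y::'a::euclidean_space) \<partial>lborel)"
  by (subst (2) lborel_distr_reflect[of t, symmetric], subst nn_integral_distr) auto

lemma nn_integral_lborel_translate:
  assumes [measurable]: "f \<in> borel_measurable borel"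
  shows "(\<integral>\<^sup>+ y. f (t + y) \<partial>lborel) = (\<integral>\<^sup>+ y. f (y::'a::euclidean_space) \<partial>lborel)"
  by (subst (2) lborel_distr_plus[of t, symmetric], subst nn_integral_distr) auto

definition gaussian :: "real \<Rightarrow> real^2 \<Rightarrow> real" where
  "gaussian a x = exp (- (pi * a * (norm x)\<^sup>2))"

lemma norm_real2_sq: "(norm (x::real^2))\<^sup>2 = (x $ 1)\<^sup>2 + (x $ 2)\<^sup>2"
  unfolding power2_norm_eq_inner by (simp add: inner_vec_def sum_2 power2_eq_square)

lemma inner_real2: "(x::real^2) \<bullet> y = x $ 1 * y $ 1 + x $ 2 * y $ 2"
  by (simp add: inner_vec_def sum_2)

lemma gaussian_pos [simp]: "gaussian a x > 0" by (simp add: gaussian_def)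
lemma gaussian_nonneg [simp]: "gaussian a x \<ge> 0" by (simp add: gaussian_def)
lemma gaussian_le_1: "a \<ge> 0 \<Longrightarrow> gaussian a x \<le> 1" by (simp add: gaussian_def)
lemma gaussian_zero [simp]: "gaussian a 0 = 1" by (simp add: gaussian_def)
lemma continuous_on_gaussian [continuous_intros]:
  "continuous_on S f \<Longrightarrow> continuous_on S (\<lambda>x. gaussian a (f x))"
  unfolding gaussian_def by (intro continuous_intros)
lemma gaussian_measurable [measurable]: "gaussian a \<in> borel_measurable borel"
  by (intro borel_measurable_continuous_onI continuous_intros)

lemma gaussian_fourier_2D:
  assumes a: "a > 0"
  shows "has_bochner_integral lborel (\<lambda>x. cis (- (2 * pi * (x \<bullet> \<xi>))) * complex_of_real (gaussian a x))
     (complex_of_real (gaussian (1 / a) \<xi> / a))"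
proof -
  have "has_bochner_integral lborel
     (\<lambda>x::real^2. (cis (- (2 * pi * (x $ 1 * \<xi> $ 1))) * exp (- (pi * a * (x $ 1)\<^sup>2))) *
       (cis (- (2 * pi * (x $ 2 * \<xi> $ 2))) * exp (- (pi * a * (x $ 2)\<^sup>2))))
     (complex_of_real (exp (- (pi * (\<xi> $ 1)\<^sup>2 / a)) / sqrt a) * complex_of_real (exp (- (pi * (\<xi> $ 2)\<^sup>2 / a)) / sqrt a))"
    by (rule has_bochner_integral_prod_coords[OF gaussian_fourier_1D[OF a] gaussian_fourier_1D[OF a]])
  moreover have "(cis (- (2 * pi * (x $ 1 * \<xi> $ 1))) * exp (- (pi * a * (x $ 1)\<^sup>2))) *
       (cis (- (2 * pi * (x $ 2 * \<xi> $ 2))) * exp (- (pi * a * (x $ 2)\<^sup>2))) =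
       cis (- (2 * pi * (x \<bullet> \<xi>))) * complex_of_real (gaussian a x)" for x :: "real^2"
  proof -
    have "cis (- (2 * pi * (x \<bullet> \<xi>))) = cis (- (2 * pi * (x $ 1 * \<xi> $ 1))) * cis (- (2 * pi * (x $ 2 * \<xi> $ 2)))"
      by (simp add: cis_mult inner_real2 algebra_simps)
    moreover have "gaussian a x = exp (- (pi * a * (x $ 1)\<^sup>2)) * exp (- (pi * a * (x $ 2)\<^sup>2))"
      unfolding gaussian_def norm_real2_sq exp_add[symmetric] by (simp add: algebra_simps)
    ultimately show ?thesis by (simp add: algebra_simps)
  qed
  moreover have "(exp (- (pi * (\<xi> $ 1)\<^sup>2 / a)) / sqrt a) * (exp (- (pi * (\<xi> $ 2)\<^sup>2 / a)) / sqrt a) = gaussian (1 / a) \<xi> / a"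
  proof -
    have "sqrt a * sqrt a = a" using a by simp
    moreover have "exp (- (pi * (\<xi> $ 1)\<^sup>2 / a)) * exp (- (pi * (\<xi> $ 2)\<^sup>2 / a)) = gaussian (1 / a) \<xi>"
      unfolding gaussian_def norm_real2_sq exp_add[symmetric] by (simp add: algebra_simps add_divide_distrib)
    ultimately show ?thesis by (metis times_divide_times_eq)
  qed
  ultimately show ?thesis by (simp only: of_real_mult[symmetric])
qed

lemma integrable_gaussian_complex: "a > 0 \<Longrightarrow> integrable lborel (\<lambda>x. complex_of_real (gaussian a x))"
  using gaussian_fourier_2D[of a 0] by (simp add: has_bochner_integral_iff)

lemma integrable_gaussian: "a > 0 \<Longrightarrow> integrable lborel (gaussian a)"
  using integrable_norm[OF integrable_gaussian_complex[of a]] by simp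

lemma integral_gaussian: "a > 0 \<Longrightarrow> (LINT x|lborel. gaussian a x) = 1 / a"
  using gaussian_fourier_2D[of a 0] by (simp add: has_bochner_integral_iff flip: of_real_divide)

lemma nn_integral_gaussian: "a > 0 \<Longrightarrow> (\<integral>\<^sup>+ x. ennreal (gaussian a x) \<partial>lborel) = ennreal (1 / a)"
  by (subst nn_integral_eq_integral) (auto simp: integral_gaussian integrable_gaussian)

lemma fourier_gaussian: "a > 0 \<Longrightarrow> fourier (\<lambda>x. complex_of_real (gaussian a x)) \<xi> = complex_of_real (gaussian (1 / a) \<xi> / a)"
  using gaussian_fourier_2D[of a \<xi>] by (simp add: fourier_def has_bochner_integral_iff)

section \<open>The Fourier transform of integrable functions\<close>

lemma integrable_bounded_mult:
  fixes f g :: "real^2 \<Rightarrow> complex"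
  assumes f: "integrable lborel f" and [measurable]: "g \<in> borel_measurable borel" and b: "\<And>x. norm (g x) \<le> B"
  shows "integrable lborel (\<lambda>x. g x * f x)"
proof (rule Bochner_Integration.integrable_bound)
  show "integrable lborel (\<lambda>x. B * norm (f x))" using f by auto
  have [measurable]: "f \<in> borel_measurable borel" using borel_measurable_integrable[OF f] by simp
  show "(\<lambda>x. g x * f x) \<in> borel_measurable lborel" by simp
  have "0 \<le> B" using b[of undefined] norm_ge_zero order_trans by blast
  then show "AE x in lborel. norm (g x * f x) \<le> norm (B * norm (f x))"
    using b by (auto simp: norm_mult intro!: AE_I2 mult_right_mono)
qed

lemma integrable_fourier_integrand:
  "integrable lborel f \<Longrightarrow> integrable lborel (\<lambda>x. cis (- (2 * pi * (x \<bullet> \<xi>))) * f x)"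
  for f :: "real^2 \<Rightarrow> complex"
  by (rule integrable_bounded_mult[where B=1]) (auto intro!: borel_measurable_continuous_onI continuous_intros)

lemma norm_fourier_le: "integrable lborel f \<Longrightarrow> norm (fourier f \<xi>) \<le> (LINT x|lborel. norm (f x))"
  unfolding fourier_def by (rule integral_norm_bound[THEN order_trans]) (simp add: norm_mult)

lemma continuous_on_fourier:
  assumes f: "integrable lborel f"
  shows "continuous_on UNIV (fourier f)"
proof -
  have "(\<lambda>n. fourier f (X n)) \<longlonglongrightarrow> fourier f \<xi>" if "X \<longlonglongrightarrow> \<xi>" for X \<xi>
    unfolding fourier_def
  proof (rule integral_dominated_convergence[where w="\<lambda>x. norm (f x)"])
    show "AE x in lborel. (\<lambda>n. cis (- (2 * pi * (x \<bullet> X n))) * f x) \<longlonglongrightarrow> cis (- (2 * pi * (x \<bullet> \<xi>))) * f x"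
      using that by (auto intro!: tendsto_intros AE_I2)
    have f': "f \<in> borel_measurable borel" using borel_measurable_integrable[OF f] by simp
    show "(\<lambda>x. cis (- (2 * pi * (x \<bullet> \<xi>))) * f x) \<in> borel_measurable lborel"
      "(\<lambda>x. cis (- (2 * pi * (x \<bullet> X n))) * f x) \<in> borel_measurable lborel" for n
      using borel_measurable_integrable[OF integrable_fourier_integrand[OF f]] by auto
  qed (use f in \<open>auto simp: norm_mult\<close>)
  then show ?thesis by (auto simp: continuous_on_sequentially o_def)
qed

lemma fourier_measurable [measurable]: "integrable lborel f \<Longrightarrow> fourier f \<in> borel_measurable borel"
  by (intro borel_measurable_continuous_onI continuous_on_fourier)

lemma fourier_diff: "integrable lborel f \<Longrightarrow> integrable lborel g \<Longrightarrow> fourier (\<lambda>x. f x - g x) \<xi> = fourier f \<xi> - fourier g \<xi>"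
  unfolding fourier_def
  by (subst Bochner_Integration.integral_diff[symmetric]) (auto simp: right_diff_distrib intro!: integrable_fourier_integrand)

lemma fourier_cmult: "fourier (\<lambda>x. c * f x) \<xi> = c * fourier f \<xi>"
proof -
  have "fourier (\<lambda>x. c * f x) \<xi> = (LINT x|lborel. c * (cis (- (2 * pi * (x \<bullet> \<xi>))) * f x))"
    unfolding fourier_def by (simp add: mult_ac)
  then show ?thesis by (simp add: fourier_def)
qed

subsection \<open>Convolution\<close>

lemma integrable_convolution_pair:
  fixes f g :: "real^2 \<Rightarrow> complex"
  assumes f: "integrable lborel f" and g: "integrable lborel g"
  shows "integrable (lborel \<Otimes>\<^sub>M lborel) (\<lambda>(y, x). f y * g (x - y))"
proof (rule lborel_pair.Fubini_integrable)
  have [measurable]: "f \<in> borel_measurable borel" "g \<in> borel_measurable borel"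
    using borel_measurable_integrable[OF f] borel_measurable_integrable[OF g] by simp_all
  show "(\<lambda>(y, x). f y * g (x - y)) \<in> borel_measurable (lborel \<Otimes>\<^sub>M lborel)" by measurable
  have t: "integrable lborel (\<lambda>x. g (x - y))" "(LINT x|lborel. norm (g (x - y))) = (LINT x|lborel. norm (g x))" for y
    using integrable_lborel_translate[OF g, of "- y"] integral_lborel_translate[of "\<lambda>x. norm (g x)" "- y"] by simp_all
  show "integrable lborel (\<lambda>x. LINT y|lborel. norm (case (x, y) of (y, x) \<Rightarrow> f y * g (x - y)))"
    using f by (simp add: norm_mult t)
  show "AE x in lborel. integrable lborel (\<lambda>y. case (x, y) of (y, x) \<Rightarrow> f y * g (x - y))"
    using t by (intro AE_I2) auto
qed

lemma integrable_convolution: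
  assumes f: "integrable lborel f" and g: "integrable lborel g"
  shows "integrable lborel (convolution f g)"
  using lborel_pair.integrable_snd[OF integrable_convolution_pair[OF f g]] by (simp add: convolution_def[abs_def])

text \<open>
  Applied to the modulated functions \<open>exp(-2\<pi>i x \<bullet> \<xi>) f(x)\<close> and \<open>exp(-2\<pi>i x \<bullet> \<xi>) g(x)\<close>, whose
  convolution is the modulation of the convolution, this identity yields the convolution theorem.
\<close>

lemma integral_convolution:
  assumes f: "integrable lborel f" and g: "integrable lborel g"
  shows "(LINT x|lborel. convolution f g x) = (LINT x|lborel. f x) * (LINT x|lborel. g x)"
proof -
  have [measurable]: "g \<in> borel_measurable borel" using borel_measurable_integrable[OF g] by simp
  have "(LINT x|lborel. convolution f g x) = (LINT y|lborel. LINT x|lborel. f y * g (x - y))"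
    unfolding convolution_def by (rule lborel_pair.Fubini_integral[OF integrable_convolution_pair[OF f g]])
  also have "\<dots> = (LINT y|lborel. f y * (LINT x|lborel. g x))"
  proof (rule Bochner_Integration.integral_cong[OF refl])
    fix y
    show "(LINT x|lborel. f y * g (x - y)) = f y * (LINT x|lborel. g x)"
      using integral_lborel_translate[of g "- y"] by simp
  qed
  finally show ?thesis by simp
qed

lemma fourier_convolution:
  assumes f: "integrable lborel f" and g: "integrable lborel g"
  shows "fourier (convolution f g) \<xi> = fourier f \<xi> * fourier g \<xi>"
proof -
  let ?e = "\<lambda>x::real^2. cis (- (2 * pi * (x \<bullet> \<xi>)))"
  have "?e x * convolution f g x = convolution (\<lambda>x. ?e x * f x) (\<lambda>x. ?e x * g x) x" for x
  proof -
    have "?e x * (f y * g (x - y)) = (?e y * f y) * (?e (x - y) * g (x - y))" for y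
    proof -
      have "?e x = ?e y * ?e (x - y)" by (simp add: cis_mult inner_diff_left algebra_simps)
      then show ?thesis by simp
    qed
    then have "(LINT y|lborel. ?e x * (f y * g (x - y))) = (LINT y|lborel. (?e y * f y) * (?e (x - y) * g (x - y)))"
      by (simp only:)
    then show ?thesis unfolding convolution_def by simp
  qed
  then show ?thesis
    using integral_convolution[OF integrable_fourier_integrand[OF f] integrable_fourier_integrand[OF g]]
    unfolding fourier_def by simp
qed

lemma convolution_commute:
  assumes [measurable]: "f \<in> borel_measurable borel" "g \<in> borel_measurable borel"
  shows "convolution f g = convolution g f"
proof
  fix x
  have "convolution f g x = (LINT y|lborel. (\<lambda>z. f z * g (x - z)) (x - y))"
    unfolding convolution_def by (rule integral_lborel_reflect[symmetric]) simp
  then show "convolution f g x = convolution g f x" by (simp add: convolution_def mult.commute)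
qed

text \<open>
  Dominated convergence after the factors are exchanged, so that the translation acts on the
  continuous bounded one.
\<close>

lemma continuous_on_convolution:
  assumes f: "continuous_on UNIV f" and b: "\<And>x. norm (f x) \<le> B" and g: "integrable lborel g"
  shows "continuous_on UNIV (convolution f g)"
proof -
  have [measurable]: "f \<in> borel_measurable borel" "g \<in> borel_measurable borel"
    using f borel_measurable_integrable[OF g] by (simp_all add: borel_measurable_continuous_onI)
  have "(\<lambda>n. convolution g f (X n)) \<longlonglongrightarrow> convolution g f \<xi>" if "X \<longlonglongrightarrow> \<xi>" for X \<xi>
    unfolding convolution_def
  proof (rule integral_dominated_convergence[where w="\<lambda>x. B * norm (g x)"])
    have "(\<lambda>n. f (X n - x)) \<longlonglongrightarrow> f (\<xi> - x)" for x
      by (rule continuous_on_tendsto_compose[OF f]) (auto intro!: tendsto_intros that)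
    then show "AE x in lborel. (\<lambda>n. g x * f (X n - x)) \<longlonglongrightarrow> g x * f (\<xi> - x)"
      by (auto intro!: tendsto_intros AE_I2)
    show "AE x in lborel. norm (g x * f (X n - x)) \<le> B * norm (g x)" for n
      using b unfolding norm_mult by (intro AE_I2, subst mult.commute) (intro mult_right_mono b norm_ge_zero)
  qed (use g in auto)
  then show ?thesis by (subst convolution_commute) (auto simp: continuous_on_sequentially o_def)
qed

lemma norm_convolution_le:
  assumes f: "f \<in> borel_measurable borel" and b: "\<And>x. norm (f x) \<le> B" and g: "integrable lborel g"
  shows "norm (convolution f g x) \<le> B * (LINT x|lborel. norm (g x))"
proof -
  have [measurable]: "f \<in> borel_measurable borel" "g \<in> borel_measurable borel"
    using f borel_measurable_integrable[OF g] by simp_all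
  have "0 \<le> B" using b[of undefined] norm_ge_zero order_trans by blast
  have "norm (convolution g f x) \<le> (LINT y|lborel. norm (g y * f (x - y)))"
    unfolding convolution_def by (rule integral_norm_bound)
  also have "\<dots> \<le> (LINT y|lborel. B * norm (g y))"
  proof (rule integral_mono')
    show "norm (g y * f (x - y)) \<le> B * norm (g y)" for y
      unfolding norm_mult by (subst mult.commute) (intro mult_right_mono b norm_ge_zero)
  qed (use g \<open>0 \<le> B\<close> in auto)
  finally show ?thesis by (simp add: convolution_commute)
qed

subsection \<open>The multiplication formula\<close>

text \<open>
  Fubini's theorem for the kernel \<open>exp(-2\<pi>i x \<bullet> \<xi>)\<close>. It replaces Fourier inversion throughout.
\<close>

lemma fourier_multiplication_formula:
  fixes f g :: "real^2 \<Rightarrow> complex"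
  assumes f: "integrable lborel f" and g: "integrable lborel g"
  shows "(LINT \<xi>|lborel. fourier f \<xi> * g \<xi>) = (LINT x|lborel. f x * fourier g x)"
proof -
  have [measurable]: "f \<in> borel_measurable borel" "g \<in> borel_measurable borel"
    using borel_measurable_integrable[OF f] borel_measurable_integrable[OF g] by simp_all
  have [measurable]: "(\<lambda>(\<xi>, x). cis (- (2 * pi * (x \<bullet> \<xi>)))) \<in> borel_measurable (borel \<Otimes>\<^sub>M (borel :: (real^2) measure))"
    unfolding borel_prod by (intro borel_measurable_continuous_onI) (auto simp: case_prod_unfold intro!: continuous_intros)
  have int: "integrable (lborel \<Otimes>\<^sub>M lborel) (\<lambda>(x, \<xi>). cis (- (2 * pi * (x \<bullet> \<xi>))) * f x * g \<xi>)"
  proof (rule lborel_pair.Fubini_integrable)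
    show "(\<lambda>(x, \<xi>). cis (- (2 * pi * (x \<bullet> \<xi>))) * f x * g \<xi>) \<in> borel_measurable (lborel \<Otimes>\<^sub>M lborel)"
      by measurable
    show "integrable lborel (\<lambda>x. LINT y|lborel. norm (case (x, y) of (x, \<xi>) \<Rightarrow> cis (- (2 * pi * (x \<bullet> \<xi>))) * f x * g \<xi>))"
      using f by (simp add: norm_mult)
    show "AE x in lborel. integrable lborel (\<lambda>y. case (x, y) of (x, \<xi>) \<Rightarrow> cis (- (2 * pi * (x \<bullet> \<xi>))) * f x * g \<xi>)"
      using integrable_fourier_integrand[OF g] by (intro AE_I2) (auto simp: mult_ac inner_commute)
  qed
  have "(LINT \<xi>|lborel. fourier f \<xi> * g \<xi>) = (LINT \<xi>|lborel. LINT x|lborel. cis (- (2 * pi * (x \<bullet> \<xi>))) * f x * g \<xi>)"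
    by (simp add: fourier_def)
  also have "\<dots> = (LINT x|lborel. LINT \<xi>|lborel. cis (- (2 * pi * (x \<bullet> \<xi>))) * f x * g \<xi>)"
    by (rule lborel_pair.Fubini_integral[OF int])
  also have "\<dots> = (LINT x|lborel. f x * fourier g x)"
  proof (rule Bochner_Integration.integral_cong[OF refl])
    fix x
    have "(LINT \<xi>|lborel. cis (- (2 * pi * (x \<bullet> \<xi>))) * f x * g \<xi>) = (LINT \<xi>|lborel. f x * (cis (- (2 * pi * (\<xi> \<bullet> x))) * g \<xi>))"
      by (simp add: inner_commute mult_ac)
    then show "(LINT \<xi>|lborel. cis (- (2 * pi * (x \<bullet> \<xi>))) * f x * g \<xi>) = f x * fourier g x"
      by (simp add: fourier_def)
  qed
  finally show ?thesis .
qed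

lemma fourier_modulation:
  "fourier (\<lambda>x. cis (2 * pi * (x \<bullet> \<eta>)) * f x) \<xi> = fourier f (\<xi> - \<eta>)"
proof -
  have "cis (- (2 * pi * (x \<bullet> \<xi>))) * (cis (2 * pi * (x \<bullet> \<eta>)) * f x) = cis (- (2 * pi * (x \<bullet> (\<xi> - \<eta>)))) * f x" for x
    unfolding mult.assoc[symmetric] cis_mult by (simp add: inner_diff_right algebra_simps)
  then show ?thesis unfolding fourier_def by (simp only:)
qed

section \<open>Plancherel inequalities\<close>

text \<open>
  Squares avoid the case distinction in \<open>ennsqrt\<close> and are additive over disjoint supports.
\<close>

definition energy :: "(real^2 \<Rightarrow> 'b::real_normed_vector) \<Rightarrow> ennreal" where
  "energy f = (\<integral>\<^sup>+ x. ennreal ((norm (f x))\<^sup>2) \<partial>lborel)"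

lemma ennsqrt_power2: "(ennsqrt a)\<^sup>2 = a"
  by (cases a) (auto simp: ennsqrt_def ennreal_power top_power_ennreal)

lemma ennsqrt_le: "a \<le> ennreal (c\<^sup>2) \<Longrightarrow> 0 \<le> c \<Longrightarrow> ennsqrt a \<le> ennreal c"
  by (cases a) (auto simp: ennsqrt_def top_unique intro!: ennreal_leI real_le_lsqrt)

lemma L2_norm_power2: "(L2_norm f)\<^sup>2 = energy f"
  by (simp add: L2_norm_def energy_def ennsqrt_power2)

lemma L2_norm_le: "energy f \<le> ennreal (c\<^sup>2) \<Longrightarrow> 0 \<le> c \<Longrightarrow> L2_norm f \<le> ennreal c"
  unfolding L2_norm_def energy_def[symmetric] by (rule ennsqrt_le)

lemma L2_norm_finite_iff: "L2_norm f < top \<longleftrightarrow> energy f < top"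
  unfolding L2_norm_def energy_def[symmetric] by (auto simp: ennsqrt_def less_top)

lemma energy_mono: "(\<And>x. norm (f x) \<le> norm (g x)) \<Longrightarrow> energy f \<le> energy g"
  unfolding energy_def by (intro nn_integral_mono ennreal_leI power_mono) auto

lemma energy_cong: "(\<And>x. norm (f x) = norm (g x)) \<Longrightarrow> energy f = energy g"
  unfolding energy_def by simp

lemma energy_triangle:
  assumes [measurable]: "f \<in> borel_measurable borel" "g \<in> borel_measurable borel"
    and h: "\<And>x. norm (h x) \<le> norm (f x) + norm (g x)"
  shows "energy h \<le> 2 * energy f + 2 * energy g"
proof -
  have "energy h \<le> (\<integral>\<^sup>+ x. (2 * ennreal ((norm (f x))\<^sup>2) + 2 * ennreal ((norm (g x))\<^sup>2)) \<partial>lborel)"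
    unfolding energy_def
  proof (rule nn_integral_mono)
    fix x
    have "(norm (h x))\<^sup>2 \<le> (norm (f x) + norm (g x))\<^sup>2" by (intro power_mono h norm_ge_zero)
    also have "\<dots> \<le> 2 * (norm (f x))\<^sup>2 + 2 * (norm (g x))\<^sup>2"
      using zero_le_power2[of "norm (f x) - norm (g x)"] by (simp add: power2_eq_square algebra_simps)
    finally have "ennreal ((norm (h x))\<^sup>2) \<le> ennreal (2 * (norm (f x))\<^sup>2 + 2 * (norm (g x))\<^sup>2)" by (rule ennreal_leI)
    then show "ennreal ((norm (h x))\<^sup>2) \<le> 2 * ennreal ((norm (f x))\<^sup>2) + 2 * ennreal ((norm (g x))\<^sup>2)"
      by (simp add: ennreal_plus ennreal_mult)
  qed
  also have "\<dots> = 2 * energy f + 2 * energy g"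
    unfolding energy_def by (simp add: nn_integral_add nn_integral_cmult)
  finally show ?thesis .
qed

lemma energy_triangle3:
  assumes [measurable]: "f \<in> borel_measurable borel" "g \<in> borel_measurable borel" "k \<in> borel_measurable borel"
    and h: "AE x in lborel. norm (h x) \<le> norm (f x) + norm (g x) + norm (k x)"
  shows "energy h \<le> 3 * energy f + 3 * energy g + 3 * energy k"
proof -
  have "energy h \<le> (\<integral>\<^sup>+ x. (3 * ennreal ((norm (f x))\<^sup>2) + 3 * ennreal ((norm (g x))\<^sup>2) + 3 * ennreal ((norm (k x))\<^sup>2)) \<partial>lborel)"
    unfolding energy_def
  proof (rule nn_integral_mono_AE, use h in eventually_elim)
    fix x assume hx: "norm (h x) \<le> norm (f x) + norm (g x) + norm (k x)"
    have "(norm (h x))\<^sup>2 \<le> (norm (f x) + norm (g x) + norm (k x))\<^sup>2" by (intro power_mono hx norm_ge_zero)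
    also have "\<dots> \<le> 3 * (norm (f x))\<^sup>2 + 3 * (norm (g x))\<^sup>2 + 3 * (norm (k x))\<^sup>2"
      using zero_le_power2[of "norm (f x) - norm (g x)"] zero_le_power2[of "norm (f x) - norm (k x)"]
        zero_le_power2[of "norm (g x) - norm (k x)"] by (simp add: power2_eq_square algebra_simps)
    finally have "ennreal ((norm (h x))\<^sup>2) \<le> ennreal (3 * (norm (f x))\<^sup>2 + 3 * (norm (g x))\<^sup>2 + 3 * (norm (k x))\<^sup>2)" by (rule ennreal_leI)
    then show "ennreal ((norm (h x))\<^sup>2) \<le> 3 * ennreal ((norm (f x))\<^sup>2) + 3 * ennreal ((norm (g x))\<^sup>2) + 3 * ennreal ((norm (k x))\<^sup>2)"
      by (simp add: ennreal_plus ennreal_mult)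
  qed
  also have "\<dots> = 3 * energy f + 3 * energy g + 3 * energy k"
    unfolding energy_def by (simp add: nn_integral_add nn_integral_cmult)
  finally show ?thesis .
qed

text \<open>
  Damping the inverse Fourier integral by a Gaussian amounts to convolving with a Gaussian of mass
  1: apply the multiplication formula to a modulated Gaussian, whose transform is known.
\<close>

lemma fourier_gaussian_smoothing:
  assumes f: "integrable lborel f" and e: "e > 0"
  shows "(LINT \<xi>|lborel. fourier f \<xi> * (cis (2 * pi * (\<xi> \<bullet> x)) * complex_of_real (gaussian e \<xi>))) =
         (LINT y|lborel. f y * complex_of_real (gaussian (1 / e) (y - x) / e))"
proof -
  have "integrable lborel (\<lambda>\<xi>. cis (2 * pi * (\<xi> \<bullet> x)) * complex_of_real (gaussian e \<xi>))"
    using e by (intro integrable_bounded_mult[where B=1] integrable_gaussian_complex)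
      (auto intro!: borel_measurable_continuous_onI continuous_intros)
  from fourier_multiplication_formula[OF f this] show ?thesis
    using e by (simp add: fourier_modulation fourier_gaussian)
qed

lemma nn_integral_gaussian_kernel:
  assumes "e > 0"
  shows "(\<integral>\<^sup>+ y. ennreal (gaussian (1 / e) (y - x) / e) \<partial>lborel) = 1"
    and "(\<integral>\<^sup>+ x. ennreal (gaussian (1 / e) (y - x) / e) \<partial>lborel) = 1"
proof -
  have 0: "(\<integral>\<^sup>+ y. ennreal (gaussian (1 / e) y / e) \<partial>lborel) = 1"
    using assms by (simp add: divide_ennreal[symmetric] nn_integral_divide nn_integral_gaussian ennreal_divide_self)
  show "(\<integral>\<^sup>+ y. ennreal (gaussian (1 / e) (y - x) / e) \<partial>lborel) = 1"
    using nn_integral_lborel_translate[of "\<lambda>y. ennreal (gaussian (1 / e) y / e)" "- x"] 0 by simp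
  show "(\<integral>\<^sup>+ x. ennreal (gaussian (1 / e) (y - x) / e) \<partial>lborel) = 1"
    using nn_integral_lborel_reflect[of "\<lambda>y. ennreal (gaussian (1 / e) y / e)" y] 0 by simp
qed

text \<open>
  By the smoothing identity, the damped energy of the Fourier transform equals the double integral
  of \<open>f(x) cnj(f(y)) K(y - x)\<close>, where \<open>K\<close> is a Gaussian of mass 1. Since
  \<open>|f(x) f(y)| \<le> |f(x)|\<^sup>2/2 + |f(y)|\<^sup>2/2\<close>, integrating out the free variable leaves the energy of
  \<open>f\<close>.
\<close>

lemma energy_fourier_damped_le:
  assumes f: "integrable lborel f" and e: "e > 0"
  shows "(\<integral>\<^sup>+ \<xi>. ennreal ((norm (fourier f \<xi>))\<^sup>2 * gaussian e \<xi>) \<partial>lborel) \<le> energy f"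
proof -
  have [measurable]: "f \<in> borel_measurable borel" using borel_measurable_integrable[OF f] by simp
  have [measurable]: "fourier f \<in> borel_measurable borel" by (rule fourier_measurable[OF f])
  let ?N = "LINT x|lborel. norm (f x)"
  let ?K = "\<lambda>z. gaussian (1 / e) z / e"
  \<comment> \<open>With this weight, the damped energy is the integral of the transform of \<open>f\<close> against \<open>\<phi>\<close>, to which
    the multiplication formula applies.\<close>
  define \<phi> where "\<phi> \<xi> = cnj (fourier f \<xi>) * complex_of_real (gaussian e \<xi>)" for \<xi>
  have \<phi>: "integrable lborel \<phi>" unfolding \<phi>_def
    using e norm_fourier_le[OF f] by (intro integrable_bounded_mult[where B="?N"] integrable_gaussian_complex)
      (auto intro!: borel_measurable_continuous_onI continuous_intros continuous_on_fourier[OF f])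
  have ff: "fourier f \<xi> * \<phi> \<xi> = complex_of_real ((norm (fourier f \<xi>))\<^sup>2 * gaussian e \<xi>)" for \<xi>
    unfolding \<phi>_def mult.assoc[symmetric] complex_norm_square[symmetric] by simp
  have "integrable lborel (\<lambda>\<xi>. fourier f \<xi> * \<phi> \<xi>)"
    using norm_fourier_le[OF f] by (intro integrable_bounded_mult[where B="?N"] \<phi>) auto
  then have int: "integrable lborel (\<lambda>\<xi>. (norm (fourier f \<xi>))\<^sup>2 * gaussian e \<xi>)"
    unfolding ff by (simp only: complex_of_real_integrable_eq)
  have \<phi>x: "fourier \<phi> x = cnj (LINT y|lborel. f y * complex_of_real (?K (y - x)))" for x
  proof -
    have "fourier \<phi> x = (LINT \<xi>|lborel. cnj (fourier f \<xi> * (cis (2 * pi * (\<xi> \<bullet> x)) * complex_of_real (gaussian e \<xi>))))"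
      unfolding fourier_def[of \<phi>] \<phi>_def by (simp add: cis_cnj mult_ac)
    also have "\<dots> = cnj (LINT \<xi>|lborel. fourier f \<xi> * (cis (2 * pi * (\<xi> \<bullet> x)) * complex_of_real (gaussian e \<xi>)))"
      by (rule Bochner_Integration.integral_cnj)
    finally show ?thesis by (simp only: fourier_gaussian_smoothing[OF f e])
  qed
  have Kint: "integrable lborel (\<lambda>y. f y * complex_of_real (?K (y - x)))" for x
  proof -
    have "integrable lborel (\<lambda>y. complex_of_real (?K (y - x)) * f y)"
      using e by (intro integrable_bounded_mult[where B="1/e"] f) (auto simp: norm_divide gaussian_le_1 divide_right_mono)
    then show ?thesis by (simp add: mult.commute)
  qed
  have "(\<integral>\<^sup>+ \<xi>. ennreal ((norm (fourier f \<xi>))\<^sup>2 * gaussian e \<xi>) \<partial>lborel) = ennreal (LINT \<xi>|lborel. (norm (fourier f \<xi>))\<^sup>2 * gaussian e \<xi>)"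
    by (rule nn_integral_eq_integral[OF int]) auto
  also have "(LINT \<xi>|lborel. (norm (fourier f \<xi>))\<^sup>2 * gaussian e \<xi>) = norm (LINT \<xi>|lborel. fourier f \<xi> * \<phi> \<xi>)"
    unfolding ff integral_complex_of_real by (simp add: Bochner_Integration.integral_nonneg)
  also have "\<dots> = norm (LINT x|lborel. f x * fourier \<phi> x)"
    by (simp only: fourier_multiplication_formula[OF f \<phi>])
  also have "ennreal \<dots> \<le> (\<integral>\<^sup>+ x. ennreal (norm (f x * fourier \<phi> x)) \<partial>lborel)"
  proof (rule integral_norm_bound_ennreal)
    have "integrable lborel (\<lambda>x. fourier \<phi> x * f x)"
      by (rule integrable_bounded_mult[OF f fourier_measurable[OF \<phi>] norm_fourier_le[OF \<phi>]])
    then show "integrable lborel (\<lambda>x. f x * fourier \<phi> x)" by (simp add: mult.commute)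
  qed
  also have "\<dots> \<le> (\<integral>\<^sup>+ x. (\<integral>\<^sup>+ y. ennreal (norm (f x)) * ennreal (norm (f y) * ?K (y - x)) \<partial>lborel) \<partial>lborel)"
  proof (rule nn_integral_mono)
    fix x
    have "ennreal (norm (fourier \<phi> x)) \<le> (\<integral>\<^sup>+ y. ennreal (norm (f y * complex_of_real (?K (y - x)))) \<partial>lborel)"
      unfolding \<phi>x complex_mod_cnj by (rule integral_norm_bound_ennreal[OF Kint])
    also have "\<dots> = (\<integral>\<^sup>+ y. ennreal (norm (f y) * ?K (y - x)) \<partial>lborel)"
      using e by (simp add: norm_mult norm_divide)
    finally show "ennreal (norm (f x * fourier \<phi> x)) \<le> (\<integral>\<^sup>+ y. ennreal (norm (f x)) * ennreal (norm (f y) * ?K (y - x)) \<partial>lborel)"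
      by (simp add: norm_mult ennreal_mult nn_integral_cmult mult_left_mono)
  qed
  also have "\<dots> \<le> (\<integral>\<^sup>+ x. (\<integral>\<^sup>+ y. ennreal (1/2) * (ennreal ((norm (f x))\<^sup>2) * ennreal (?K (y - x)))
      + ennreal (1/2) * (ennreal ((norm (f y))\<^sup>2) * ennreal (?K (y - x))) \<partial>lborel) \<partial>lborel)"
  proof (intro nn_integral_mono)
    fix x y
    have K: "?K (y - x) \<ge> 0" using e by simp
    have "norm (f x) * norm (f y) \<le> 1/2 * (norm (f x))\<^sup>2 + 1/2 * (norm (f y))\<^sup>2"
      using zero_le_power2[of "norm (f x) - norm (f y)"] by (simp add: power2_eq_square algebra_simps)
    from mult_right_mono[OF this K]
    have "norm (f x) * (norm (f y) * ?K (y - x)) \<le> 1/2 * ((norm (f x))\<^sup>2 * ?K (y - x)) + 1/2 * ((norm (f y))\<^sup>2 * ?K (y - x))"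
      by (simp only: distrib_right mult.assoc)
    then have "ennreal (norm (f x) * (norm (f y) * ?K (y - x))) \<le> ennreal (1/2 * ((norm (f x))\<^sup>2 * ?K (y - x)) + 1/2 * ((norm (f y))\<^sup>2 * ?K (y - x)))"
      by (rule ennreal_leI)
    also have "\<dots> = ennreal (1/2) * (ennreal ((norm (f x))\<^sup>2) * ennreal (?K (y - x)))
      + ennreal (1/2) * (ennreal ((norm (f y))\<^sup>2) * ennreal (?K (y - x)))"
      using K by (simp only: ennreal_plus ennreal_mult zero_le_power2 mult_nonneg_nonneg zero_le_divide_1_iff zero_le_numeral)
    finally show "ennreal (norm (f x)) * ennreal (norm (f y) * ?K (y - x)) \<le> ennreal (1/2) * (ennreal ((norm (f x))\<^sup>2) * ennreal (?K (y - x)))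
      + ennreal (1/2) * (ennreal ((norm (f y))\<^sup>2) * ennreal (?K (y - x)))"
      using K by (simp only: ennreal_mult norm_ge_zero mult_nonneg_nonneg)
  qed
  also have "\<dots> = ennreal (1/2) * energy f + ennreal (1/2) * (\<integral>\<^sup>+ x. (\<integral>\<^sup>+ y. ennreal ((norm (f y))\<^sup>2) * ennreal (?K (y - x)) \<partial>lborel) \<partial>lborel)"
    by (simp add: nn_integral_add nn_integral_cmult energy_def nn_integral_gaussian_kernel[OF e])
  also have "(\<integral>\<^sup>+ x. (\<integral>\<^sup>+ y. ennreal ((norm (f y))\<^sup>2) * ennreal (?K (y - x)) \<partial>lborel) \<partial>lborel) = (\<integral>\<^sup>+ y. (\<integral>\<^sup>+ x. ennreal ((norm (f y))\<^sup>2) * ennreal (?K (y - x)) \<partial>lborel) \<partial>lborel)"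
    by (rule lborel_pair.Fubini') simp
  also have "\<dots> = energy f"
    by (simp add: nn_integral_cmult energy_def nn_integral_gaussian_kernel[OF e])
  also have "ennreal (1/2) * energy f + ennreal (1/2) * energy f = energy f"
  proof -
    have "ennreal (1/2) + ennreal (1/2) = 1" by (subst ennreal_plus[symmetric]) auto
    then show ?thesis unfolding distrib_right[symmetric] by simp
  qed
  finally show ?thesis .
qed

lemma nn_integral_Fatou_bound:
  assumes [measurable]: "\<And>n. u n \<in> borel_measurable M"
    and lim: "\<And>x. (\<lambda>n. u n x) \<longlonglongrightarrow> v x" and b: "\<And>n. (\<integral>\<^sup>+ x. u n x \<partial>M) \<le> (c::ennreal)"
  shows "(\<integral>\<^sup>+ x. v x \<partial>M) \<le> c"
proof -
  have "(\<integral>\<^sup>+ x. v x \<partial>M) = (\<integral>\<^sup>+ x. liminf (\<lambda>n. u n x) \<partial>M)"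
    using lim_imp_Liminf[OF _ lim] by simp
  also have "\<dots> \<le> liminf (\<lambda>n. \<integral>\<^sup>+ x. u n x \<partial>M)" by (rule nn_integral_liminf) simp
  also have "\<dots> \<le> liminf (\<lambda>n::nat. c)" by (intro Liminf_mono always_eventually allI b)
  finally show ?thesis by (simp add: Liminf_const)
qed

text \<open>
  Let the damping tend to 0 and apply Fatou's lemma.
\<close>

lemma energy_fourier_le:
  assumes f: "integrable lborel f"
  shows "energy (fourier f) \<le> energy f"
  unfolding energy_def[of "fourier f"]
proof (rule nn_integral_Fatou_bound)
  show "(\<integral>\<^sup>+ \<xi>. ennreal ((norm (fourier f \<xi>))\<^sup>2 * gaussian (1 / real (Suc n)) \<xi>) \<partial>lborel) \<le> energy f" for n
    by (rule energy_fourier_damped_le[OF f]) simp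
  fix \<xi> :: "real^2"
  have "(\<lambda>n. gaussian (1 / real (Suc n)) \<xi>) \<longlonglongrightarrow> exp (- (pi * 0 * (norm \<xi>)\<^sup>2))"
    unfolding gaussian_def using LIMSEQ_inverse_real_of_nat by (intro tendsto_intros) (simp add: inverse_eq_divide)
  then have "(\<lambda>n. ennreal ((norm (fourier f \<xi>))\<^sup>2 * gaussian (1 / real (Suc n)) \<xi>)) \<longlonglongrightarrow> ennreal ((norm (fourier f \<xi>))\<^sup>2 * 1)"
    by (intro tendsto_intros) simp
  then show "(\<lambda>n. ennreal ((norm (fourier f \<xi>))\<^sup>2 * gaussian (1 / real (Suc n)) \<xi>)) \<longlonglongrightarrow> ennreal ((norm (fourier f \<xi>))\<^sup>2)"
    by simp
qed (use fourier_measurable[OF f] in measurable)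

lemma integral_lborel_scale:
  fixes f :: "real^2 \<Rightarrow> 'b::{banach, second_countable_topology}"
  assumes [measurable]: "f \<in> borel_measurable borel" and c: "c > 0"
  shows "(LINT y|lborel. f y) = (LINT z|lborel. c\<^sup>2 *\<^sub>R f (t + c *\<^sub>R z))"
proof -
  have "(LINT y|lborel. f y) = (LINT y|density (distr lborel borel (\<lambda>z. t + c *\<^sub>R z)) (\<lambda>_. ennreal (\<bar>c\<bar> ^ DIM(real^2))). f y)"
    using lborel_affine[of c t] c by simp
  also have "\<dots> = (LINT z|lborel. c\<^sup>2 *\<^sub>R f (t + c *\<^sub>R z))"
    using c by (subst integral_density) (auto simp: integral_distr)
  finally show ?thesis .
qed

text \<open>
  Substituting \<open>y = x + cz\<close> with \<open>c\<^sup>2 = e n\<close> turns the kernel into a fixed Gaussian, and dominated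
  convergence applies. The squares in \<open>e\<close> avoid square roots in this substitution.
\<close>

lemma gaussian_mollification_tendsto:
  assumes f: "continuous_on UNIV f" and b: "\<And>x. norm (f x) \<le> B"
  defines "e \<equiv> \<lambda>n. (1 / real (Suc n))\<^sup>2"
  shows "(\<lambda>n. LINT y|lborel. f y * complex_of_real (gaussian (1 / e n) (y - x) / e n)) \<longlonglongrightarrow> f x"
proof -
  have [measurable]: "f \<in> borel_measurable borel" using f by (rule borel_measurable_continuous_onI)
  have gen: "(LINT y|lborel. f y * complex_of_real (gaussian (1 / c\<^sup>2) (y - x) / c\<^sup>2)) =
     (LINT z|lborel. f (x + c *\<^sub>R z) * complex_of_real (gaussian 1 z))" if c: "c > 0" for c
  proof -
    have "gaussian (1 / c\<^sup>2) (c *\<^sub>R z) = gaussian 1 z" for z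
      unfolding gaussian_def using c by (simp add: power_mult_distrib field_simps)
    then show ?thesis using c
      by (subst integral_lborel_scale[where c=c and t=x]) (auto simp: scaleR_conv_of_real)
  qed
  let ?c = "\<lambda>n. 1 / real (Suc n)"
  have "(LINT y|lborel. f y * complex_of_real (gaussian (1 / e n) (y - x) / e n)) =
     (LINT z|lborel. f (x + ?c n *\<^sub>R z) * complex_of_real (gaussian 1 z))" for n
    unfolding e_def by (rule gen) simp
  moreover have "(\<lambda>n. LINT z|lborel. f (x + ?c n *\<^sub>R z) * complex_of_real (gaussian 1 z)) \<longlonglongrightarrow> (LINT z|lborel. f x * complex_of_real (gaussian 1 z))"
  proof (rule integral_dominated_convergence[where w="\<lambda>z. B * gaussian 1 z"])
    show "AE z in lborel. (\<lambda>n. f (x + ?c n *\<^sub>R z) * complex_of_real (gaussian 1 z)) \<longlonglongrightarrow> f x * complex_of_real (gaussian 1 z)"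
    proof (intro AE_I2 tendsto_intros continuous_on_tendsto_compose[OF f])
      fix z :: "real^2"
      have "(\<lambda>n. x + ?c n *\<^sub>R z) \<longlonglongrightarrow> x + 0 *\<^sub>R z"
        using LIMSEQ_inverse_real_of_nat by (intro tendsto_intros) (simp add: inverse_eq_divide)
      then show "(\<lambda>n. x + ?c n *\<^sub>R z) \<longlonglongrightarrow> x" by simp
    qed auto
    show "AE z in lborel. norm (f (x + ?c n *\<^sub>R z) * complex_of_real (gaussian 1 z)) \<le> B * gaussian 1 z" for n
      using b by (intro AE_I2) (auto simp: norm_mult intro!: mult_right_mono)
  qed (auto intro!: integrable_gaussian)
  moreover have "(LINT z|lborel. f x * complex_of_real (gaussian 1 z)) = f x"
    by (simp add: integral_gaussian)
  ultimately show ?thesis by (simp only:)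
qed

text \<open>
  A Gaussian mollification of \<open>f\<close> is the reflected Fourier transform of the damped Fourier
  transform of \<open>f\<close>, so the opposite inequality bounds its energy by that of the Fourier transform.
  The mollifications converge pointwise because \<open>f\<close> is continuous, and Fatou's lemma gives the
  claim. Continuity thus takes the place of approximation in \<open>L\<^sup>2\<close>.
\<close>

lemma energy_le_energy_fourier:
  assumes f: "continuous_on UNIV f" and b: "\<And>x. norm (f x) \<le> B" and i: "integrable lborel f"
  shows "energy f \<le> energy (fourier f)"
  unfolding energy_def[of f]
proof (rule nn_integral_Fatou_bound)
  let ?e = "\<lambda>n. (1 / real (Suc n))\<^sup>2"
  have [measurable]: "fourier f \<in> borel_measurable borel" by (rule fourier_measurable[OF i])
  let ?h = "\<lambda>n x. LINT y|lborel. f y * complex_of_real (gaussian (1 / ?e n) (y - x) / ?e n)"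
  let ?g = "\<lambda>n \<xi>. fourier f \<xi> * complex_of_real (gaussian (?e n) \<xi>)"
  have g: "integrable lborel (?g n)" for n
    by (rule integrable_bounded_mult[OF integrable_gaussian_complex _ norm_fourier_le[OF i]]) auto
  have h: "?h n x = fourier (?g n) (- x)" for n x
  proof -
    have "?h n x = (LINT \<xi>|lborel. fourier f \<xi> * (cis (2 * pi * (\<xi> \<bullet> x)) * complex_of_real (gaussian (?e n) \<xi>)))"
      by (rule fourier_gaussian_smoothing[OF i, symmetric]) simp
    then show ?thesis by (simp only: fourier_def[of "?g n"] inner_minus_right mult_minus_right minus_minus mult_ac)
  qed
  show "(\<lambda>x. ennreal ((norm (?h n x))\<^sup>2)) \<in> borel_measurable lborel" for n
    unfolding h using fourier_measurable[OF g, of n] by measurable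
  show "(\<lambda>n. ennreal ((norm (?h n x))\<^sup>2)) \<longlonglongrightarrow> ennreal ((norm (f x))\<^sup>2)" for x
    by (intro tendsto_intros gaussian_mollification_tendsto[OF f b])
  show "(\<integral>\<^sup>+ x. ennreal ((norm (?h n x))\<^sup>2) \<partial>lborel) \<le> energy (fourier f)" for n
  proof -
    have "(\<integral>\<^sup>+ x. ennreal ((norm (?h n x))\<^sup>2) \<partial>lborel) = energy (fourier (?g n))"
      unfolding h energy_def using fourier_measurable[OF g, of n]
        nn_integral_lborel_reflect[of "\<lambda>x. ennreal ((norm (fourier (?g n) x))\<^sup>2)" 0] by simp
    also have "\<dots> \<le> energy (?g n)" by (rule energy_fourier_le[OF g])
    also have "\<dots> \<le> energy (fourier f)"
      by (rule energy_mono) (auto simp: norm_mult gaussian_le_1 intro!: mult_left_le)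
    finally show ?thesis .
  qed
qed

lemma energy_convolution_le:
  assumes f: "continuous_on UNIV f" and b: "\<And>x. norm (f x) \<le> B" and i: "integrable lborel f" and g: "integrable lborel g"
  shows "energy (convolution f g) \<le> energy (\<lambda>\<xi>. fourier f \<xi> * fourier g \<xi>)"
proof -
  have "energy (convolution f g) \<le> energy (fourier (convolution f g))"
    by (rule energy_le_energy_fourier[OF continuous_on_convolution[OF f b g] norm_convolution_le[OF _ b g] integrable_convolution[OF i g]])
      (use f in \<open>auto intro: borel_measurable_continuous_onI\<close>)
  then show ?thesis by (simp only: fourier_convolution[OF i g] cong: energy_cong)
qed

section \<open>The Fourier transform on square-integrable functions\<close>

lemma L2_norm_tendsto_0:
  assumes "(\<lambda>n. energy (F n)) \<longlonglongrightarrow> 0"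
  shows "(\<lambda>n. L2_norm (F n)) \<longlonglongrightarrow> 0"
proof (rule order_tendstoI)
  fix a :: ennreal assume a: "0 < a"
  obtain e where e: "0 < e" "ennreal e < a"
  proof -
    obtain b where "0 < b" "b < a" using dense[OF a] by blast
    then show ?thesis using that[of "enn2real b"] by (cases b) (auto simp: top_unique)
  qed
  have "\<forall>\<^sub>F n in sequentially. energy (F n) < ennreal (e\<^sup>2)"
    using order_tendstoD(2)[OF assms, of "ennreal (e\<^sup>2)"] e by simp
  then show "\<forall>\<^sub>F n in sequentially. L2_norm (F n) < a"
    by eventually_elim (use e L2_norm_le[of _ e] in \<open>meson le_less_trans less_imp_le\<close>)
qed simp

text \<open>
  The ordinary transform is an \<open>L\<^sup>2\<close>-limit of the transforms of the truncations, because the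
  transform does not increase the \<open>L\<^sup>2\<close>-norm and the truncated parts tend to 0. Such a limit is
  unique up to null sets.
\<close>

lemma L2_fourier_AE:
  assumes f: "integrable lborel f" and fin: "energy f < \<infinity>"
  shows "AE \<xi> in lborel. L2_fourier f \<xi> = fourier f \<xi>"
proof -
  have [measurable]: "f \<in> borel_measurable borel" using borel_measurable_integrable[OF f] by simp
  let ?t = "\<lambda>n x. indicator (ball 0 (real n)) x *\<^sub>R f x"
  have t: "integrable lborel (?t n)" for n
    by (rule Bochner_Integration.integrable_bound[OF f]) (auto simp: indicator_def)
  have [measurable]: "?t n \<in> borel_measurable borel" for n using borel_measurable_integrable[OF t] by simp
  have [measurable]: "fourier (?t n) \<in> borel_measurable borel" for n by (rule fourier_measurable[OF t])
  have [measurable]: "fourier f \<in> borel_measurable borel" by (rule fourier_measurable[OF f])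
  define P where "P g \<longleftrightarrow> g \<in> L2_space \<and> (\<lambda>n. L2_norm (\<lambda>\<xi>. fourier (?t n) \<xi> - g \<xi>)) \<longlonglongrightarrow> 0" for g
  have Pf: "P (fourier f)" unfolding P_def
  proof
    have "energy (fourier f) < \<infinity>" using energy_fourier_le[OF f] fin by (rule le_less_trans)
    then show "fourier f \<in> L2_space" by (simp add: L2_space_def L2_norm_finite_iff)
    have "(\<lambda>n. energy (\<lambda>x. ?t n x - f x)) \<longlonglongrightarrow> (\<integral>\<^sup>+ (x::real^2). 0 \<partial>lborel)"
      unfolding energy_def
    proof (rule nn_integral_dominated_convergence[where w="\<lambda>x. ennreal ((norm (f x))\<^sup>2)"])
      show "(\<integral>\<^sup>+ x. ennreal ((norm (f x))\<^sup>2) \<partial>lborel) < \<infinity>" using fin by (simp add: energy_def)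
      show "AE x in lborel. ennreal ((norm (?t n x - f x))\<^sup>2) \<le> ennreal ((norm (f x))\<^sup>2)" for n
        by (auto simp: indicator_def)
      show "AE x in lborel. (\<lambda>n. ennreal ((norm (?t n x - f x))\<^sup>2)) \<longlonglongrightarrow> 0"
      proof (rule AE_I2)
        fix x :: "real^2"
        obtain N where N: "norm x < real N" using reals_Archimedean2 by blast
        have "\<forall>\<^sub>F n in sequentially. ennreal ((norm (?t n x - f x))\<^sup>2) = 0"
          using eventually_ge_at_top[of N] by eventually_elim (use N in \<open>auto simp: indicator_def\<close>)
        then show "(\<lambda>n. ennreal ((norm (?t n x - f x))\<^sup>2)) \<longlonglongrightarrow> 0" by (rule tendsto_eventually)
      qed
      show "(\<lambda>x. ennreal ((norm (?t n x - f x))\<^sup>2)) \<in> borel_measurable lborel" for n by measurable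
    qed auto
    then have lim: "(\<lambda>n. energy (\<lambda>x. ?t n x - f x)) \<longlonglongrightarrow> 0" by simp
    have "energy (\<lambda>\<xi>. fourier (?t n) \<xi> - fourier f \<xi>) \<le> energy (\<lambda>x. ?t n x - f x)" for n
      unfolding fourier_diff[OF t f, symmetric] by (intro energy_fourier_le Bochner_Integration.integrable_diff t f)
    then have "(\<lambda>n. energy (\<lambda>\<xi>. fourier (?t n) \<xi> - fourier f \<xi>)) \<longlonglongrightarrow> 0"
      by (intro tendsto_sandwich[OF _ _ tendsto_const lim]) auto
    then show "(\<lambda>n. L2_norm (\<lambda>\<xi>. fourier (?t n) \<xi> - fourier f \<xi>)) \<longlonglongrightarrow> 0"
      by (rule L2_norm_tendsto_0)
  qed
  define g where "g = L2_fourier f"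
  have "P g" unfolding g_def L2_fourier_def P_def[symmetric] by (rule someI[of P, OF Pf])
  have [measurable]: "g \<in> borel_measurable borel" using \<open>P g\<close> by (simp add: P_def L2_space_def)
  have le: "energy (\<lambda>\<xi>. g \<xi> - fourier f \<xi>) \<le> ennreal e" if e: "e > 0" for e
  proof -
    let ?d = "sqrt (e / 4)"
    have "\<forall>\<^sub>F n in sequentially. L2_norm (\<lambda>\<xi>. fourier (?t n) \<xi> - h \<xi>) < ennreal ?d" if "P h" for h
      using order_tendstoD(2)[of "\<lambda>n. L2_norm (\<lambda>\<xi>. fourier (?t n) \<xi> - h \<xi>)" 0 sequentially "ennreal ?d"] that e
      by (simp add: P_def)
    from eventually_conj[OF this[OF \<open>P g\<close>] this[OF Pf]] obtain n where
      n: "L2_norm (\<lambda>\<xi>. fourier (?t n) \<xi> - g \<xi>) < ennreal ?d" "L2_norm (\<lambda>\<xi>. fourier (?t n) \<xi> - fourier f \<xi>) < ennreal ?d"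
      by (auto dest: eventually_happens)
    have sq: "energy h \<le> ennreal (e / 4)" if "L2_norm h < ennreal ?d" for h :: "real^2 \<Rightarrow> complex"
    proof -
      have "(L2_norm h)\<^sup>2 \<le> (ennreal ?d)\<^sup>2" using that by (intro power_mono) auto
      then show ?thesis using e by (simp add: L2_norm_power2 ennreal_power)
    qed
    have "energy (\<lambda>\<xi>. g \<xi> - fourier f \<xi>) \<le> 2 * energy (\<lambda>\<xi>. fourier (?t n) \<xi> - g \<xi>) + 2 * energy (\<lambda>\<xi>. fourier (?t n) \<xi> - fourier f \<xi>)"
    proof (rule energy_triangle)
      fix \<xi>
      show "norm (g \<xi> - fourier f \<xi>) \<le> norm (fourier (?t n) \<xi> - g \<xi>) + norm (fourier (?t n) \<xi> - fourier f \<xi>)"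
        by (simp only: dist_norm[symmetric] dist_triangle3)
    qed auto
    also have "\<dots> \<le> 2 * ennreal (e / 4) + 2 * ennreal (e / 4)"
      by (intro add_mono mult_left_mono sq n) auto
    also have "\<dots> = ennreal e"
    proof -
      have "(2::ennreal) * ennreal (e / 4) = ennreal (2 * (e / 4))" using e by (subst ennreal_mult) auto
      then show ?thesis using e by (simp flip: ennreal_plus)
    qed
    finally show ?thesis .
  qed
  have "energy (\<lambda>\<xi>. g \<xi> - fourier f \<xi>) = 0"
  proof (rule ccontr)
    assume "energy (\<lambda>\<xi>. g \<xi> - fourier f \<xi>) \<noteq> 0"
    moreover have "energy (\<lambda>\<xi>. g \<xi> - fourier f \<xi>) < \<infinity>" using le[of 1] by (auto intro: le_less_trans)
    ultimately obtain r where r: "energy (\<lambda>\<xi>. g \<xi> - fourier f \<xi>) = ennreal r" "r > 0"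
      by (cases "energy (\<lambda>\<xi>. g \<xi> - fourier f \<xi>)") (auto simp: less_le)
    then show False using le[of "r / 2"] by simp
  qed
  then have "AE \<xi> in lborel. ennreal ((norm (g \<xi> - fourier f \<xi>))\<^sup>2) = 0"
    unfolding energy_def by (subst (asm) nn_integral_0_iff_AE) auto
  then show ?thesis unfolding g_def by (auto elim!: eventually_mono)
qed

lemma Hs_norm_eq:
  assumes f: "integrable lborel f" and fin: "energy f < \<infinity>"
  shows "Hs_norm s f = L2_norm (\<lambda>\<xi>. ((1 + (norm \<xi>)\<^sup>2) powr (s / 2)) *\<^sub>R fourier f \<xi>)"
  unfolding Hs_norm_def L2_norm_def
  by (rule arg_cong[where f=ennsqrt], rule nn_integral_cong_AE) (use L2_fourier_AE[OF f fin] in \<open>auto elim!: eventually_mono\<close>)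

section \<open>Gaussian wave packets\<close>

text \<open>
  Both the packet and its Fourier transform are Gaussians up to a modulation: the packet has
  spatial width of order \<open>1/sqrt a\<close> and occupies frequencies within order \<open>sqrt a\<close> of \<open>\<eta>\<close>.
\<close>

definition wave_packet :: "real \<Rightarrow> real^2 \<Rightarrow> real^2 \<Rightarrow> complex" where
  "wave_packet a \<eta> x = cis (2 * pi * (x \<bullet> \<eta>)) * complex_of_real (gaussian a x)"

lemma norm_wave_packet [simp]: "norm (wave_packet a \<eta> x) = gaussian a x"
  by (simp add: wave_packet_def norm_mult)

lemma continuous_on_wave_packet: "continuous_on UNIV (wave_packet a \<eta>)"
  unfolding wave_packet_def by (intro continuous_intros)

lemma wave_packet_measurable [measurable]: "wave_packet a \<eta> \<in> borel_measurable borel"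
  by (rule borel_measurable_continuous_onI[OF continuous_on_wave_packet])

lemma integrable_wave_packet: "a > 0 \<Longrightarrow> integrable lborel (wave_packet a \<eta>)"
  unfolding wave_packet_def
  by (intro integrable_bounded_mult[where B=1] integrable_gaussian_complex)
    (auto intro!: borel_measurable_continuous_onI continuous_intros)

lemma fourier_wave_packet:
  "a > 0 \<Longrightarrow> fourier (wave_packet a \<eta>) \<xi> = complex_of_real (gaussian (1 / a) (\<xi> - \<eta>) / a)"
  unfolding wave_packet_def[abs_def] by (simp add: fourier_modulation fourier_gaussian)

lemma gaussian_square: "(gaussian a x)\<^sup>2 = gaussian (2 * a) x"
  unfolding gaussian_def by (simp add: exp_double[symmetric] algebra_simps)

lemma energy_gaussian: "a > 0 \<Longrightarrow> energy (gaussian a) = ennreal (1 / (2 * a))"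
  unfolding energy_def by (simp add: gaussian_square nn_integral_gaussian)

lemma energy_wave_packet: "a > 0 \<Longrightarrow> energy (wave_packet a \<eta>) = ennreal (1 / (2 * a))"
  using energy_gaussian[of a] by (simp cong: energy_cong add: energy_def)

lemma energy_translate:
  assumes [measurable]: "f \<in> borel_measurable borel"
  shows "energy (\<lambda>x. f (x - t)) = energy f"
  unfolding energy_def using nn_integral_lborel_translate[of "\<lambda>x. ennreal ((norm (f x))\<^sup>2)" "- t"] by simp

text \<open>
  Outside the ball, one factor of the squared Gaussian is at most its value on the sphere; the other
  factor is integrable.
\<close>

lemma energy_gaussian_tail:
  assumes a: "a > 0" and r: "r \<ge> 0"
  shows "energy (\<lambda>x. if norm x < r then 0 else gaussian a x) \<le> ennreal (exp (- (pi * a * r\<^sup>2)) / a)"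
proof -
  have "energy (\<lambda>x. if norm x < r then 0 else gaussian a x) \<le> (\<integral>\<^sup>+ x. ennreal (exp (- (pi * a * r\<^sup>2))) * ennreal (gaussian a x) \<partial>lborel)"
    unfolding energy_def
  proof (intro nn_integral_mono)
    fix x :: "real^2"
    show "ennreal ((norm (if norm x < r then 0 else gaussian a x))\<^sup>2) \<le> ennreal (exp (- (pi * a * r\<^sup>2))) * ennreal (gaussian a x)"
    proof (cases "norm x < r")
      case False
      then have "r\<^sup>2 \<le> (norm x)\<^sup>2" using r by (intro power_mono) auto
      then have "gaussian a x \<le> exp (- (pi * a * r\<^sup>2))" using a by (simp add: gaussian_def)
      then have "(gaussian a x)\<^sup>2 \<le> exp (- (pi * a * r\<^sup>2)) * gaussian a x"
        unfolding power2_eq_square by (intro mult_right_mono) auto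
      then show ?thesis using False by (simp flip: ennreal_mult)
    qed auto
  qed
  also have "\<dots> = ennreal (exp (- (pi * a * r\<^sup>2)) / a)"
    using a by (subst nn_integral_cmult) (auto simp: nn_integral_gaussian ennreal_mult[symmetric])
  finally show ?thesis .
qed

text \<open>
  For \<open>c \<le> 1\<close> one has \<open>c(1 + y) \<le> 1 + cy \<le> exp(cy)\<close>; take the power \<open>s\<close> with \<open>sc \<le> b\<close>.
\<close>

lemma power_le_exp_bound:
  fixes s b :: real
  assumes s: "s \<ge> 0" and b: "b > 0"
  obtains K where "K > 0" "\<And>y. y \<ge> 0 \<Longrightarrow> (1 + y) powr s \<le> K * exp (b * y)"
proof -
  define c where "c = min 1 (b / (s + 1))"
  have c: "c > 0" "c \<le> 1" "s * c \<le> b"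
  proof -
    show "c > 0" "c \<le> 1" using s b by (auto simp: c_def)
    have "s * c \<le> s * (b / (s + 1))" using s by (intro mult_left_mono) (auto simp: c_def)
    also have "\<dots> \<le> b" using s b by (simp add: field_simps)
    finally show "s * c \<le> b" .
  qed
  have "(1 + y) powr s \<le> (1 / c) powr s * exp (b * y)" if y: "y \<ge> 0" for y
  proof -
    have "c * (1 + y) \<le> 1 + c * y" using c by (simp add: algebra_simps)
    also have "\<dots> \<le> exp (c * y)" by (rule exp_ge_add_one_self)
    finally have "1 + y \<le> (1 / c) * exp (c * y)" using c by (simp add: field_simps)
    then have "(1 + y) powr s \<le> ((1 / c) * exp (c * y)) powr s" using y s by (intro powr_mono2) auto
    also have "\<dots> = (1 / c) powr s * exp (s * (c * y))" using c by (subst powr_mult) (auto simp: exp_powr_real mult_ac)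
    also have "\<dots> \<le> (1 / c) powr s * exp (b * y)"
      using mult_right_mono[OF c(3) y] by (intro mult_left_mono) (auto simp: mult_ac)
    finally show ?thesis .
  qed
  then show thesis using c by (intro that[of "(1 / c) powr s"]) auto
qed

lemma one_plus_norm_sq_le:
  fixes x y :: "'a::real_inner"
  shows "1 + (norm x)\<^sup>2 \<le> 2 * ((1 + (norm y)\<^sup>2) * (1 + (norm (x - y))\<^sup>2))"
proof -
  have "norm x \<le> norm y + norm (x - y)" by (metis norm_triangle_sub)
  then have "(norm x)\<^sup>2 \<le> (norm y + norm (x - y))\<^sup>2" by (intro power_mono) auto
  also have "\<dots> \<le> 2 * (norm y)\<^sup>2 + 2 * (norm (x - y))\<^sup>2"
    using zero_le_power2[of "norm y - norm (x - y)"] by (simp add: power2_eq_square algebra_simps)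
  finally have "(norm x)\<^sup>2 \<le> 2 * (norm y)\<^sup>2 + 2 * (norm (x - y))\<^sup>2" .
  moreover have "0 \<le> (norm y)\<^sup>2 * (norm (x - y))\<^sup>2" by simp
  ultimately show ?thesis unfolding distrib_left distrib_right mult_1 mult_1_right by linarith
qed

text \<open>
  The Sobolev weight at \<open>\<xi>\<close> is at most a constant times the weight at the centre \<open>\<eta>\<close> and the
  weight at \<open>\<xi> - \<eta>\<close>. The latter is absorbed by one of the two Gaussian factors of the squared
  transform. The constant does not depend on the centre.
\<close>

lemma Hs_norm_wave_packet:
  assumes a: "a > 0" and s: "s \<ge> 0"
  obtains K where "K > 0" "\<And>\<eta>. Hs_norm s (wave_packet a \<eta>) \<le> ennreal (K * (1 + (norm \<eta>)\<^sup>2) powr (s / 2))"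
proof -
  obtain K0 where K0: "K0 > 0" "\<And>y. y \<ge> 0 \<Longrightarrow> (1 + y) powr s \<le> K0 * exp (pi * (1 / a) * y)"
    using power_le_exp_bound[OF s, of "pi * (1 / a)"] a by (auto simp: pi_gt_zero)
  define K where "K = sqrt (2 powr s * K0 / a)"
  have K: "K > 0" using K0 a by (simp add: K_def)
  have "Hs_norm s (wave_packet a \<eta>) \<le> ennreal (K * (1 + (norm \<eta>)\<^sup>2) powr (s / 2))" for \<eta>
  proof -
    let ?w = "(1 + (norm \<eta>)\<^sup>2) powr s"
    have "energy (\<lambda>\<xi>. ((1 + (norm \<xi>)\<^sup>2) powr (s / 2)) *\<^sub>R fourier (wave_packet a \<eta>) \<xi>) \<le>
      (\<integral>\<^sup>+ \<xi>. ennreal (2 powr s * ?w * K0 / a\<^sup>2) * ennreal (gaussian (1 / a) (\<xi> - \<eta>)) \<partial>lborel)"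
      unfolding energy_def
    proof (rule nn_integral_mono)
      fix \<xi> :: "real^2"
      let ?g = "gaussian (1 / a) (\<xi> - \<eta>)"
      have "(norm (((1 + (norm \<xi>)\<^sup>2) powr (s / 2)) *\<^sub>R fourier (wave_packet a \<eta>) \<xi>))\<^sup>2 =
          ((1 + (norm \<xi>)\<^sup>2) powr (s / 2))\<^sup>2 * (?g / a)\<^sup>2"
        using a by (simp add: fourier_wave_packet power_mult_distrib norm_divide power_divide)
      also have "((1 + (norm \<xi>)\<^sup>2) powr (s / 2))\<^sup>2 = (1 + (norm \<xi>)\<^sup>2) powr s"
        by (simp add: power2_eq_square flip: powr_add)
      also have "\<dots> \<le> (2 * ((1 + (norm \<eta>)\<^sup>2) * (1 + (norm (\<xi> - \<eta>))\<^sup>2))) powr s"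
        using s by (intro powr_mono2 one_plus_norm_sq_le) auto
      also have "\<dots> = 2 powr s * ?w * (1 + (norm (\<xi> - \<eta>))\<^sup>2) powr s" by (simp add: powr_mult)
      also have "\<dots> \<le> 2 powr s * ?w * (K0 * exp (pi * (1 / a) * (norm (\<xi> - \<eta>))\<^sup>2))"
        by (intro mult_left_mono K0) auto
      also have "exp (pi * (1 / a) * (norm (\<xi> - \<eta>))\<^sup>2) = inverse ?g"
        by (simp add: gaussian_def exp_minus)
      finally have "(norm (((1 + (norm \<xi>)\<^sup>2) powr (s / 2)) *\<^sub>R fourier (wave_packet a \<eta>) \<xi>))\<^sup>2 \<le>
         2 powr s * ?w * (K0 * inverse ?g) * (?g / a)\<^sup>2" by (simp add: mult_right_mono)
      also have "\<dots> = (2 powr s * ?w * K0 / a\<^sup>2) * ?g"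
        using gaussian_pos[of "1 / a" "\<xi> - \<eta>"] a by (simp add: field_simps power2_eq_square del: gaussian_pos)
      finally show "ennreal ((norm (((1 + (norm \<xi>)\<^sup>2) powr (s / 2)) *\<^sub>R fourier (wave_packet a \<eta>) \<xi>))\<^sup>2) \<le>
          ennreal (2 powr s * ?w * K0 / a\<^sup>2) * ennreal ?g"
        using K0 a by (simp flip: ennreal_mult add: ennreal_leI)
    qed
    also have "\<dots> = ennreal (2 powr s * ?w * K0 / a\<^sup>2) * ennreal a"
      using nn_integral_lborel_translate[of "\<lambda>x. ennreal (gaussian (1 / a) x)" "- \<eta>"] a
      by (simp add: nn_integral_cmult nn_integral_gaussian)
    also have "\<dots> = ennreal ((K * (1 + (norm \<eta>)\<^sup>2) powr (s / 2))\<^sup>2)"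
    proof -
      have "((1 + (norm \<eta>)\<^sup>2) powr (s / 2))\<^sup>2 = ?w" by (simp add: power2_eq_square flip: powr_add)
      moreover have "K\<^sup>2 = 2 powr s * K0 / a" using K0 a by (simp add: K_def)
      ultimately have "(K * (1 + (norm \<eta>)\<^sup>2) powr (s / 2))\<^sup>2 = 2 powr s * ?w * K0 / a\<^sup>2 * a"
        using a by (simp add: power_mult_distrib power2_eq_square[of a])
      then show ?thesis using K0 a by (simp flip: ennreal_mult)
    qed
    finally show ?thesis
      using a K by (subst Hs_norm_eq) (auto simp: integrable_wave_packet energy_wave_packet intro!: L2_norm_le)
  qed
  with K show thesis by (rule that)
qed

section \<open>Smooth functions and cutoffs\<close>

lemma partial_deriv_eq: "(f has_derivative f') (at x) \<Longrightarrow> partial_deriv k f x = f' (axis k 1)"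
  unfolding partial_deriv_def by (metis frechet_derivative_at)

text \<open>
  Recursion on the derivative taken first makes closure under products an induction on the order;
  smoothness is the conjunction over all orders.
\<close>

fun diff_times :: "nat \<Rightarrow> (real^2 \<Rightarrow> 'b::real_normed_vector) \<Rightarrow> bool" where
  "diff_times 0 f \<longleftrightarrow> True"
| "diff_times (Suc n) f \<longleftrightarrow> (\<forall>x. f differentiable at x) \<and> (\<forall>k. diff_times n (partial_deriv k f))"

lemma diff_times_differentiable: "diff_times (Suc n) f \<Longrightarrow> f differentiable at x"
  by simp

lemma diff_times_foldr: "diff_times n f \<Longrightarrow> length ks \<le> n \<Longrightarrow> diff_times (n - length ks) (foldr partial_deriv ks f)"
proof (induction ks)
  case (Cons k ks)
  then have "diff_times (n - length ks) (foldr partial_deriv ks f)" by simp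
  moreover have "n - length ks = Suc (n - length (k # ks))" using Cons.prems by simp
  ultimately show ?case by simp
qed simp

lemma smooth_iff_diff_times: "smooth f \<longleftrightarrow> (\<forall>n. diff_times n f)"
proof
  assume s: "smooth f"
  have "diff_times n (foldr partial_deriv ks f)" for n ks
  proof (induction n arbitrary: ks)
    case (Suc n)
    have "diff_times n (partial_deriv k (foldr partial_deriv ks f))" for k using Suc[of "k # ks"] by simp
    then show ?case using s by (simp add: smooth_def)
  qed simp
  from this[of _ "[]"] show "\<forall>n. diff_times n f" by simp
next
  assume C: "\<forall>n. diff_times n f"
  have "diff_times (Suc (length ks) - length ks) (foldr partial_deriv ks f)" for ks
    using C by (intro diff_times_foldr) auto
  then show "smooth f" unfolding smooth_def by simp
qed

lemma smooth_partial_deriv: "smooth f \<Longrightarrow> smooth (partial_deriv k f)"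
  unfolding smooth_iff_diff_times by (metis diff_times.simps(2))

lemma smooth_differentiable: "smooth f \<Longrightarrow> f differentiable at x"
  unfolding smooth_iff_diff_times using diff_times_differentiable by blast

lemma smooth_has_derivative: "smooth f \<Longrightarrow> (f has_derivative frechet_derivative f (at x)) (at x)"
  using smooth_differentiable frechet_derivative_works by blast

lemma smooth_continuous_on: "smooth f \<Longrightarrow> continuous_on S f"
  by (meson smooth_differentiable differentiable_imp_continuous_on differentiable_at_withinI differentiable_on_def)

lemma diff_times_Suc_imp: "diff_times (Suc n) f \<Longrightarrow> diff_times n f"
  by (induction n arbitrary: f) auto

lemma diff_times_const: "diff_times n (\<lambda>x. c)"
proof (induction n arbitrary: c)
  case (Suc n)
  have "partial_deriv k (\<lambda>x. c) = (\<lambda>x. 0)" for k by (auto intro!: ext partial_deriv_eq[THEN trans] derivative_eq_intros)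
  then show ?case using Suc by simp
qed simp

lemma partial_deriv_bounded_linear:
  assumes L: "bounded_linear L" and f: "\<And>x. f differentiable at x"
  shows "partial_deriv k (\<lambda>x. L (f x)) = (\<lambda>x. L (partial_deriv k f x))"
proof
  fix x
  have "((\<lambda>x. L (f x)) has_derivative (\<lambda>h. L (frechet_derivative f (at x) h))) (at x)"
    using f by (intro bounded_linear.has_derivative[OF L]) (simp add: frechet_derivative_works)
  then show "partial_deriv k (\<lambda>x. L (f x)) x = L (partial_deriv k f x)"
    by (subst partial_deriv_eq) (auto simp: partial_deriv_def)
qed

lemma diff_times_bounded_linear: "bounded_linear L \<Longrightarrow> diff_times n f \<Longrightarrow> diff_times n (\<lambda>x. L (f x))"
proof (induction n arbitrary: f)
  case (Suc n)
  have "(\<lambda>x. L (f x)) differentiable at x" for x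
    using Suc.prems bounded_linear.has_derivative[OF Suc.prems(1)] unfolding differentiable_def by (metis diff_times.simps(2) differentiable_def)
  then show ?case using Suc by (simp add: partial_deriv_bounded_linear)
qed simp

lemma partial_deriv_add:
  assumes "\<And>x. f differentiable at x" "\<And>x. g differentiable at x"
  shows "partial_deriv k (\<lambda>x. f x + g x) = (\<lambda>x. partial_deriv k f x + partial_deriv k g x)"
  by (rule ext, subst partial_deriv_eq[OF has_derivative_add[OF assms[unfolded frechet_derivative_works]]])
    (simp add: partial_deriv_def)

lemma diff_times_add: "diff_times n f \<Longrightarrow> diff_times n g \<Longrightarrow> diff_times n (\<lambda>x. f x + g x)"
  by (induction n arbitrary: f g) (auto simp: partial_deriv_add)

lemma partial_deriv_mult:
  fixes f g :: "real^2 \<Rightarrow> real"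
  assumes "\<And>x. f differentiable at x" "\<And>x. g differentiable at x"
  shows "partial_deriv k (\<lambda>x. f x * g x) = (\<lambda>x. f x * partial_deriv k g x + partial_deriv k f x * g x)"
  by (rule ext, subst partial_deriv_eq[OF has_derivative_mult[OF assms[unfolded frechet_derivative_works]]])
    (simp add: partial_deriv_def)

lemma diff_times_mult: "diff_times n f \<Longrightarrow> diff_times n g \<Longrightarrow> diff_times n (\<lambda>x. f x * g x :: real)"
proof (induction n arbitrary: f g)
  case (Suc n)
  have "diff_times n (\<lambda>x. f x * partial_deriv k g x + partial_deriv k f x * g x)" for k
    using Suc diff_times_Suc_imp by (intro diff_times_add Suc.IH) auto
  then show ?case using Suc.prems by (simp add: partial_deriv_mult)
qed simp

text \<open>
  The analogue on the line, used to build the cutoffs coordinate by coordinate.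
\<close>

fun real_diff_times :: "nat \<Rightarrow> (real \<Rightarrow> real) \<Rightarrow> bool" where
  "real_diff_times 0 h \<longleftrightarrow> True"
| "real_diff_times (Suc n) h \<longleftrightarrow> (\<exists>h'. (\<forall>t. (h has_real_derivative h' t) (at t)) \<and> real_diff_times n h')"

lemma real_diff_times_SucI: "(\<And>t. (h has_real_derivative h' t) (at t)) \<Longrightarrow> real_diff_times n h' \<Longrightarrow> real_diff_times (Suc n) h"
  by auto

lemma real_diff_times_Suc_imp: "real_diff_times (Suc n) f \<Longrightarrow> real_diff_times n f"
proof (induction n arbitrary: f)
  case (Suc n)
  then obtain f' where "\<And>t. (f has_real_derivative f' t) (at t)" "real_diff_times (Suc n) f'" by (metis real_diff_times.simps(2))
  then show ?case using Suc.IH by (metis real_diff_times.simps(2))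
qed simp

lemma real_diff_times_add: "real_diff_times n f \<Longrightarrow> real_diff_times n g \<Longrightarrow> real_diff_times n (\<lambda>x. f x + g x)"
proof (induction n arbitrary: f g)
  case (Suc n)
  then obtain f' g' where d: "\<And>t. (f has_real_derivative f' t) (at t)" "real_diff_times n f'" "\<And>t. (g has_real_derivative g' t) (at t)" "real_diff_times n g'"
    by auto
  then show ?case unfolding real_diff_times.simps(2) by (intro exI[of _ "\<lambda>t. f' t + g' t"]) (auto intro!: derivative_eq_intros Suc.IH)
qed auto

lemma real_diff_times_mult: "real_diff_times n f \<Longrightarrow> real_diff_times n g \<Longrightarrow> real_diff_times n (\<lambda>x. f x * g x)"
proof (induction n arbitrary: f g)
  case (Suc n)
  obtain f' g' where d: "\<And>t. (f has_real_derivative f' t) (at t)" "real_diff_times n f'" "\<And>t. (g has_real_derivative g' t) (at t)" "real_diff_times n g'"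
    using Suc.prems by auto
  have "((\<lambda>x. f x * g x) has_real_derivative f' t * g t + f t * g' t) (at t)" for t
    by (auto intro!: derivative_eq_intros d)
  moreover have "real_diff_times n (\<lambda>t. f' t * g t + f t * g' t)" using Suc real_diff_times_Suc_imp d by (intro real_diff_times_add Suc.IH) auto
  ultimately show ?case by (rule real_diff_times_SucI)
qed auto

lemma real_diff_times_const: "real_diff_times n (\<lambda>x. c)"
proof (induction n arbitrary: c)
  case (Suc n) then show ?case by (auto intro!: exI[of _ "\<lambda>x. 0"] derivative_eq_intros)
qed auto

lemma real_diff_times_affine: "real_diff_times n f \<Longrightarrow> real_diff_times n (\<lambda>t. f (a * t + b))"
proof (induction n arbitrary: f)
  case (Suc n)
  then obtain f' where f': "\<And>t. (f has_real_derivative f' t) (at t)" "real_diff_times n f'" by auto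
  have "((\<lambda>t. f (a * t + b)) has_real_derivative f' (a * t + b) * a) (at t)" for t
    by (rule DERIV_chain2[of f]) (auto intro!: f' derivative_eq_intros)
  moreover have "real_diff_times n (\<lambda>t. f' (a * t + b) * a)" by (intro real_diff_times_mult real_diff_times_const Suc.IH f')
  ultimately show ?case by (rule real_diff_times_SucI)
qed simp

text \<open>
  The derivative of the reciprocal is polynomial in the derivative and the reciprocal itself, so
  the induction on the order closes.
\<close>

lemma real_diff_times_inverse:
  assumes pos: "\<And>t. f t \<noteq> 0"
  shows "real_diff_times n f \<Longrightarrow> real_diff_times n (\<lambda>t. inverse (f t))"
proof (induction n)
  case (Suc n)
  then obtain f' where f': "\<And>t. (f has_real_derivative f' t) (at t)" "real_diff_times n f'" by auto
  have "((\<lambda>t. inverse (f t)) has_real_derivative (- 1) * (f' t * (inverse (f t) * inverse (f t)))) (at t)" for t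
    using pos by (auto intro!: derivative_eq_intros f' simp: mult_ac)
  moreover have "real_diff_times n (\<lambda>t. (- 1) * (f' t * (inverse (f t) * inverse (f t))))"
    using Suc real_diff_times_Suc_imp by (intro real_diff_times_mult real_diff_times_const f') auto
  ultimately show ?case by (rule real_diff_times_SucI)
qed simp

lemma diff_times_coord_comp:
  assumes "\<And>n. real_diff_times n h"
  shows "diff_times n (\<lambda>x. h (x $ i))"
proof -
  have "real_diff_times n h \<Longrightarrow> diff_times n (\<lambda>x. h (x $ i))" for n
  proof (induction n arbitrary: h)
    case (Suc n)
    then obtain h' where h': "\<And>t. (h has_real_derivative h' t) (at t)" "real_diff_times n h'" by auto
    have D: "((\<lambda>x::real^2. h (x $ i)) has_derivative (\<lambda>v. v $ i * h' (x $ i))) (at x)" for x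
      using has_derivative_compose[OF bounded_linear_imp_has_derivative[OF bounded_linear_vec_nth[of i]] h'(1)[unfolded has_field_derivative_def]]
      by (simp add: mult.commute)
    have "partial_deriv k (\<lambda>x::real^2. h (x $ i)) = (\<lambda>x. (axis k 1 :: real^2) $ i * h' (x $ i))" for k
      by (rule ext, rule partial_deriv_eq[OF D])
    moreover have "diff_times n (\<lambda>x::real^2. (axis k 1 :: real^2) $ i * h' (x $ i))" for k
      by (intro diff_times_mult diff_times_const Suc.IH h')
    ultimately show ?case using D by (auto simp: differentiable_def)
  qed simp
  then show ?thesis using assms by blast
qed

subsection \<open>The flat function\<close>

text \<open>
  The family \<open>t\<^sup>-\<^sup>k exp(-1/t)\<close>, extended by 0 to the left. It contains the standard flat function
  (\<open>k = 0\<close>), and its linear span is closed under differentiation.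
\<close>

definition flat_exp :: "nat \<Rightarrow> real \<Rightarrow> real" where
  "flat_exp k t = (if t \<le> 0 then 0 else (1 / t) ^ k * exp (- (1 / t)))"

lemma flat_exp_nonneg: "0 \<le> flat_exp k t"
  by (simp add: flat_exp_def)

lemma power_exp_tendsto_0: "((\<lambda>y::real. y ^ k * exp (- y)) \<longlongrightarrow> 0) at_top"
  using tendsto_power_div_exp_0[of k] by (simp add: exp_minus divide_inverse)

lemma flat_exp_has_derivative:
  "(flat_exp k has_real_derivative flat_exp (k + 2) t - real k * flat_exp (k + 1) t) (at t)"
proof -
  consider "t < 0" | "t > 0" | "t = 0" by linarith
  then show ?thesis
  proof cases
    case 1
    have "((\<lambda>x. 0) has_real_derivative 0) (at t)" by simp
    then have "(flat_exp k has_real_derivative 0) (at t)"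
      by (rule has_field_derivative_transform_within_open[where S="{..<0}"]) (use 1 in \<open>auto simp: flat_exp_def\<close>)
    then show ?thesis using 1 by (simp add: flat_exp_def)
  next
    case 2
    have d: "((\<lambda>t. 1 / t) has_real_derivative - ((1 / t) ^ 2)) (at t)"
      using 2 by (auto intro!: derivative_eq_intros simp: power2_eq_square)
    have "((\<lambda>t. (1 / t) ^ k * exp (- (1 / t))) has_real_derivative
       flat_exp (k + 2) t - real k * flat_exp (k + 1) t) (at t)"
      by (rule DERIV_cong[OF DERIV_mult[OF DERIV_power[OF d, of k] DERIV_fun_exp[OF DERIV_minus[OF d]]]])
        (use 2 in \<open>cases k; simp add: flat_exp_def algebra_simps power2_eq_square\<close>)
    then show ?thesis
      by (rule has_field_derivative_transform_within_open[where S="{0<..}"]) (use 2 in \<open>auto simp: flat_exp_def\<close>)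
  next
    case 3
    have "((\<lambda>h. flat_exp k h / h) \<longlongrightarrow> 0) (at 0)"
    proof (rule filterlim_split_at)
      show "((\<lambda>h. flat_exp k h / h) \<longlongrightarrow> 0) (at_left 0)"
        by (rule tendsto_eventually) (auto simp: flat_exp_def eventually_at_filter)
      have "((\<lambda>h. (inverse h) ^ (k + 1) * exp (- inverse h)) \<longlongrightarrow> (0::real)) (at_right 0)"
        by (rule filterlim_compose[OF power_exp_tendsto_0 filterlim_inverse_at_top_right])
      then show "((\<lambda>h. flat_exp k h / h) \<longlongrightarrow> 0) (at_right 0)"
        by (rule Lim_transform_eventually) (auto simp: flat_exp_def eventually_at_filter inverse_eq_divide)
    qed
    then show ?thesis using 3 by (simp add: has_field_derivative_iff flat_exp_def)
  qed
qed

lemma real_diff_times_flat_exp: "real_diff_times n (flat_exp k)"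
proof (induction n arbitrary: k)
  case (Suc n)
  have "real_diff_times n (\<lambda>t. flat_exp (k + 2) t + (- real k) * flat_exp (k + 1) t)"
    by (intro real_diff_times_add real_diff_times_mult real_diff_times_const Suc)
  then show ?case
    by (rule real_diff_times_SucI[rotated]) (use flat_exp_has_derivative[of k] in simp)
qed simp

subsection \<open>Plateau functions\<close>

definition smooth_step :: "real \<Rightarrow> real" where
  "smooth_step t = flat_exp 0 t * inverse (flat_exp 0 t + flat_exp 0 (1 - t))"

lemma smooth_step_denom: "flat_exp 0 t + flat_exp 0 (1 - t) > 0"
  by (auto simp: flat_exp_def add_pos_nonneg)

lemma real_diff_times_smooth_step: "real_diff_times n smooth_step"
proof -
  have "real_diff_times n (\<lambda>t. flat_exp 0 ((- 1) * t + 1))" by (intro real_diff_times_affine real_diff_times_flat_exp)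
  then have "real_diff_times n (\<lambda>t. flat_exp 0 (1 - t))" by (simp add: algebra_simps)
  then have "real_diff_times n (\<lambda>t. flat_exp 0 t * inverse (flat_exp 0 t + flat_exp 0 (1 - t)))"
    using smooth_step_denom by (intro real_diff_times_mult real_diff_times_flat_exp real_diff_times_inverse real_diff_times_add) (auto simp: less_imp_neq[symmetric])
  then show ?thesis by (simp add: smooth_step_def[abs_def])
qed

lemma smooth_step_simps: "t \<le> 0 \<Longrightarrow> smooth_step t = 0" "t \<ge> 1 \<Longrightarrow> smooth_step t = 1"
  by (auto simp: smooth_step_def flat_exp_def)

lemma smooth_step_range: "0 \<le> smooth_step t" "smooth_step t \<le> 1"
  using smooth_step_denom[of t] by (auto simp: smooth_step_def divide_simps mult.commute[of "flat_exp 0 t"] flat_exp_nonneg simp flip: divide_inverse)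

definition plateau :: "real \<Rightarrow> real" where
  "plateau t = smooth_step (2 - t) * smooth_step (2 + t)"

lemma real_diff_times_plateau_scaled: "real_diff_times n (\<lambda>t. plateau (a * t))"
proof -
  have "real_diff_times n (\<lambda>t. smooth_step ((- a) * t + 2) * smooth_step (a * t + 2))" by (intro real_diff_times_mult real_diff_times_affine real_diff_times_smooth_step)
  then show ?thesis by (simp add: plateau_def algebra_simps)
qed

lemma plateau_eq_1: "\<bar>t\<bar> \<le> 1 \<Longrightarrow> plateau t = 1"
  by (simp add: plateau_def smooth_step_simps)

lemma plateau_eq_0: "\<bar>t\<bar> \<ge> 2 \<Longrightarrow> plateau t = 0"
  by (cases "t \<ge> 0") (auto simp: plateau_def smooth_step_simps)

lemma plateau_range: "0 \<le> plateau t" "plateau t \<le> 1"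
  by (auto simp: plateau_def smooth_step_range mult_le_one)

text \<open>
  The product of plateau functions in the two coordinates equals 1 on the square of half-side \<open>R\<close>,
  hence on the ball of radius \<open>R\<close>, and vanishes off the square of half-side \<open>2R\<close>, hence off the ball
  of radius \<open>4R\<close>.
\<close>

definition cutoff :: "real \<Rightarrow> real^2 \<Rightarrow> real" where
  "cutoff R x = plateau (inverse R * x $ 1) * plateau (inverse R * x $ 2)"

lemma diff_times_cutoff: "diff_times n (cutoff R)"
  unfolding cutoff_def[abs_def]
  by (intro diff_times_mult diff_times_coord_comp[where h="\<lambda>t. plateau (inverse R * t)"] real_diff_times_plateau_scaled)

lemma cutoff_range: "0 \<le> cutoff R x" "cutoff R x \<le> 1"
  by (auto simp: cutoff_def plateau_range mult_le_one)

lemma cutoff_eq_1: "R > 0 \<Longrightarrow> norm x \<le> R \<Longrightarrow> cutoff R x = 1"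
  using component_le_norm_cart[of x 1] component_le_norm_cart[of x 2]
  by (simp add: cutoff_def plateau_eq_1 abs_mult divide_simps)

lemma cutoff_eq_0:
  assumes "R > 0" "norm x \<ge> 4 * R"
  shows "cutoff R x = 0"
proof -
  have "norm x \<le> \<bar>x $ 1\<bar> + \<bar>x $ 2\<bar>" using norm_le_l1_cart[of x] by (simp add: sum_2)
  then have "\<bar>x $ 1\<bar> \<ge> 2 * R \<or> \<bar>x $ 2\<bar> \<ge> 2 * R" using assms by linarith
  then show ?thesis using assms by (auto simp: cutoff_def abs_mult divide_simps intro!: plateau_eq_0)
qed

lemma compact_supp_cutoff_scaled:
  fixes f :: "real^2 \<Rightarrow> 'b::real_normed_vector"
  assumes R: "R > 0"
  shows "compact (supp (\<lambda>x. cutoff R x *\<^sub>R f x))" and "supp (\<lambda>x. cutoff R x *\<^sub>R f x) \<subseteq> cball 0 (4 * R)"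
proof -
  have "{x. cutoff R x *\<^sub>R f x \<noteq> 0} \<subseteq> cball 0 (4 * R)"
  proof
    fix x assume "x \<in> {x. cutoff R x *\<^sub>R f x \<noteq> 0}"
    then have "cutoff R x \<noteq> 0" by auto
    then show "x \<in> cball 0 (4 * R)" using cutoff_eq_0[OF R, of x] by force
  qed
  then show *: "supp (\<lambda>x. cutoff R x *\<^sub>R f x) \<subseteq> cball 0 (4 * R)"
    unfolding supp_def by (intro closure_minimal) auto
  then show "compact (supp (\<lambda>x. cutoff R x *\<^sub>R f x))"
    by (metis bounded_cball bounded_subset closed_closure compact_eq_bounded_closed supp_def)
qed

section \<open>Truncated linear deformations\<close>

lemma frechet_eq_partials:
  fixes f :: "real^2 \<Rightarrow> 'b::real_normed_vector"
  assumes "f differentiable at x"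
  shows "frechet_derivative f (at x) h = h $ 1 *\<^sub>R partial_deriv 1 f x + h $ 2 *\<^sub>R partial_deriv 2 f x"
proof -
  have l: "linear (frechet_derivative f (at x))" using assms by (rule linear_frechet_derivative)
  have "h = h $ 1 *\<^sub>R axis 1 1 + h $ 2 *\<^sub>R axis 2 1"
    by (simp add: vec_eq_iff forall_2 axis_def)
  then have "frechet_derivative f (at x) h = frechet_derivative f (at x) (h $ 1 *\<^sub>R axis 1 1 + h $ 2 *\<^sub>R axis 2 1)" by simp
  also have "\<dots> = h $ 1 *\<^sub>R partial_deriv 1 f x + h $ 2 *\<^sub>R partial_deriv 2 f x"
    by (simp add: linear_add[OF l] linear_scale[OF l] partial_deriv_def)
  finally show ?thesis .
qed

lemma smooth_foldr: "smooth f \<Longrightarrow> smooth (foldr partial_deriv ks f)"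
  by (induction ks) (auto intro: smooth_partial_deriv)

lemma partial_deriv_zero_on_open:
  assumes U: "open U" "x \<in> U" and f: "\<And>y. y \<in> U \<Longrightarrow> f y = 0"
  shows "partial_deriv k f x = 0"
proof -
  have "((\<lambda>y. 0) has_derivative (\<lambda>h. 0)) (at x)" by simp
  then have "(f has_derivative (\<lambda>h. 0)) (at x)"
    by (rule has_derivative_transform_within_open[OF _ U]) (simp add: f)
  then show ?thesis by (rule partial_deriv_eq)
qed

lemma foldr_partial_deriv_zero_on_open:
  assumes U: "open U" and f: "\<And>y. y \<in> U \<Longrightarrow> f y = 0"
  shows "x \<in> U \<Longrightarrow> foldr partial_deriv ks f x = 0"
proof (induction ks arbitrary: x)
  case (Cons k ks)
  then show ?case by (simp add: partial_deriv_zero_on_open[OF U])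
qed (simp add: f)

text \<open>
  Derivatives vanish where the function vanishes on an open set, so only a compact set matters,
  and they are continuous there.
\<close>

lemma foldr_partial_deriv_bounded:
  assumes f: "smooth f" and K: "compact K" and z: "\<And>y. y \<notin> K \<Longrightarrow> f y = 0"
  obtains B where "B > 0" "\<And>x. norm (foldr partial_deriv ks f x) \<le> B"
proof -
  let ?D = "foldr partial_deriv ks f"
  have "compact (?D ` K)" by (intro compact_continuous_image smooth_continuous_on smooth_foldr f K)
  then obtain B where B: "\<And>y. y \<in> ?D ` K \<Longrightarrow> norm y \<le> B" using compact_imp_bounded bounded_iff by metis
  have "norm (?D x) \<le> max B 1" for x
  proof (cases "x \<in> K")
    case True then show ?thesis using B by (force intro: le_max_iff_disj[THEN iffD2])
  next
    case False
    then have "?D x = 0" using foldr_partial_deriv_zero_on_open[of "- K" f x ks] z K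
      by (auto simp: compact_imp_closed open_Compl)
    then show ?thesis by simp
  qed
  then show thesis by (intro that[of "max B 1"]) auto
qed

lemma partial_deriv_sum:
  assumes fin: "finite I" and d: "\<And>i x. i \<in> I \<Longrightarrow> E i differentiable at x"
  shows "partial_deriv k (\<lambda>x. \<Sum>i\<in>I. c i *\<^sub>R E i x) = (\<lambda>x. \<Sum>i\<in>I. c i *\<^sub>R partial_deriv k (E i) x)"
proof
  fix x
  have "((\<lambda>x. \<Sum>i\<in>I. c i *\<^sub>R E i x) has_derivative (\<lambda>h. \<Sum>i\<in>I. c i *\<^sub>R frechet_derivative (E i) (at x) h)) (at x)"
    using d by (intro has_derivative_sum has_derivative_scaleR_right) (auto simp: frechet_derivative_works)
  then show "partial_deriv k (\<lambda>x. \<Sum>i\<in>I. c i *\<^sub>R E i x) x = (\<Sum>i\<in>I. c i *\<^sub>R partial_deriv k (E i) x)"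
    by (subst partial_deriv_eq) (auto simp: partial_deriv_def)
qed

lemma foldr_partial_deriv_sum:
  assumes fin: "finite I" and d: "\<And>i. i \<in> I \<Longrightarrow> smooth (E i)"
  shows "foldr partial_deriv ks (\<lambda>x. \<Sum>i\<in>I. c i *\<^sub>R E i x) = (\<lambda>x. \<Sum>i\<in>I. c i *\<^sub>R foldr partial_deriv ks (E i) x)"
proof (induction ks)
  case (Cons k ks)
  have "partial_deriv k (\<lambda>x. \<Sum>i\<in>I. c i *\<^sub>R foldr partial_deriv ks (E i) x) =
      (\<lambda>x. \<Sum>i\<in>I. c i *\<^sub>R partial_deriv k (foldr partial_deriv ks (E i)) x)"
    by (rule partial_deriv_sum[OF fin]) (intro smooth_differentiable smooth_foldr d)
  with Cons show ?case by simp
qed simp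

lemma smooth_sum:
  assumes fin: "finite I" and d: "\<And>i. i \<in> I \<Longrightarrow> smooth (E i)"
  shows "smooth (\<lambda>x. \<Sum>i\<in>I. c i *\<^sub>R E i x)"
  unfolding smooth_def
proof (intro allI)
  fix ks x
  have "(\<lambda>x. \<Sum>i\<in>I. c i *\<^sub>R foldr partial_deriv ks (E i) x) differentiable at x"
    using fin by (intro differentiable_sum ballI differentiable_scaleR differentiable_const smooth_differentiable smooth_foldr d)
  then show "foldr partial_deriv ks (\<lambda>x. \<Sum>i\<in>I. c i *\<^sub>R E i x) differentiable at x"
    by (simp only: foldr_partial_deriv_sum[OF assms])
qed

text \<open>
  The field equals \<open>M\<^sup>T x\<close> on the ball of radius \<open>R\<close>. There the deformation composes a function
  with the transpose of \<open>Id - M\<close>, which acts on the spectrum as \<open>Id - M\<close> itself.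
\<close>

definition cutoff_linear :: "real \<Rightarrow> real^2^2 \<Rightarrow> real^2 \<Rightarrow> real^2" where
  "cutoff_linear R M x = cutoff R x *\<^sub>R (transpose M *v x)"

text \<open>
  Since \<open>cutoff_linear\<close> is linear in the matrix, bounds for these four fields control all its
  derivatives uniformly in \<open>M\<close>.
\<close>

definition cutoff_elementary :: "real \<Rightarrow> 2 \<times> 2 \<Rightarrow> real^2 \<Rightarrow> real^2" where
  "cutoff_elementary R p x = (cutoff R x * x $ fst p) *\<^sub>R axis (snd p) 1"

lemma cutoff_linear_eq_sum: "cutoff_linear R M = (\<lambda>x. \<Sum>p\<in>UNIV. M $ fst p $ snd p *\<^sub>R cutoff_elementary R p x)"
proof
  fix x
  have eq: "(\<Sum>p\<in>UNIV. g p) = (\<Sum>i\<in>UNIV. \<Sum>j\<in>UNIV. g (i, j))" for g :: "2 \<times> 2 \<Rightarrow> real^2"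
    by (simp add: sum.cartesian_product)
  have "(\<Sum>p\<in>UNIV. M $ fst p $ snd p *\<^sub>R cutoff_elementary R p x) = (\<Sum>i\<in>UNIV. \<Sum>j\<in>UNIV. M $ i $ j *\<^sub>R cutoff_elementary R (i, j) x)"
    unfolding eq by simp
  then show "cutoff_linear R M x = (\<Sum>p\<in>UNIV. M $ fst p $ snd p *\<^sub>R cutoff_elementary R p x)"
    by (simp add: cutoff_linear_def cutoff_elementary_def vec_eq_iff forall_2 matrix_vector_mult_def transpose_def sum_2 axis_def algebra_simps)
qed

lemma smooth_cutoff_elementary: "smooth (cutoff_elementary R p)"
proof -
  have "real_diff_times n (\<lambda>t. t)" for n
  proof (cases n)
    case (Suc k)
    have "real_diff_times (Suc k) (\<lambda>t. t)" by (rule real_diff_times_SucI[of _ "\<lambda>t. 1"]) (auto intro: real_diff_times_const)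
    then show ?thesis using Suc by simp
  qed simp
  then have "diff_times n (\<lambda>x::real^2. x $ fst p)" for n by (rule diff_times_coord_comp)
  then have "diff_times n (\<lambda>x. (cutoff R x * x $ fst p) *\<^sub>R axis (snd p) (1::real))" for n
    by (intro diff_times_bounded_linear[of "\<lambda>c. c *\<^sub>R axis (snd p) (1::real)"] bounded_linear_scaleR_left diff_times_mult diff_times_cutoff)
  then show ?thesis unfolding smooth_iff_diff_times cutoff_elementary_def[abs_def] by simp
qed

lemma smooth_cutoff_linear: "smooth (cutoff_linear R M)"
  unfolding cutoff_linear_eq_sum by (intro smooth_sum smooth_cutoff_elementary) auto

lemma cutoff_linear_in_Cc_infty: "R > 0 \<Longrightarrow> cutoff_linear R M \<in> Cc_infty"
  unfolding Cc_infty_def using smooth_cutoff_linear[of R M] compact_supp_cutoff_scaled(1)[of R "\<lambda>x. transpose M *v x"]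
  by (simp add: cutoff_linear_def[abs_def])

lemma foldr_cutoff_linear_bounded:
  assumes R: "R > 0"
  shows "\<exists>B>0. \<forall>M \<mu> x. (\<forall>i j. \<bar>M $ i $ j\<bar> \<le> \<mu>) \<longrightarrow> norm (foldr partial_deriv ks (cutoff_linear R M) x) \<le> B * \<mu>"
proof -
  have "\<exists>B. B > 0 \<and> (\<forall>x. norm (foldr partial_deriv ks (cutoff_elementary R p) x) \<le> B)" for p
  proof -
    have "cutoff_elementary R p y = 0" if "y \<notin> cball 0 (4 * R)" for y
      using that cutoff_eq_0[OF R, of y] by (simp add: cutoff_elementary_def)
    then show ?thesis by (meson foldr_partial_deriv_bounded[OF smooth_cutoff_elementary compact_cball])
  qed
  then obtain B where B: "\<And>p. B p > 0" "\<And>p x. norm (foldr partial_deriv ks (cutoff_elementary R p) x) \<le> B p" by metis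
  have "norm (foldr partial_deriv ks (cutoff_linear R M) x) \<le> (\<Sum>p\<in>UNIV. B p) * \<mu>"
    if M: "\<And>i j. \<bar>M $ i $ j\<bar> \<le> \<mu>" for M :: "real^2^2" and \<mu> x
  proof -
    have "norm (foldr partial_deriv ks (cutoff_linear R M) x) \<le> (\<Sum>p\<in>UNIV. norm (M $ fst p $ snd p *\<^sub>R foldr partial_deriv ks (cutoff_elementary R p) x))"
      unfolding cutoff_linear_eq_sum foldr_partial_deriv_sum[OF finite smooth_cutoff_elementary] by (rule norm_sum)
    also have "\<dots> \<le> (\<Sum>p\<in>UNIV. \<mu> * B p)"
    proof (rule sum_mono)
      fix p :: "2 \<times> 2"
      have "\<mu> \<ge> 0" using M[of 1 1] by linarith
      then show "norm (M $ fst p $ snd p *\<^sub>R foldr partial_deriv ks (cutoff_elementary R p) x) \<le> \<mu> * B p"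
        unfolding norm_scaleR by (intro mult_mono M B(2) norm_ge_zero)
    qed
    finally show ?thesis by (simp add: sum_distrib_left mult.commute)
  qed
  then show ?thesis using B by (intro exI[of _ "\<Sum>p\<in>UNIV. B p"]) (auto intro: sum_pos)
qed

lemma Linfty_norm_UNIV_le:
  assumes "continuous_on UNIV f" "\<And>x. norm (f x) \<le> B"
  shows "Linfty_norm UNIV f \<le> ennreal B"
  unfolding Linfty_norm_def
proof (rule esssup_I)
  have "(\<lambda>x. norm (f x)) \<in> borel_measurable borel"
    using assms(1) by (intro borel_measurable_continuous_onI continuous_intros)
  then show "(\<lambda>x. ennreal (norm (f x))) \<in> borel_measurable (restrict_space lborel UNIV)"
    by (simp add: measurable_restrict_space1)
qed (auto intro!: AE_I2 ennreal_leI assms)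

lemma funpow_eq_foldr: "(f k ^^ n) x = foldr f (replicate n k) x"
  by (induction n) auto

lemma Cm_norm_cutoff_linear:
  assumes R: "R > 0"
  shows "\<exists>C>0. \<forall>M \<mu>. (\<forall>i j. \<bar>M $ i $ j\<bar> \<le> \<mu>) \<longrightarrow> Cm_norm m (cutoff_linear R M) \<le> ennreal (C * \<mu>)"
proof -
  define ks where "ks a b = replicate a (1::2) @ replicate b 2" for a b
  have "\<forall>a b. \<exists>B>0. \<forall>M \<mu> x. (\<forall>i j. \<bar>M $ i $ j\<bar> \<le> \<mu>) \<longrightarrow> norm (foldr partial_deriv (ks a b) (cutoff_linear R M) x) \<le> B * \<mu>"
    using foldr_cutoff_linear_bounded[OF R] by blast
  then obtain B where B: "\<And>a b. B a b > 0"
     "\<And>a b M \<mu> x. (\<And>i j. \<bar>M $ i $ j\<bar> \<le> \<mu>) \<Longrightarrow> norm (foldr partial_deriv (ks a b) (cutoff_linear R M) x) \<le> B a b * \<mu>"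
    by metis
  let ?C = "\<Sum>a\<le>m. \<Sum>b\<le>m - a. B a b"
  have "Cm_norm m (cutoff_linear R M) \<le> ennreal (?C * \<mu>)" if M: "\<And>i j. \<bar>M $ i $ j\<bar> \<le> \<mu>" for M :: "real^2^2" and \<mu>
  proof -
    have mu: "\<mu> \<ge> 0" using M[of 1 1] by linarith
    have "Linfty_norm UNIV ((partial_deriv 1 ^^ a) ((partial_deriv 2 ^^ b) (cutoff_linear R M))) \<le> ennreal (B a b * \<mu>)" for a b
    proof -
      have eq: "(partial_deriv 1 ^^ a) ((partial_deriv 2 ^^ b) (cutoff_linear R M)) = foldr partial_deriv (ks a b) (cutoff_linear R M)"
        unfolding funpow_eq_foldr ks_def foldr_append by (rule refl)
      show ?thesis
        unfolding eq by (rule Linfty_norm_UNIV_le[OF smooth_continuous_on[OF smooth_foldr[OF smooth_cutoff_linear]] B(2)[OF M]])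
    qed
    then have "Cm_norm m (cutoff_linear R M) \<le> (\<Sum>a\<le>m. \<Sum>b\<le>m - a. ennreal (B a b * \<mu>))"
      unfolding Cm_norm_def by (intro sum_mono) simp
    also have "\<dots> = ennreal (\<Sum>a\<le>m. \<Sum>b\<le>m - a. B a b * \<mu>)"
      using B(1) mu by (simp add: sum_ennreal sum_nonneg less_imp_le)
    also have "(\<Sum>a\<le>m. \<Sum>b\<le>m - a. B a b * \<mu>) = ?C * \<mu>" by (simp add: sum_distrib_right)
    finally show ?thesis .
  qed
  moreover have "?C > 0" using B(1) by (intro sum_pos) auto
  ultimately show ?thesis by blast
qed

text \<open>
  Needed because the essential supremum of a function that is not measurable is infinite. The
  derivative is written as a combination of the partial derivatives in the space of bounded linear
  maps, where the operator norm is continuous.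
\<close>

lemma continuous_on_onorm_frechet:
  fixes f :: "real^2 \<Rightarrow> real^2"
  assumes f: "smooth f"
  shows "continuous_on UNIV (\<lambda>x. onorm (frechet_derivative f (at x)))"
proof -
  define G where "G x = (blinfun_scaleR_left (partial_deriv 1 f x) o\<^sub>L Blinfun (\<lambda>h::real^2. h $ 1)) +
     (blinfun_scaleR_left (partial_deriv 2 f x) o\<^sub>L Blinfun (\<lambda>h::real^2. h $ 2))" for x
  have "continuous_on UNIV G" unfolding G_def
    by (intro continuous_intros smooth_continuous_on smooth_partial_deriv f
      bounded_linear.continuous_on[OF bounded_linear_blinfun_scaleR_left])
  then have "continuous_on UNIV (\<lambda>x. norm (G x))" by (intro continuous_intros)
  moreover have "norm (G x) = onorm (frechet_derivative f (at x))" for x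
  proof -
    have "blinfun_apply (G x) = frechet_derivative f (at x)"
      by (rule ext) (simp add: G_def plus_blinfun.rep_eq bounded_linear_Blinfun_apply bounded_linear_vec_nth
        frechet_eq_partials[OF smooth_differentiable[OF f]])
    then show ?thesis by (simp add: norm_blinfun.rep_eq)
  qed
  ultimately show ?thesis by simp
qed

lemma Dsup_norm_cutoff_linear:
  assumes R: "R > 0"
  shows "\<exists>C>0. \<forall>M \<mu>. (\<forall>i j. \<bar>M $ i $ j\<bar> \<le> \<mu>) \<longrightarrow> Dsup_norm (cutoff_linear R M) \<le> ennreal (C * \<mu>)"
proof -
  obtain B1 where B1: "B1 > 0" "\<And>M \<mu> x. (\<And>i j. \<bar>M $ i $ j\<bar> \<le> \<mu>) \<Longrightarrow> norm (partial_deriv 1 (cutoff_linear R M) x) \<le> B1 * \<mu>"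
    using foldr_cutoff_linear_bounded[OF R, of "[1]"] by auto
  obtain B2 where B2: "B2 > 0" "\<And>M \<mu> x. (\<And>i j. \<bar>M $ i $ j\<bar> \<le> \<mu>) \<Longrightarrow> norm (partial_deriv 2 (cutoff_linear R M) x) \<le> B2 * \<mu>"
    using foldr_cutoff_linear_bounded[OF R, of "[2]"] by auto
  have "Dsup_norm (cutoff_linear R M) \<le> ennreal ((B1 + B2) * \<mu>)" if M: "\<And>i j. \<bar>M $ i $ j\<bar> \<le> \<mu>" for M :: "real^2^2" and \<mu>
    unfolding Dsup_norm_def
  proof (rule Linfty_norm_UNIV_le[OF continuous_on_onorm_frechet[OF smooth_cutoff_linear]])
    fix x
    have mu: "\<mu> \<ge> 0" using M[of 1 1] by linarith
    let ?D = "frechet_derivative (cutoff_linear R M) (at x)"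
    have "onorm ?D \<le> (B1 + B2) * \<mu>"
    proof (rule onorm_le)
      fix h
      have "norm (?D h) \<le> norm (h $ 1 *\<^sub>R partial_deriv 1 (cutoff_linear R M) x) + norm (h $ 2 *\<^sub>R partial_deriv 2 (cutoff_linear R M) x)"
        unfolding frechet_eq_partials[OF smooth_differentiable[OF smooth_cutoff_linear]] by (rule norm_triangle_ineq)
      also have "\<dots> \<le> norm h * (B1 * \<mu>) + norm h * (B2 * \<mu>)"
        unfolding norm_scaleR
        by (intro add_mono mult_mono B1(2) B2(2) M norm_ge_zero) (auto simp: component_le_norm_cart)
      finally show "norm (?D h) \<le> (B1 + B2) * \<mu> * norm h" by (simp add: algebra_simps)
    qed
    moreover have "0 \<le> onorm ?D"
      using smooth_differentiable[OF smooth_cutoff_linear] by (intro onorm_pos_le linear_frechet_derivative[THEN linear_conv_bounded_linear[THEN iffD1]])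
    ultimately show "norm (onorm ?D) \<le> (B1 + B2) * \<mu>" by simp
  qed
  then show ?thesis using B1(1) B2(1) by (intro exI[of _ "B1 + B2"]) auto
qed

text \<open>
  A nonempty open set is not negligible.
\<close>

lemma AE_lborel_closed_imp_all:
  fixes S :: "'a::euclidean_space set"
  assumes S: "closed S" and ae: "AE x in lborel. x \<in> S"
  shows "x \<in> S"
proof (rule ccontr)
  assume "x \<notin> S"
  have "open (- S)" using S by (simp add: open_Compl)
  then have "\<not> negligible (- S)" using \<open>x \<notin> S\<close> by (intro open_not_negligible) auto
  moreover have "- S \<in> null_sets lborel"
    using ae \<open>open (- S)\<close> by (subst AE_iff_null_sets) auto
  then have "negligible (- S)" unfolding negligible_iff_null_sets by (rule null_sets_completionI)
  ultimately show False by contradiction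
qed

text \<open>
  The summand of order 0 is the supremum norm. Positivity is what places the norm in the interval
  on which \<open>\<omega>\<close> is controlled.
\<close>

lemma Cm_norm_pos:
  assumes f: "continuous_on UNIV f" and x: "f x \<noteq> 0"
  shows "Cm_norm m f > 0"
proof (rule ccontr)
  assume "\<not> Cm_norm m f > 0"
  then have "Cm_norm m f = 0" by simp
  then have "Linfty_norm UNIV f = 0"
    unfolding Cm_norm_def by (auto simp: sum_nonneg_eq_0_iff dest!: bspec[of _ _ 0])
  then have "esssup (restrict_space lborel UNIV) (\<lambda>x. ennreal (norm (f x))) = 0" by (simp add: Linfty_norm_def)
  then have "AE x in restrict_space lborel UNIV. ennreal (norm (f x)) \<le> 0"
    using esssup_AE[of "\<lambda>x. ennreal (norm (f x))" "restrict_space lborel UNIV"] by simp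
  then have "AE x in lborel. ennreal (norm (f x)) \<le> 0" by (subst (asm) AE_restrict_space_iff) auto
  then have "AE x in lborel. x \<in> {x. f x = 0}" by (auto elim: eventually_mono)
  moreover have "closed {x. f x = 0}" using f by (intro closed_Collect_eq) auto
  ultimately show False using AE_lborel_closed_imp_all x by blast
qed

lemma norm_transpose_mult_le:
  fixes M :: "real^2^2"
  assumes M: "\<And>i j. \<bar>M $ i $ j\<bar> \<le> \<mu>"
  shows "norm (transpose M *v x) \<le> 4 * \<mu> * norm x"
proof -
  have c: "\<bar>M $ i $ j * x $ i\<bar> \<le> \<mu> * norm x" for i j
    unfolding abs_mult using M[of i j] component_le_norm_cart[of x i] by (intro mult_mono) auto
  have "norm (transpose M *v x) \<le> \<bar>(transpose M *v x) $ 1\<bar> + \<bar>(transpose M *v x) $ 2\<bar>"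
    using norm_le_l1_cart[of "transpose M *v x"] by (simp add: sum_2)
  also have "\<dots> = \<bar>M $ 1 $ 1 * x $ 1 + M $ 2 $ 1 * x $ 2\<bar> + \<bar>M $ 1 $ 2 * x $ 1 + M $ 2 $ 2 * x $ 2\<bar>"
    by (simp add: matrix_vector_mult_def transpose_def sum_2)
  also have "\<dots> \<le> 4 * (\<mu> * norm x)"
    using c[of 1 1] c[of 2 1] c[of 1 2] c[of 2 2] by linarith
  finally show ?thesis by simp
qed

lemma cutoff_linear_nonzero:
  assumes R: "R > 0" and M: "M \<noteq> 0"
  obtains x where "cutoff_linear R M x \<noteq> 0"
proof -
  obtain i j where ij: "M $ i $ j \<noteq> 0" using M by (auto simp: vec_eq_iff)
  define x where "x = R *\<^sub>R axis i (1::real)"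
  have "norm x = R" using R by (simp add: x_def norm_axis_1)
  then have "cutoff R x = 1" using R by (intro cutoff_eq_1) auto
  moreover have "(transpose M *v x) $ j = R * M $ i $ j"
    by (simp add: x_def matrix_vector_mult_def transpose_def axis_def if_distrib if_distribR sum.If_cases cong: if_cong)
  ultimately have "cutoff_linear R M x $ j \<noteq> 0" using R ij by (simp add: cutoff_linear_def)
  then have "cutoff_linear R M x \<noteq> 0" by (metis zero_index)
  then show thesis by (rule that)
qed

section \<open>Lipschitz bounds from weak gradients\<close>

lemma diff_times_reflect: "diff_times n f \<Longrightarrow> diff_times n (\<lambda>y. f (z - y))"
  and partial_deriv_reflect: "(\<And>x. f differentiable at x) \<Longrightarrow> partial_deriv k (\<lambda>y. f (z - y)) = (\<lambda>y. - partial_deriv k f (z - y))"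
proof -
  have D: "((\<lambda>y. f (z - y)) has_derivative (\<lambda>h. frechet_derivative f (at (z - y)) (- h))) (at y)"
    if "\<And>x. f differentiable at x" for f :: "real^2 \<Rightarrow> 'a" and y
  proof -
    have "((\<lambda>y. z - y) has_derivative (\<lambda>h. - h)) (at y)" by (auto intro!: derivative_eq_intros)
    moreover have "(f has_derivative frechet_derivative f (at (z - y))) (at (z - y))"
      using that by (simp add: frechet_derivative_works)
    ultimately show ?thesis by (rule has_derivative_compose)
  qed
  have P: "partial_deriv k (\<lambda>y. f (z - y)) = (\<lambda>y. - partial_deriv k f (z - y))"
    if d: "\<And>x. f differentiable at x" for f :: "real^2 \<Rightarrow> 'a" and k
  proof
    fix y
    have "linear (frechet_derivative f (at (z - y)))" using d by (rule linear_frechet_derivative)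
    then show "partial_deriv k (\<lambda>y. f (z - y)) y = - partial_deriv k f (z - y)"
      by (subst partial_deriv_eq[OF D[OF d]]) (simp add: partial_deriv_def linear_neg)
  qed
  then show "(\<And>x. f differentiable at x) \<Longrightarrow> partial_deriv k (\<lambda>y. f (z - y)) = (\<lambda>y. - partial_deriv k f (z - y))" .
  show "diff_times n f \<Longrightarrow> diff_times n (\<lambda>y. f (z - y))"
  proof (induction n arbitrary: f)
    case (Suc n)
    then have d: "\<And>x. f differentiable at x" by auto
    have "(\<lambda>y. f (z - y)) differentiable at y" for y using D[OF d] unfolding differentiable_def by blast
    moreover have "diff_times n (\<lambda>y. - partial_deriv k f (z - y))" for k
      using Suc by (intro diff_times_bounded_linear[of uminus] bounded_linear_minus bounded_linear_ident) auto
    ultimately show ?case by (simp add: P[OF d])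
  qed simp
qed

lemma LINT_eq_HK_integral:
  fixes F :: "real^2 \<Rightarrow> complex"
  assumes F: "continuous_on UNIV F" and z: "\<And>y. y \<notin> cbox a b \<Longrightarrow> F y = 0"
  shows "integral (cbox a b) F = (LINT y|lborel. F y)"
proof -
  have "set_integrable lborel (cbox a b) F"
    unfolding set_integrable_def using F by (intro borel_integrable_compact) (auto intro: continuous_on_subset)
  then have "integral (cbox a b) F = (LINT y:cbox a b|lborel. F y)" by (rule set_borel_integral_eq_integral(2)[symmetric])
  also have "\<dots> = (LINT y|lborel. F y)"
    unfolding set_lebesgue_integral_def using z by (intro Bochner_Integration.integral_cong) (auto simp: indicator_def)
  finally show ?thesis .
qed

lemma continuous_on_cutoff [continuous_intros]: "continuous_on S f \<Longrightarrow> continuous_on S (\<lambda>x. cutoff R (f x))"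
  using continuous_on_compose2[OF smooth_continuous_on[of "cutoff R" UNIV]] diff_times_cutoff smooth_iff_diff_times by blast

lemma smooth_cutoff: "smooth (cutoff R)"
  by (simp add: smooth_iff_diff_times diff_times_cutoff)

lemma integrable_cutoff: "R > 0 \<Longrightarrow> integrable lborel (cutoff R)"
proof -
  assume R: "R > 0"
  have "integrable lborel (\<lambda>x. indicator (cball 0 (4 * R)) x *\<^sub>R cutoff R x)"
    by (intro borel_integrable_compact continuous_intros) auto
  moreover have "(\<lambda>x. indicator (cball 0 (4 * R)) x *\<^sub>R cutoff R x) = cutoff R"
    using cutoff_eq_0[OF R] by (auto simp: indicator_def fun_eq_iff)
  ultimately show ?thesis by simp
qed

lemma integral_cutoff_pos:
  assumes R: "R > 0"
  shows "(LINT x|lborel. cutoff R x) > 0"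
proof -
  have "0 < measure lborel (cball (0::real^2) R)" using R by (simp add: content_cball_pos)
  also have "\<dots> = (LINT x|lborel. indicator (cball (0::real^2) R) x)" by simp
  also have "\<dots> \<le> (LINT x|lborel. cutoff R x)"
    using R by (intro integral_mono integrable_cutoff integrable_real_indicator)
      (auto simp: indicator_def cutoff_eq_1 cutoff_range emeasure_bounded_finite[OF bounded_cball, unfolded infinity_ennreal_def])
  finally show ?thesis .
qed

text \<open>
  The reflected cutoff \<open>y \<mapsto> \<eta>(z - y)\<close> is an admissible test function in the definition of the weak
  gradient. The derivative of the mollification is thus an average of the weak gradient.
\<close>

lemma mollified_gradient_bound:
  fixes u :: "real^2 \<Rightarrow> complex"
  assumes wg: "weak_gradient_on U u g" and U: "open U"
    and gC: "Linfty_norm U g \<le> ennreal C" and C: "C \<ge> 0"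
    and e: "e > 0" and z: "cball z (4 * e) \<subseteq> U"
  shows "norm (LINT y|lborel. partial_deriv k (cutoff e) (z - y) *\<^sub>R u y) \<le> C * (LINT x|lborel. cutoff e x)"
proof -
  define \<phi> where "\<phi> y = cutoff e (z - y)" for y
  have smooth: "smooth \<phi>" unfolding smooth_iff_diff_times \<phi>_def[abs_def] by (intro allI diff_times_reflect diff_times_cutoff)
  have pd: "partial_deriv k \<phi> = (\<lambda>y. - partial_deriv k (cutoff e) (z - y))"
    unfolding \<phi>_def[abs_def] by (rule partial_deriv_reflect) (rule smooth_differentiable[OF smooth_cutoff])
  have out: "\<phi> y = 0" if "y \<notin> cball z (4 * e)" for y
    using that e by (auto simp: \<phi>_def dist_norm intro!: cutoff_eq_0)
  have supp: "supp \<phi> \<subseteq> cball z (4 * e)"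
  proof -
    have "{y. \<phi> y \<noteq> 0} \<subseteq> cball z (4 * e)" using out by blast
    then show ?thesis unfolding supp_def by (intro closure_minimal) auto
  qed
  have cc: "\<phi> \<in> Cc_infty"
    unfolding Cc_infty_def using smooth supp by (auto simp: supp_def compact_eq_bounded_closed intro: bounded_subset[OF bounded_cball])
  have pd0: "partial_deriv k \<phi> y = 0" if "y \<notin> U" for y
    by (rule partial_deriv_zero_on_open[of "- cball z (4 * e)"]) (use that z out in auto)
  have "(LINT x:U|lborel. partial_deriv k \<phi> x *\<^sub>R u x) = - (LINT x:U|lborel. \<phi> x *\<^sub>R (g x $ k))"
    using wg cc supp z unfolding weak_gradient_on_def by blast
  moreover have "(LINT x:U|lborel. partial_deriv k \<phi> x *\<^sub>R u x) = (LINT x|lborel. partial_deriv k \<phi> x *\<^sub>R u x)"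
    unfolding set_lebesgue_integral_def using pd0 by (intro Bochner_Integration.integral_cong) (auto simp: indicator_def)
  ultimately have eq: "(LINT y|lborel. partial_deriv k (cutoff e) (z - y) *\<^sub>R u y) = (LINT x:U|lborel. \<phi> x *\<^sub>R (g x $ k))"
    by (simp add: pd)
  have "AE x in restrict_space lborel U. ennreal (norm (g x)) \<le> ennreal C"
    using esssup_AE[of "\<lambda>x. ennreal (norm (g x))" "restrict_space lborel U"] gC unfolding Linfty_norm_def
    by (auto elim: eventually_mono)
  then have ae: "AE x in lborel. x \<in> U \<longrightarrow> norm (g x) \<le> C"
    using U C by (subst (asm) AE_restrict_space_iff) (auto elim!: eventually_mono)
  have int: "integrable lborel \<phi>"
    unfolding \<phi>_def[abs_def] by (intro integrable_lborel_reflect integrable_cutoff e)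
  have "norm (LINT x:U|lborel. \<phi> x *\<^sub>R (g x $ k)) \<le> (LINT x|lborel. norm (indicator U x *\<^sub>R (\<phi> x *\<^sub>R (g x $ k))))"
    unfolding set_lebesgue_integral_def by (rule integral_norm_bound)
  also have "\<dots> \<le> (LINT x|lborel. C * \<phi> x)"
  proof (rule integral_mono_AE')
    show "AE x in lborel. norm (indicator U x *\<^sub>R (\<phi> x *\<^sub>R (g x $ k))) \<le> C * \<phi> x"
      using ae
    proof eventually_elim
      case (elim x)
      have "norm (g x $ k) \<le> C" if "x \<in> U" using elim that Finite_Cartesian_Product.norm_nth_le[of "g x" k] by simp
      then show ?case using C
        by (auto simp: indicator_def \<phi>_def cutoff_range mult.commute[of _ "cutoff e (z - x)"] intro!: mult_left_mono)
    qed
    show "AE x in lborel. 0 \<le> C * \<phi> x" using C by (auto simp: \<phi>_def cutoff_range)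
  qed (use int in auto)
  also have "\<dots> = C * (LINT x|lborel. cutoff e x)"
    using integral_lborel_reflect[of "cutoff e" z]
    by (simp add: \<phi>_def borel_measurable_continuous_onI smooth_continuous_on smooth_cutoff)
  finally show ?thesis unfolding eq .
qed

text \<open>
  The mollification of \<open>u\<close> along the segment from \<open>p\<close> to \<open>x\<close> is differentiable under the integral
  sign, and its derivative is controlled by the bound on the weak gradient. As the mollification
  radius tends to 0, the mollified values at the endpoints approach those of the continuous function
  \<open>u\<close>. The factor 2 comes from bounding the two partial derivatives separately.
\<close>

lemma weak_gradient_imp_lipschitz_from_center:
  fixes u :: "real^2 \<Rightarrow> complex"
  assumes u: "continuous_on UNIV u" and wg: "weak_gradient_on (ball p r) u g"
    and gC: "Linfty_norm (ball p r) g \<le> ennreal C" and C: "C \<ge> 0"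
    and x: "x \<in> ball p r"
  shows "norm (u x - u p) \<le> 2 * C * norm (x - p)"
proof (rule field_le_epsilon)
  fix \<eta> :: real assume \<eta>: "\<eta> > 0"
  define v where "v = x - p"
  have v: "norm v < r" using x by (simp add: v_def dist_norm norm_minus_commute)
  have "\<exists>d>0. \<forall>y. dist y w < d \<longrightarrow> dist (u y) (u w) < \<eta> / 2" for w
    using u[unfolded continuous_on_iff] half_gt_zero[OF \<eta>] by (metis UNIV_I)
  then obtain d where d: "\<And>w. d w > 0" "\<And>w y. dist y w < d w \<Longrightarrow> dist (u y) (u w) < \<eta> / 2" by metis
  \<comment> \<open>The cutoff of parameter \<open>e\<close> is supported in the ball of radius \<open>4e\<close>; division by 8 keeps its
    translates along the segment inside the ball and within the moduli of continuity.\<close>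
  define e where "e = min (r - norm v) (min (d x) (d p)) / 8"
  have e: "e > 0" "norm v + 4 * e < r" "4 * e < d x" "4 * e < d p"
  proof -
    have le: "e \<le> (r - norm v) / 8" "e \<le> d x / 8" "e \<le> d p / 8" by (auto simp: e_def)
    show "e > 0" using v d(1) by (simp add: e_def)
    have "4 * e \<le> (r - norm v) / 2" using le(1) by simp
    also have "\<dots> < r - norm v" using v by simp
    finally show "norm v + 4 * e < r" by simp
    show "4 * e < d x" "4 * e < d p" using le d(1)[of x] d(1)[of p] by auto
  qed
  let ?N = "LINT x|lborel. cutoff e x"
  have N: "?N > 0" using integral_cutoff_pos e by blast
  obtain a where a: "ball p r \<subseteq> cbox (- a) a" using bounded_subset_cbox_symmetric[OF bounded_ball] by blast
  have sub: "y \<notin> ball p r" if "y \<notin> cbox (- a) a" for y using a that by blast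
  define \<Phi> where "\<Phi> t = (LINT y|lborel. cutoff e (p + t *\<^sub>R v - y) *\<^sub>R u y)" for t
  have inside: "cball (p + t *\<^sub>R v) (4 * e) \<subseteq> ball p r" if "t \<in> {0..1}" for t
  proof
    fix y assume "y \<in> cball (p + t *\<^sub>R v) (4 * e)"
    then have "norm (y - (p + t *\<^sub>R v)) \<le> 4 * e" by (simp add: dist_norm norm_minus_commute)
    moreover have "norm (t *\<^sub>R v) \<le> norm v" using that by (simp add: mult_left_le_one_le)
    moreover have "norm (y - p) \<le> norm (y - (p + t *\<^sub>R v)) + norm (t *\<^sub>R v)"
      using norm_triangle_ineq[of "y - (p + t *\<^sub>R v)" "t *\<^sub>R v"] by (simp add: algebra_simps)
    ultimately show "y \<in> ball p r" using e(2) by (simp add: dist_norm norm_minus_commute)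
  qed
  have z0: "cutoff e (p + t *\<^sub>R v - y) = 0" if "t \<in> {0..1}" "y \<notin> ball p r" for t y
  proof -
    have "y \<notin> cball (p + t *\<^sub>R v) (4 * e)" using inside[OF that(1)] that(2) by blast
    then show ?thesis using e(1) by (intro cutoff_eq_0) (auto simp: dist_norm)
  qed
  have zd: "partial_deriv k (cutoff e) (p + t *\<^sub>R v - y) = 0" if "t \<in> {0..1}" "y \<notin> ball p r" for t y k
  proof -
    have "y \<notin> cball (p + t *\<^sub>R v) (4 * e)" using inside[OF that(1)] that(2) by blast
    then show ?thesis
      by (intro partial_deriv_zero_on_open[of "- cball 0 (4 * e)"]) (use e(1) in \<open>auto simp: dist_norm norm_minus_commute intro!: cutoff_eq_0\<close>)
  qed
  have \<Phi>HK: "\<Phi> t = integral (cbox (- a) a) (\<lambda>y. cutoff e (p + t *\<^sub>R v - y) *\<^sub>R u y)" if "t \<in> {0..1}" for t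
    unfolding \<Phi>_def
    by (intro LINT_eq_HK_integral[symmetric] continuous_intros u) (simp add: z0[OF that sub])
  define F' where "F' t y = v $ 1 *\<^sub>R (partial_deriv 1 (cutoff e) (p + t *\<^sub>R v - y) *\<^sub>R u y) + v $ 2 *\<^sub>R (partial_deriv 2 (cutoff e) (p + t *\<^sub>R v - y) *\<^sub>R u y)" for t y
  have cpd: "continuous_on S h \<Longrightarrow> continuous_on S (\<lambda>w. partial_deriv k (cutoff e) (h w))" for k S and h :: "'w::topological_space \<Rightarrow> real^2"
    by (rule continuous_on_compose2[OF smooth_continuous_on[OF smooth_partial_deriv[OF smooth_cutoff], where S=UNIV]]) auto
  have der: "(\<Phi> has_vector_derivative integral (cbox (- a) a) (F' t)) (at t within {0..1})" if t: "t \<in> {0..1}" for t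
  proof -
    have "((\<lambda>t. integral (cbox (- a) a) (\<lambda>y. cutoff e (p + t *\<^sub>R v - y) *\<^sub>R u y)) has_vector_derivative integral (cbox (- a) a) (F' t)) (at t within {0..1})"
    proof (rule leibniz_rule_vector_derivative)
      fix t y assume "t \<in> {0..1::real}" "y \<in> cbox (- a) a"
      have 1: "((\<lambda>t. p + t *\<^sub>R v - y) has_derivative (\<lambda>h. h *\<^sub>R v)) (at t within {0..1})"
        by (auto intro!: derivative_eq_intros)
      have 2: "((\<lambda>t. cutoff e (p + t *\<^sub>R v - y)) has_derivative (\<lambda>h. frechet_derivative (cutoff e) (at (p + t *\<^sub>R v - y)) (h *\<^sub>R v))) (at t within {0..1})"
        by (rule has_derivative_compose[OF 1 smooth_has_derivative[OF smooth_cutoff]])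
      have 3: "frechet_derivative (cutoff e) (at (p + t *\<^sub>R v - y)) (h *\<^sub>R v) =
          h * (v $ 1 * partial_deriv 1 (cutoff e) (p + t *\<^sub>R v - y) + v $ 2 * partial_deriv 2 (cutoff e) (p + t *\<^sub>R v - y))" for h
        by (subst frechet_eq_partials[OF smooth_differentiable[OF smooth_cutoff]]) (simp add: algebra_simps)
      show "((\<lambda>t. cutoff e (p + t *\<^sub>R v - y) *\<^sub>R u y) has_vector_derivative F' t y) (at t within {0..1})"
        unfolding has_vector_derivative_def
        by (rule has_derivative_eq_rhs[OF has_derivative_scaleR_left[OF 2]])
          (simp add: 3 F'_def fun_eq_iff algebra_simps)
    next
      show "(\<lambda>y. cutoff e (p + t *\<^sub>R v - y) *\<^sub>R u y) integrable_on cbox (- a) a" for t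
        by (intro integrable_continuous continuous_intros continuous_on_subset[OF u]) auto
      show "continuous_on ({0..1} \<times> cbox (- a) a) (\<lambda>(t, y). F' t y)"
        unfolding F'_def case_prod_unfold by (intro continuous_intros cpd continuous_on_compose2[OF u]) auto
    qed (use t in auto)
    then show ?thesis
      by (rule has_vector_derivative_transform[OF t, rotated]) (simp add: \<Phi>HK)
  qed
  have bnd: "norm (integral (cbox (- a) a) (F' t)) \<le> 2 * C * norm v * ?N" if t: "t \<in> {0..1}" for t
  proof -
    let ?I = "\<lambda>k. LINT y|lborel. partial_deriv k (cutoff e) (p + t *\<^sub>R v - y) *\<^sub>R u y"
    have c: "continuous_on UNIV (\<lambda>y. partial_deriv k (cutoff e) (p + t *\<^sub>R v - y) *\<^sub>R u y)" for k
      by (intro continuous_intros cpd u)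
    have eq: "integral (cbox (- a) a) (F' t) = v $ 1 *\<^sub>R ?I 1 + v $ 2 *\<^sub>R ?I 2"
    proof -
      have "integral (cbox (- a) a) (F' t) = v $ 1 *\<^sub>R integral (cbox (- a) a) (\<lambda>y. partial_deriv 1 (cutoff e) (p + t *\<^sub>R v - y) *\<^sub>R u y)
         + v $ 2 *\<^sub>R integral (cbox (- a) a) (\<lambda>y. partial_deriv 2 (cutoff e) (p + t *\<^sub>R v - y) *\<^sub>R u y)"
        unfolding F'_def integral_cmul[symmetric]
        by (intro Henstock_Kurzweil_Integration.integral_add integrable_continuous continuous_intros continuous_on_subset[OF c]) auto
      moreover have "integral (cbox (- a) a) (\<lambda>y. partial_deriv k (cutoff e) (p + t *\<^sub>R v - y) *\<^sub>R u y) = ?I k" for k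
        by (intro LINT_eq_HK_integral c) (simp add: zd[OF t sub])
      ultimately show ?thesis by simp
    qed
    have "norm (integral (cbox (- a) a) (F' t)) \<le> norm (v $ 1 *\<^sub>R ?I 1) + norm (v $ 2 *\<^sub>R ?I 2)"
      unfolding eq by (rule norm_triangle_ineq)
    also have "\<dots> \<le> norm v * (C * ?N) + norm v * (C * ?N)"
      unfolding norm_scaleR
      by (intro add_mono mult_mono mollified_gradient_bound[OF wg _ gC C e(1) inside[OF t]])
        (auto simp: component_le_norm_cart)
    finally show ?thesis by (simp add: algebra_simps)
  qed
  have "norm (\<Phi> 1 - \<Phi> 0) \<le> (2 * C * norm v * ?N) * norm (1 - (0::real))"
  proof (rule differentiable_bound[of "{0..1}"])
    fix t :: real assume t: "t \<in> {0..1}"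
    show "(\<Phi> has_derivative (\<lambda>h. h *\<^sub>R integral (cbox (- a) a) (F' t))) (at t within {0..1})"
      using der[OF t] by (simp add: has_vector_derivative_def)
    show "onorm (\<lambda>h. h *\<^sub>R integral (cbox (- a) a) (F' t)) \<le> 2 * C * norm v * ?N"
      by (rule onorm_le) (use bnd[OF t] in \<open>auto simp: mult.commute intro!: mult_left_mono\<close>)
  qed auto
  then have L: "norm (\<Phi> 1 - \<Phi> 0) \<le> 2 * C * norm v * ?N" by simp
  have near: "norm (\<Phi> t - ?N *\<^sub>R u (p + t *\<^sub>R v)) \<le> \<eta> / 2 * ?N" if t: "t \<in> {0..1}" and dt: "4 * e < d (p + t *\<^sub>R v)" for t
  proof -
    let ?w = "p + t *\<^sub>R v"
    have i1: "integrable lborel (\<lambda>y. cutoff e (?w - y))" by (intro integrable_lborel_reflect integrable_cutoff e)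
    have N': "(LINT y|lborel. cutoff e (?w - y)) = ?N"
      by (rule integral_lborel_reflect) (simp add: borel_measurable_continuous_onI smooth_continuous_on smooth_cutoff)
    have "integrable lborel (\<lambda>y. indicator (cball p r) y *\<^sub>R (cutoff e (?w - y) *\<^sub>R u y))"
      by (intro borel_integrable_compact continuous_intros continuous_on_subset[OF u]) auto
    moreover have "(\<lambda>y. indicator (cball p r) y *\<^sub>R (cutoff e (?w - y) *\<^sub>R u y)) = (\<lambda>y. cutoff e (?w - y) *\<^sub>R u y)"
    proof
      fix y show "indicator (cball p r) y *\<^sub>R (cutoff e (?w - y) *\<^sub>R u y) = cutoff e (?w - y) *\<^sub>R u y"
        by (cases "y \<in> ball p r") (auto simp: z0[OF t] indicator_def)
    qed
    ultimately have i2: "integrable lborel (\<lambda>y. cutoff e (?w - y) *\<^sub>R u y)" by simp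
    have eq: "\<Phi> t - ?N *\<^sub>R u ?w = (LINT y|lborel. cutoff e (?w - y) *\<^sub>R u y - cutoff e (?w - y) *\<^sub>R u ?w)"
      unfolding \<Phi>_def using i1 i2 by (subst Bochner_Integration.integral_diff) (auto simp: N')
    have "norm (\<Phi> t - ?N *\<^sub>R u ?w) \<le> (LINT y|lborel. \<eta> / 2 * cutoff e (?w - y))"
      unfolding eq
    proof (rule integral_norm_bound[THEN order_trans], rule integral_mono')
      fix y
      show "norm (cutoff e (?w - y) *\<^sub>R u y - cutoff e (?w - y) *\<^sub>R u ?w) \<le> \<eta> / 2 * cutoff e (?w - y)"
      proof (cases "norm (?w - y) \<ge> 4 * e")
        case True then show ?thesis using cutoff_eq_0[OF e(1)] by simp
      next
        case False
        then have "dist y ?w < d ?w" using dt by (simp add: dist_norm norm_minus_commute)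
        then have "norm (u y - u ?w) \<le> \<eta> / 2" using d(2) by (simp add: dist_norm less_imp_le)
        then have "cutoff e (?w - y) * norm (u y - u ?w) \<le> cutoff e (?w - y) * (\<eta> / 2)"
          by (intro mult_left_mono cutoff_range)
        then show ?thesis
          unfolding scaleR_diff_right[symmetric] norm_scaleR abs_of_nonneg[OF cutoff_range(1)]
          by (subst (2) mult.commute)
      qed
    qed (use i1 \<eta> in \<open>auto simp: cutoff_range\<close>)
    also have "\<dots> = \<eta> / 2 * ?N" by (simp add: N')
    finally show ?thesis .
  qed
  have n1: "norm (\<Phi> 1 - ?N *\<^sub>R u x) \<le> \<eta> / 2 * ?N" using near[of 1] e(3) by (simp add: v_def)
  have n0: "norm (\<Phi> 0 - ?N *\<^sub>R u p) \<le> \<eta> / 2 * ?N" using near[of 0] e(4) by simp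
  have tri: "norm (A - B) \<le> norm (P - A) + norm (Q - B) + norm (P - Q)" for A B P Q :: complex
    by norm
  have "?N * norm (u x - u p) = norm (?N *\<^sub>R u x - ?N *\<^sub>R u p)"
    using N by (simp add: scaleR_diff_right[symmetric])
  also have "\<dots> \<le> norm (\<Phi> 1 - ?N *\<^sub>R u x) + norm (\<Phi> 0 - ?N *\<^sub>R u p) + norm (\<Phi> 1 - \<Phi> 0)"
    by (rule tri)
  also have "\<dots> \<le> \<eta> / 2 * ?N + \<eta> / 2 * ?N + 2 * C * norm v * ?N" using n0 n1 L by linarith
  also have "\<dots> = ?N * (2 * C * norm (x - p) + \<eta>)" by (simp add: v_def algebra_simps)
  finally show "norm (u x - u p) \<le> 2 * C * norm (x - p) + \<eta>" using N by simp
qed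

section \<open>Frequency localisation of the filter bank\<close>

lemma norm_R_mat: "norm (R_mat \<beta> j l *v y) = norm y"
proof -
  let ?t = "theta \<beta> j l"
  have "(norm (R_mat \<beta> j l *v y))\<^sup>2 = (cos ?t * y $ 1 - sin ?t * y $ 2)\<^sup>2 + (sin ?t * y $ 1 + cos ?t * y $ 2)\<^sup>2"
    by (simp add: norm_real2_sq R_mat_def matrix_vector_mult_def sum_2)
  also have "\<dots> = ((sin ?t)\<^sup>2 + (cos ?t)\<^sup>2) * ((y $ 1)\<^sup>2 + (y $ 2)\<^sup>2)"
    by algebra
  also have "\<dots> = (norm y)\<^sup>2" by (simp add: norm_real2_sq)
  finally show ?thesis by simp
qed

text \<open>
  Rotations preserve the norm, and before the rotation the first coordinate is at least
  \<open>2\<^sup>j\<^sup>-\<^sup>1 - \<epsilon>\<^sub>0 2\<^sup>\<alpha>\<^sup>j \<ge> 2\<^sup>j\<^sup>-\<^sup>1 (1 - 2\<epsilon>\<^sub>0) \<ge> 15/16\<close>.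
\<close>

lemma tiles_avoid_low_frequencies:
  assumes ab: "\<alpha> \<le> 1" and e: "0 < \<epsilon>\<^sub>0" "\<epsilon>\<^sub>0 < 1 / 32" and i: "i \<in> I_star \<alpha> \<beta>"
    and \<xi>: "\<xi> \<in> Q_set \<alpha> \<beta> \<epsilon>\<^sub>0 (Some i)"
  shows "15 / 16 \<le> norm \<xi>"
proof -
  obtain j m l where i': "i = (j, m, l)" "1 \<le> j" using i by (auto simp: I_star_def)
  obtain x where x: "x \<in> Q_ref \<epsilon>\<^sub>0" "\<xi> = R_mat \<beta> j l *v (A_mat \<alpha> \<beta> j *v x + c_vec \<alpha> j m)"
    using \<xi> by (auto simp: Q_set_def place_def i')
  let ?y = "A_mat \<alpha> \<beta> j *v x + c_vec \<alpha> j m"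
  have x1: "- \<epsilon>\<^sub>0 < x $ 1" using x(1) by (auto simp: Q_ref_def mem_box_cart forall_2)
  have "2 powr (\<alpha> * real j) \<le> 2 powr (real j)" using mult_right_mono[OF ab, of "real j"] by (intro powr_mono) auto
  also have "\<dots> = 2 * 2 powr (real j - 1)" by (simp add: powr_diff)
  finally have pa: "2 powr (\<alpha> * real j) \<le> 2 * 2 powr (real j - 1)" .
  have p1: "1 \<le> 2 powr (real j - 1)" using i'(2) by (intro ge_one_powr_ge_zero) auto
  have "- (1 / 32) * (2 * 2 powr (real j - 1)) \<le> - \<epsilon>\<^sub>0 * (2 * 2 powr (real j - 1))" using e by simp
  also have "\<dots> \<le> - \<epsilon>\<^sub>0 * 2 powr (\<alpha> * real j)" using pa e by simp
  also have "\<dots> \<le> x $ 1 * 2 powr (\<alpha> * real j)" using x1 by (intro mult_right_mono) auto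
  finally have 1: "- (1 / 16) * 2 powr (real j - 1) \<le> 2 powr (\<alpha> * real j) * x $ 1" by (simp add: mult.commute)
  have "?y $ 1 = 2 powr (\<alpha> * real j) * x $ 1 + (2 powr (real j - 1) + real m * 2 powr (\<alpha> * real j))"
    by (simp add: A_mat_def c_vec_def matrix_vector_mult_def sum_2)
  moreover have "0 \<le> real m * 2 powr (\<alpha> * real j)" by simp
  ultimately have "15 / 16 \<le> ?y $ 1" using 1 p1 by linarith
  also have "\<dots> \<le> norm ?y" using component_le_norm_cart[of ?y 1] by linarith
  also have "\<dots> = norm \<xi>" by (simp add: x(2) norm_R_mat)
  finally show ?thesis .
qed

lemma fourier_eq_0_outside_supp: "\<xi> \<notin> S \<Longrightarrow> supp (fourier f) \<subseteq> S \<Longrightarrow> fourier f \<xi> = 0"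
  unfolding supp_def using closure_subset[of "{x. fourier f x \<noteq> 0}"] by blast

text \<open>
  The partition of unity gives this almost everywhere, and the multiplier is continuous.
\<close>

lemma bank_multiplier_le_1:
  assumes b: "scattering_bank \<alpha> \<beta> \<epsilon>\<^sub>0 chi \<psi>" and i: "i \<in> I_star \<alpha> \<beta>"
  shows "norm (fourier (\<psi> i) \<xi>) \<le> 1"
proof -
  have int: "integrable lborel (\<psi> i)" using b i by (auto simp: scattering_bank_def)
  let ?F = "\<lambda>\<xi> i. (cmod (fourier (\<psi> i) \<xi>))\<^sup>2"
  have "AE \<xi> in lborel. ?F \<xi> summable_on I_star \<alpha> \<beta> \<and> (cmod (fourier chi \<xi>))\<^sup>2 + infsum (?F \<xi>) (I_star \<alpha> \<beta>) = 1"
    using b by (simp add: scattering_bank_def)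
  then have "AE \<xi> in lborel. \<xi> \<in> {\<xi>. norm (fourier (\<psi> i) \<xi>) \<le> 1}"
  proof eventually_elim
    case (elim \<xi>)
    then have "sum (?F \<xi>) {i} \<le> infsum (?F \<xi>) (I_star \<alpha> \<beta>)" using i by (intro finite_sum_le_infsum) auto
    also have "\<dots> \<le> 1" using elim zero_le_power2[of "cmod (fourier chi \<xi>)"] by linarith
    finally show ?case by (simp add: power_le_one_iff)
  qed
  moreover have "closed {\<xi>. norm (fourier (\<psi> i) \<xi>) \<le> 1}"
    using continuous_on_fourier[OF int] by (intro closed_Collect_le continuous_intros) auto
  ultimately have "\<xi> \<in> {\<xi>. norm (fourier (\<psi> i) \<xi>) \<le> 1}" by (intro AE_lborel_closed_imp_all)
  then show ?thesis by simp
qed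

text \<open>
  All other summands of the partition of unity vanish on this ball.
\<close>

lemma bank_chi_eq_1_near_0:
  assumes b: "scattering_bank \<alpha> \<beta> \<epsilon>\<^sub>0 chi \<psi>" and ab: "\<alpha> \<le> 1" and e: "0 < \<epsilon>\<^sub>0" "\<epsilon>\<^sub>0 < 1 / 32"
  shows "AE \<xi> in lborel. norm \<xi> < 15 / 16 \<longrightarrow> norm (fourier chi \<xi>) = 1"
proof -
  let ?F = "\<lambda>\<xi> i. (cmod (fourier (\<psi> i) \<xi>))\<^sup>2"
  have "AE \<xi> in lborel. ?F \<xi> summable_on I_star \<alpha> \<beta> \<and> (cmod (fourier chi \<xi>))\<^sup>2 + infsum (?F \<xi>) (I_star \<alpha> \<beta>) = 1"
    using b by (simp add: scattering_bank_def)
  then show ?thesis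
  proof eventually_elim
    case (elim \<xi>)
    show ?case
    proof
      assume n: "norm \<xi> < 15 / 16"
      have "?F \<xi> i = 0" if i: "i \<in> I_star \<alpha> \<beta>" for i
      proof -
        have "\<xi> \<notin> Q_set \<alpha> \<beta> \<epsilon>\<^sub>0 (Some i)" using tiles_avoid_low_frequencies[OF ab e i] n by force
        moreover have "supp (fourier (\<psi> i)) \<subseteq> Q_set \<alpha> \<beta> \<epsilon>\<^sub>0 (Some i)" using b i by (auto simp: scattering_bank_def)
        ultimately show ?thesis by (simp add: fourier_eq_0_outside_supp)
      qed
      then have "infsum (?F \<xi>) (I_star \<alpha> \<beta>) = 0" by (rule infsum_0)
      then have "(cmod (fourier chi \<xi>))\<^sup>2 = 1" using elim by simp
      then show "norm (fourier chi \<xi>) = 1" by (simp add: power2_eq_1_iff) (use norm_ge_zero[of "fourier chi \<xi>"] in linarith)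
    qed
  qed
qed

lemma ell2_L2_norm_ge:
  assumes i: "i \<in> A" and c: "c \<ge> 0" and e: "ennreal (c\<^sup>2) \<le> energy (q i)"
  shows "ennreal c \<le> ell2_L2_norm A q"
proof -
  have "energy (q i) = (\<Sum>\<^sub>\<infinity>p\<in>{i}. (L2_norm (q p))\<^sup>2)" by (simp add: L2_norm_power2)
  also have "\<dots> \<le> (\<Sum>\<^sub>\<infinity>p\<in>A. (L2_norm (q p))\<^sup>2)"
    using i by (intro infsum_mono_neutral) (auto intro: nonneg_summable_on_complete)
  finally have "ennreal (c\<^sup>2) \<le> (\<Sum>\<^sub>\<infinity>p\<in>A. (L2_norm (q p))\<^sup>2)" using e by (rule order_trans[rotated])
  then show ?thesis unfolding ell2_L2_norm_def
  proof (cases "\<Sum>\<^sub>\<infinity>p\<in>A. (L2_norm (q p))\<^sup>2")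
    case (real r)
    assume "ennreal (c\<^sup>2) \<le> (\<Sum>\<^sub>\<infinity>p\<in>A. (L2_norm (q p))\<^sup>2)"
    then have "c\<^sup>2 \<le> r" using real by simp
    then have "c \<le> sqrt r" using c by (simp add: real_le_rsqrt)
    then show "ennreal c \<le> ennsqrt (\<Sum>\<^sub>\<infinity>p\<in>A. (L2_norm (q p))\<^sup>2)" using real by (simp add: ennsqrt_def ennreal_leI)
  qed (simp add: ennsqrt_def)
qed

section \<open>The change of a single channel\<close>

lemma of_real_norm_integrable:
  fixes f :: "real^2 \<Rightarrow> complex"
  shows "integrable lborel f \<Longrightarrow> integrable lborel (\<lambda>x. complex_of_real (norm (f x)))"
  using integrable_norm[of lborel f] by (simp add: complex_of_real_integrable_eq)

text \<open>
  Write \<open>V\<close>, \<open>U\<close> and \<open>F\<close> for the moduli of \<open>h * \<psi>\<close>, \<open>f * \<psi>\<close> and \<open>f\<close>, so that the change of the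
  channel is \<open>(V - U) * chi\<close>. On the low-frequency ball, where the transform of \<open>chi\<close> has modulus 1,
  its Fourier transform has the same modulus as that of \<open>V - U\<close>. There \<open>|c| F\<close> is recovered from
  \<open>V - U\<close> up to \<open>V\<close>, which is small if \<open>\<psi>\<close> suppresses \<open>h\<close>, and up to \<open>U - |c| F\<close>, which is small if
  \<open>\<psi>\<close> acts on \<open>f\<close> almost as multiplication by \<open>c\<close>.
\<close>

lemma first_layer_energy_lower_bound:
  fixes f h chi \<psi> :: "real^2 \<Rightarrow> complex"
  assumes f: "integrable lborel f" and h: "integrable lborel h"
    and chi: "integrable lborel chi" and \<psi>: "integrable lborel \<psi>"
    and one: "AE \<xi> in lborel. norm \<xi> < \<rho> \<longrightarrow> norm (fourier chi \<xi>) = 1"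
  defines "S \<equiv> \<lambda>f. convolution (\<lambda>x. complex_of_real (cmod (convolution f \<psi> x))) chi"
  shows "energy (\<lambda>\<xi>. if norm \<xi> < \<rho> then complex_of_real (norm c) * fourier (\<lambda>x. complex_of_real (norm (f x))) \<xi> else 0)
     \<le> 3 * energy (\<lambda>x. S h x - S f x) + 3 * energy (\<lambda>x. convolution f \<psi> x - c * f x) + 3 * energy (convolution h \<psi>)"
proof -
  define U where "U x = complex_of_real (norm (convolution f \<psi> x))" for x
  define V where "V x = complex_of_real (norm (convolution h \<psi> x))" for x
  define F where "F x = complex_of_real (norm (f x))" for x
  have U: "integrable lborel U" unfolding U_def by (intro of_real_norm_integrable integrable_convolution f \<psi>)
  have V: "integrable lborel V" unfolding V_def by (intro of_real_norm_integrable integrable_convolution h \<psi>)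
  have F: "integrable lborel F" unfolding F_def by (intro of_real_norm_integrable f)
  let ?c = "complex_of_real (norm c)"
  have cF: "integrable lborel (\<lambda>x. ?c * F x)" using F by simp
  define q where "q x = convolution V chi x - convolution U chi x" for x
  have q: "integrable lborel q" unfolding q_def by (intro Bochner_Integration.integrable_diff integrable_convolution U V chi)
  have qS: "q = (\<lambda>x. S h x - S f x)" unfolding q_def[abs_def] S_def U_def[abs_def] V_def[abs_def] by (rule refl)
  have qh: "fourier q \<xi> = (fourier V \<xi> - fourier U \<xi>) * fourier chi \<xi>" for \<xi>
    unfolding q_def by (simp add: fourier_diff integrable_convolution U V chi fourier_convolution left_diff_distrib)
  define D where "D x = U x - ?c * F x" for x
  have D: "integrable lborel D" unfolding D_def using U F by (intro Bochner_Integration.integrable_diff) auto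
  have Dh: "fourier D \<xi> = fourier U \<xi> - ?c * fourier F \<xi>" for \<xi>
    unfolding D_def by (simp add: fourier_diff U cF fourier_cmult)
  have "energy (\<lambda>\<xi>. if norm \<xi> < \<rho> then ?c * fourier F \<xi> else 0) \<le> 3 * energy (fourier q) + 3 * energy (fourier D) + 3 * energy (fourier V)"
  proof (rule energy_triangle3)
    show "AE \<xi> in lborel. norm (if norm \<xi> < \<rho> then ?c * fourier F \<xi> else 0) \<le> norm (fourier q \<xi>) + norm (fourier D \<xi>) + norm (fourier V \<xi>)"
      using one
    proof eventually_elim
      case (elim \<xi>)
      show ?case
      proof (cases "norm \<xi> < \<rho>")
        case True
        then have "norm (fourier q \<xi>) = norm (fourier V \<xi> - fourier U \<xi>)" using elim by (simp add: qh norm_mult)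
        moreover have "?c * fourier F \<xi> = fourier V \<xi> - (fourier V \<xi> - fourier U \<xi>) - fourier D \<xi>" by (simp add: Dh)
        moreover have "norm (fourier V \<xi> - (fourier V \<xi> - fourier U \<xi>) - fourier D \<xi>) \<le>
            norm (fourier V \<xi> - fourier U \<xi>) + norm (fourier D \<xi>) + norm (fourier V \<xi>)" by norm
        ultimately show ?thesis using True by (simp only: if_True)
      qed auto
    qed
  qed (use q D V fourier_measurable in auto)
  also have "\<dots> \<le> 3 * energy q + 3 * energy D + 3 * energy V"
    by (intro add_mono mult_left_mono energy_fourier_le q D V) auto
  also have "energy V = energy (convolution h \<psi>)" by (rule energy_cong) (simp add: V_def)
  also have "3 * energy q + 3 * energy D + 3 * energy (convolution h \<psi>) \<le>
     3 * energy (\<lambda>x. S h x - S f x) + 3 * energy (\<lambda>x. convolution f \<psi> x - c * f x) + 3 * energy (convolution h \<psi>)"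
  proof (intro add_mono mult_left_mono)
    show "energy D \<le> energy (\<lambda>x. convolution f \<psi> x - c * f x)"
    proof (rule energy_mono)
      fix x
      have "norm (D x) = \<bar>norm (convolution f \<psi> x) - norm (c * f x)\<bar>"
        by (simp add: D_def U_def F_def norm_mult flip: of_real_mult of_real_diff)
      also have "\<dots> \<le> norm (convolution f \<psi> x - c * f x)" by (rule norm_triangle_ineq3)
      finally show "norm (D x) \<le> norm (convolution f \<psi> x - c * f x)" .
    qed
  qed (auto simp: qS)
  finally show ?thesis unfolding F_def .
qed

lemma energy_cmult: "energy (\<lambda>x. c *\<^sub>R f x) = ennreal (c\<^sup>2) * energy f" if [measurable]: "f \<in> borel_measurable borel"
  unfolding energy_def by (simp add: power_mult_distrib ennreal_mult nn_integral_cmult)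

text \<open>
  A bound for the energy of the transform of a packet at distance at least \<open>r\<close> from its centre.
\<close>

definition packet_tail :: "real \<Rightarrow> real \<Rightarrow> real" where
  "packet_tail a r = exp (- (pi * r\<^sup>2 / a)) / a"

lemma energy_fourier_wave_packet:
  assumes a: "a > 0"
  shows "energy (fourier (wave_packet a \<eta>)) = ennreal (1 / (2 * a))"
proof -
  have "energy (fourier (wave_packet a \<eta>)) = energy (\<lambda>\<xi>. (1 / a) *\<^sub>R gaussian (1 / a) (\<xi> - \<eta>))"
    by (rule energy_cong) (use a in \<open>simp add: fourier_wave_packet norm_divide\<close>)
  also have "\<dots> = ennreal ((1 / a)\<^sup>2) * energy (gaussian (1 / a))"
    by (subst energy_cmult) (auto simp: energy_translate)
  also have "\<dots> = ennreal (1 / (2 * a))"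
    using a by (simp add: energy_gaussian power2_eq_square flip: ennreal_mult)
  finally show ?thesis .
qed

lemma energy_fourier_wave_packet_tail:
  assumes a: "a > 0" and r: "r \<ge> 0"
  shows "energy (\<lambda>\<xi>. if norm (\<xi> - \<eta>) < r then 0 else fourier (wave_packet a \<eta>) \<xi>) \<le> ennreal (packet_tail a r)"
proof -
  have "energy (\<lambda>\<xi>. if norm (\<xi> - \<eta>) < r then 0 else fourier (wave_packet a \<eta>) \<xi>)
      = energy (\<lambda>\<xi>. (1 / a) *\<^sub>R (\<lambda>\<xi>. if norm \<xi> < r then 0 else gaussian (1 / a) \<xi>) (\<xi> - \<eta>))"
    by (rule energy_cong) (use a in \<open>simp add: fourier_wave_packet norm_divide\<close>)
  also have "\<dots> = ennreal ((1 / a)\<^sup>2) * energy (\<lambda>\<xi>. if norm \<xi> < r then 0 else gaussian (1 / a) \<xi>)"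
    by (subst energy_cmult, measurable) (subst energy_translate, auto)
  also have "\<dots> \<le> ennreal ((1 / a)\<^sup>2) * ennreal (exp (- (pi * (1 / a) * r\<^sup>2)) / (1 / a))"
    using a r by (intro mult_left_mono energy_gaussian_tail) auto
  also have "\<dots> = ennreal (packet_tail a r)"
    using a by (simp add: packet_tail_def power2_eq_square mult_ac flip: ennreal_mult)
  finally show ?thesis .
qed

lemma energy_split:
  assumes [measurable]: "f \<in> borel_measurable borel" "Measurable.pred borel P"
  shows "energy f = energy (\<lambda>x. if P x then f x else 0) + energy (\<lambda>x. if P x then 0 else f x)"
  unfolding energy_def by (subst nn_integral_add[symmetric]) (auto intro!: nn_integral_cong)

lemma fourier_abs_wave_packet:
  "a > 0 \<Longrightarrow> fourier (\<lambda>x. complex_of_real (norm (wave_packet a \<eta> x))) = fourier (wave_packet a 0)"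
  by (simp add: wave_packet_def[of a 0, abs_def])

lemma measurable_outside_ball:
  fixes f :: "real^2 \<Rightarrow> complex"
  assumes [measurable]: "f \<in> borel_measurable borel"
  shows "(\<lambda>\<xi>. if norm (\<xi> - \<eta>) < r then 0 else f \<xi>) \<in> borel_measurable borel"
  by measurable

text \<open>
  On the frequency side, the error is the transform of the packet multiplied by the deviation of the
  multiplier from its value at the centre. The deviation is at most \<open>L\<close> within distance \<open>r\<close> of the
  centre and at most 2 in the tail.
\<close>

lemma packet_filter_error:
  assumes a: "a > 0" and r: "r > 0" and \<psi>: "integrable lborel \<psi>" and le1: "\<And>\<xi>. norm (fourier \<psi> \<xi>) \<le> 1"
    and L: "L \<ge> 0" "\<And>\<xi>. norm (\<xi> - \<eta>) < r \<Longrightarrow> norm (fourier \<psi> \<xi> - fourier \<psi> \<eta>) \<le> L"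
  shows "energy (\<lambda>x. convolution (wave_packet a \<eta>) \<psi> x - fourier \<psi> \<eta> * wave_packet a \<eta> x)
     \<le> ennreal (L\<^sup>2 / a + 8 * packet_tail a r)"
proof -
  let ?f = "wave_packet a \<eta>" and ?c = "fourier \<psi> \<eta>"
  have f: "integrable lborel ?f" by (rule integrable_wave_packet[OF a])
  have fb: "norm (?f x) \<le> 1" for x using a by (simp add: gaussian_le_1)
  have cf: "integrable lborel (\<lambda>x. ?c * ?f x)" using f by simp
  let ?g = "\<lambda>x. convolution ?f \<psi> x - ?c * ?f x"
  have g: "integrable lborel ?g" by (intro Bochner_Integration.integrable_diff integrable_convolution f \<psi> cf)
  have gb: "norm (?g x) \<le> (LINT x|lborel. norm (\<psi> x)) + norm ?c" for x
  proof -
    have "norm (convolution ?f \<psi> x) \<le> 1 * (LINT x|lborel. norm (\<psi> x))"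
      by (rule norm_convolution_le[OF _ fb \<psi>]) simp
    moreover have "norm (?c * ?f x) \<le> norm ?c * 1" unfolding norm_mult by (intro mult_left_mono fb) auto
    ultimately show ?thesis using norm_triangle_ineq4[of "convolution ?f \<psi> x" "?c * ?f x"] by linarith
  qed
  have "energy ?g \<le> energy (fourier ?g)"
    by (rule energy_le_energy_fourier[OF _ gb g])
      (intro continuous_intros continuous_on_convolution[OF _ fb \<psi>] continuous_on_wave_packet)
  also have "fourier ?g = (\<lambda>\<xi>. (fourier \<psi> \<xi> - ?c) * fourier ?f \<xi>)"
    by (auto simp: fun_eq_iff fourier_diff integrable_convolution f \<psi> cf fourier_convolution fourier_cmult algebra_simps)
  also have "energy \<dots> \<le> 2 * energy (\<lambda>\<xi>. L *\<^sub>R fourier ?f \<xi>) + 2 * energy (\<lambda>\<xi>. 2 *\<^sub>R (if norm (\<xi> - \<eta>) < r then 0 else fourier ?f \<xi>))"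
  proof (rule energy_triangle)
    fix \<xi>
    have "norm (fourier \<psi> \<xi> - ?c) \<le> norm (fourier \<psi> \<xi>) + norm ?c" by (rule norm_triangle_ineq4)
    then have 2: "norm (fourier \<psi> \<xi> - ?c) \<le> 2" using le1[of \<xi>] le1[of \<eta>] by linarith
    show "norm ((fourier \<psi> \<xi> - ?c) * fourier ?f \<xi>) \<le> norm (L *\<^sub>R fourier ?f \<xi>) + norm (2 *\<^sub>R (if norm (\<xi> - \<eta>) < r then 0 else fourier ?f \<xi>))"
    proof (cases "norm (\<xi> - \<eta>) < r")
      case True
      then show ?thesis using L by (auto simp: norm_mult intro!: mult_right_mono)
    next
      case False
      have "norm ((fourier \<psi> \<xi> - ?c) * fourier ?f \<xi>) \<le> 2 * norm (fourier ?f \<xi>)"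
        unfolding norm_mult by (intro mult_right_mono 2) auto
      then show ?thesis using False by (simp add: add_increasing)
    qed
  qed (intro borel_measurable_scaleR borel_measurable_const measurable_outside_ball fourier_measurable[OF f])+
  also have "\<dots> \<le> 2 * (ennreal (L\<^sup>2) * ennreal (1 / (2 * a))) + 2 * (ennreal (2\<^sup>2) * ennreal (packet_tail a r))"
  proof (intro add_mono mult_left_mono)
    have m: "fourier ?f \<in> borel_measurable borel" by (rule fourier_measurable[OF f])
    show "energy (\<lambda>\<xi>. L *\<^sub>R fourier ?f \<xi>) \<le> ennreal (L\<^sup>2) * ennreal (1 / (2 * a))"
      using m by (subst energy_cmult) (auto simp: energy_fourier_wave_packet[OF a])
    have "energy (\<lambda>\<xi>. 2 *\<^sub>R (if norm (\<xi> - \<eta>) < r then 0 else fourier ?f \<xi>)) = ennreal (2\<^sup>2) * energy (\<lambda>\<xi>. if norm (\<xi> - \<eta>) < r then 0 else fourier ?f \<xi>)"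
      by (intro energy_cmult measurable_outside_ball m)
    also have "\<dots> \<le> ennreal (2\<^sup>2) * ennreal (packet_tail a r)"
      using a r by (intro mult_left_mono energy_fourier_wave_packet_tail) auto
    finally show "energy (\<lambda>\<xi>. 2 *\<^sub>R (if norm (\<xi> - \<eta>) < r then 0 else fourier ?f \<xi>)) \<le> ennreal (2\<^sup>2) * ennreal (packet_tail a r)" .
  qed auto
  also have "\<dots> = ennreal (2 * (L\<^sup>2 * (1 / (2 * a)))) + ennreal (2 * (2\<^sup>2 * packet_tail a r))"
  proof -
    have e: "2 * (ennreal x * ennreal y) = ennreal (2 * (x * y))" if "x \<ge> 0" "y \<ge> 0" for x y
      using that by (metis ennreal_mult ennreal_numeral mult_nonneg_nonneg zero_le_numeral)
    show ?thesis using a by (intro arg_cong2[where f="(+)"] e) (auto simp: packet_tail_def)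
  qed
  also have "\<dots> = ennreal (L\<^sup>2 / a + 8 * packet_tail a r)"
    using a by (subst ennreal_plus[symmetric]) (auto simp: packet_tail_def)
  finally show ?thesis .
qed

section \<open>Linear changes of variables\<close>

lemma matrix_vector_measurable [measurable]: "(*v) (A :: real^2^2) \<in> borel_measurable borel"
  by (intro borel_measurable_continuous_onI linear_continuous_on matrix_vector_mul_bounded_linear)

lemma lborel_distr_matrix:
  fixes A :: "real^2^2"
  assumes "det A \<noteq> 0"
  shows "lborel = density (distr lborel borel ((*v) A)) (\<lambda>_. ennreal \<bar>det A\<bar>)"
  by (rule lborel_distr_linear[of "(*v) A", unfolded matrix_of_matrix_vector_mul, OF matrix_vector_mul_linear assms])

lemma nn_integral_compose_linear:
  fixes A :: "real^2^2"
  assumes d: "det A \<noteq> 0" and [measurable]: "g \<in> borel_measurable borel"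
  shows "(\<integral>\<^sup>+ y. g y \<partial>lborel) = ennreal \<bar>det A\<bar> * (\<integral>\<^sup>+ x. g (A *v x) \<partial>lborel)"
proof -
  have "(\<integral>\<^sup>+ y. g y \<partial>lborel) = (\<integral>\<^sup>+ y. g y \<partial>density (distr lborel borel ((*v) A)) (\<lambda>_. ennreal \<bar>det A\<bar>))"
    using lborel_distr_matrix[OF d] by (rule arg_cong)
  also have "\<dots> = (\<integral>\<^sup>+ y. ennreal \<bar>det A\<bar> * g y \<partial>distr lborel borel ((*v) A))"
    by (rule nn_integral_density) auto
  also have "\<dots> = ennreal \<bar>det A\<bar> * (\<integral>\<^sup>+ x. g (A *v x) \<partial>lborel)"
    by (subst nn_integral_distr) (auto simp: nn_integral_cmult)
  finally show ?thesis .
qed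

lemma integral_compose_linear:
  fixes A :: "real^2^2" and g :: "real^2 \<Rightarrow> complex"
  assumes d: "det A \<noteq> 0" and [measurable]: "g \<in> borel_measurable borel"
  shows "(LINT y|lborel. g y) = \<bar>det A\<bar> *\<^sub>R (LINT x|lborel. g (A *v x))"
proof -
  have "(LINT y|lborel. g y) = (LINT y|density (distr lborel borel ((*v) A)) (\<lambda>_. ennreal \<bar>det A\<bar>). g y)"
    using lborel_distr_matrix[OF d] by (rule arg_cong)
  also have "\<dots> = (LINT y|distr lborel borel ((*v) A). \<bar>det A\<bar> *\<^sub>R g y)"
    by (rule integral_density) auto
  also have "\<dots> = \<bar>det A\<bar> *\<^sub>R (LINT x|lborel. g (A *v x))"
    by (subst integral_distr) auto
  finally show ?thesis .
qed

text \<open>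
  Composition with \<open>A\<close> acts on the spectrum by the inverse transpose of \<open>A\<close>; here \<open>B\<close> is the
  inverse of \<open>A\<close>.
\<close>

lemma fourier_compose_linear:
  fixes A B :: "real^2^2"
  assumes d: "det A \<noteq> 0" and B: "B ** A = mat 1" and [measurable]: "f \<in> borel_measurable borel"
  shows "fourier (\<lambda>x. f (A *v x)) \<xi> = (1 / \<bar>det A\<bar>) *\<^sub>R fourier f (transpose B *v \<xi>)"
proof -
  have [measurable]: "(\<lambda>y. cis (- (2 * pi * (y \<bullet> \<zeta>)))) \<in> borel_measurable borel" for \<zeta> :: "real^2"
    by (intro borel_measurable_continuous_onI continuous_intros)
  have "(A *v x) \<bullet> (transpose B *v \<xi>) = x \<bullet> \<xi>" for x
  proof -
    have "(A *v x) \<bullet> (transpose B *v \<xi>) = (transpose B *v \<xi>) \<bullet> (A *v x)" by (rule inner_commute)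
    also have "\<dots> = \<xi> \<bullet> (B *v (A *v x))" by (simp only: transpose_matrix_vector dot_lmul_matrix)
    also have "\<dots> = x \<bullet> \<xi>" by (simp add: matrix_vector_mul_assoc B inner_commute)
    finally show ?thesis .
  qed
  then have "fourier f (transpose B *v \<xi>) = \<bar>det A\<bar> *\<^sub>R fourier (\<lambda>x. f (A *v x)) \<xi>"
    unfolding fourier_def by (subst integral_compose_linear[OF d]) auto
  then show ?thesis using d by simp
qed

lemma det_near_identity:
  fixes M :: "real^2^2"
  assumes M: "\<And>i j. \<bar>M $ i $ j\<bar> \<le> 1 / 8"
  shows "1 / 2 \<le> det (mat 1 - M)"
proof -
  have "det (mat 1 - M) = (1 - M $ 1 $ 1) * (1 - M $ 2 $ 2) - M $ 1 $ 2 * M $ 2 $ 1"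
    by (simp add: det_2 mat_def)
  moreover have "(7 / 8) * (7 / 8) \<le> (1 - M $ 1 $ 1) * (1 - M $ 2 $ 2)"
    using M[of 1 1] M[of 2 2] by (intro mult_mono) auto
  moreover have "\<bar>M $ 1 $ 2 * M $ 2 $ 1\<bar> \<le> (1 / 8) * (1 / 8)"
    unfolding abs_mult by (intro mult_mono M) auto
  ultimately show ?thesis by linarith
qed

section \<open>Deformed wave packets\<close>

text \<open>
  The filter \<open>\<psi>\<close> is controlled through its multiplier and not through its \<open>L\<^sup>1\<close>-norm, for which the
  bank gives no bound that is uniform over the channels.
\<close>

lemma energy_convolution_le_energy:
  assumes f: "continuous_on UNIV f" and b: "\<And>x. norm (f x) \<le> B" and i: "integrable lborel f" and \<psi>: "integrable lborel \<psi>"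
    and le1: "\<And>\<xi>. norm (fourier \<psi> \<xi>) \<le> 1"
  shows "energy (convolution f \<psi>) \<le> energy f"
proof -
  have "energy (convolution f \<psi>) \<le> energy (\<lambda>\<xi>. fourier f \<xi> * fourier \<psi> \<xi>)" by (rule energy_convolution_le[OF f b i \<psi>])
  also have "\<dots> \<le> energy (fourier f)" by (rule energy_mono) (simp add: norm_mult mult_left_le le1)
  also have "\<dots> \<le> energy f" by (rule energy_fourier_le[OF i])
  finally show ?thesis .
qed

lemma continuous_on_transpose_mult: "continuous_on S (\<lambda>x. transpose (M :: real^2^2) *v x)"
  by (intro linear_continuous_on matrix_vector_mul_bounded_linear)

text \<open>
  The spectrum of the composed packet at \<open>\<xi>\<close> is that of the packet at \<open>S \<xi>\<close>, where \<open>S\<close> is the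
  inverse of \<open>N\<close>. Wherever \<open>S \<xi>\<close> lies near the centre \<open>\<eta>\<close>, the multiplier vanishes at
  \<open>\<xi> = N (S \<xi>)\<close>, so only the tail survives; the change of variables costs the factor
  \<open>1 / det N \<le> 2\<close>.
\<close>

lemma linear_packet_misses_filter:
  assumes a: "a > 0" and r: "r > 0" and \<psi>: "integrable lborel \<psi>" and le1: "\<And>\<xi>. norm (fourier \<psi> \<xi>) \<le> 1"
    and d: "1 / 2 \<le> det N" and zero: "\<And>\<zeta>. norm (\<zeta> - \<eta>) < r \<Longrightarrow> fourier \<psi> (N *v \<zeta>) = 0"
    and int: "integrable lborel (\<lambda>x. wave_packet a \<eta> (transpose N *v x))"
  shows "energy (convolution (\<lambda>x. wave_packet a \<eta> (transpose N *v x)) \<psi>) \<le> ennreal (2 * packet_tail a r)"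
proof -
  let ?f = "wave_packet a \<eta>" and ?l = "\<lambda>x. wave_packet a \<eta> (transpose N *v x)"
  have dN: "det N \<noteq> 0" and dT: "det (transpose N) = det N" using d by auto
  then obtain S where S: "S ** N = mat 1" "N ** S = mat 1" using invertible_det_nz[of N] by (auto simp: invertible_def)
  have dS: "det S * det N = 1" using S(1) by (metis det_I det_mul)
  then have "det S = 1 / det N" using dN by (simp add: field_simps)
  then have dS0: "det S \<noteq> 0" and dS1: "\<bar>det S\<bar> = 1 / det N" using d by auto
  have SN: "S *v (N *v x) = x" "N *v (S *v x) = x" for x by (simp_all add: matrix_vector_mul_assoc S)
  have B: "transpose S ** transpose N = mat 1" using S(2) by (metis matrix_transpose_mul transpose_mat)
  have lh: "fourier ?l \<xi> = (1 / det N) *\<^sub>R fourier ?f (S *v \<xi>)" for \<xi>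
    using fourier_compose_linear[OF _ B, of ?f \<xi>] dN d by (simp add: dT)
  let ?G = "\<lambda>\<zeta>. if norm (\<zeta> - \<eta>) < r then 0 else fourier ?f \<zeta>"
  have G[measurable]: "?G \<in> borel_measurable borel"
    by (intro measurable_outside_ball fourier_measurable integrable_wave_packet a)
  have GS: "(\<lambda>\<xi>. ?G (S *v \<xi>)) \<in> borel_measurable borel"
    using measurable_compose[OF matrix_vector_measurable G] .
  have eG: "energy ?G = ennreal (1 / det N) * energy (\<lambda>\<xi>. ?G (S *v \<xi>))"
    unfolding energy_def dS1[symmetric] by (rule nn_integral_compose_linear[OF dS0]) measurable
  have "energy (convolution ?l \<psi>) \<le> energy (\<lambda>\<xi>. fourier ?l \<xi> * fourier \<psi> \<xi>)"
  proof (rule energy_convolution_le[OF _ _ int \<psi>])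
    show "continuous_on UNIV ?l"
      by (rule continuous_on_compose2[OF continuous_on_wave_packet continuous_on_transpose_mult]) auto
    show "norm (?l x) \<le> 1" for x using a by (simp add: gaussian_le_1)
  qed
  also have "\<dots> \<le> energy (\<lambda>\<xi>. (1 / det N) *\<^sub>R ?G (S *v \<xi>))"
  proof (rule energy_mono)
    fix \<xi>
    show "norm (fourier ?l \<xi> * fourier \<psi> \<xi>) \<le> norm ((1 / det N) *\<^sub>R ?G (S *v \<xi>))"
    proof (cases "norm (S *v \<xi> - \<eta>) < r")
      case True
      then have "fourier \<psi> \<xi> = 0" using zero[of "S *v \<xi>"] by (simp add: SN)
      then show ?thesis by simp
    next
      case False
      have "norm (fourier ?l \<xi>) * norm (fourier \<psi> \<xi>) \<le> norm (fourier ?l \<xi>)" by (intro mult_left_le le1) auto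
      moreover have "norm (fourier ?l \<xi>) = norm ((1 / det N) *\<^sub>R ?G (S *v \<xi>))" using False by (simp only: lh if_False)
      ultimately show ?thesis by (simp only: norm_mult)
    qed
  qed
  also have "\<dots> = ennreal ((1 / det N)\<^sup>2) * energy (\<lambda>\<xi>. ?G (S *v \<xi>))" by (rule energy_cmult[OF GS])
  also have "\<dots> = ennreal (1 / det N) * energy ?G"
  proof -
    have "ennreal ((1 / det N)\<^sup>2) = ennreal (1 / det N) * ennreal (1 / det N)"
      unfolding power2_eq_square using d by (intro ennreal_mult) auto
    then show ?thesis unfolding eG by (simp only: mult.assoc)
  qed
  also have "\<dots> \<le> ennreal 2 * ennreal (packet_tail a r)"
  proof (intro mult_mono energy_fourier_wave_packet_tail a ennreal_leI)
    show "1 / det N \<le> 2" using d by (simp add: field_simps)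
  qed (use r in auto)
  also have "\<dots> = ennreal (2 * packet_tail a r)"
    using a by (subst ennreal_mult) (auto simp: packet_tail_def)
  finally show ?thesis .
qed

lemma gaussian_mono: "a \<ge> 0 \<Longrightarrow> norm x / 2 \<le> norm y \<Longrightarrow> gaussian a y \<le> gaussian (a / 4) x"
proof -
  assume a: "a \<ge> 0" and n: "norm x / 2 \<le> norm y"
  have "(norm x / 2)\<^sup>2 \<le> (norm y)\<^sup>2" using n by (intro power_mono) auto
  then have "a * ((norm x)\<^sup>2 / 4) \<le> a * (norm y)\<^sup>2" using a by (intro mult_left_mono) (auto simp: power_divide)
  then show ?thesis by (simp add: gaussian_def mult.assoc)
qed

lemma displaced_point_norm:
  fixes M :: "real^2^2"
  assumes M: "\<And>i j. \<bar>M $ i $ j\<bar> \<le> 1 / 8" and s: "0 \<le> s" "s \<le> 1"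
  shows "norm x / 2 \<le> norm (x - s *\<^sub>R (transpose M *v x))"
proof -
  have "norm (s *\<^sub>R (transpose M *v x)) \<le> 1 * (4 * (1 / 8) * norm x)"
    unfolding norm_scaleR using s by (intro mult_mono norm_transpose_mult_le M) auto
  then show ?thesis using norm_triangle_ineq2[of x "s *\<^sub>R (transpose M *v x)"] by simp
qed

context
  fixes a R :: real and \<eta> :: "real^2" and M :: "real^2^2"
  assumes a: "a > 0" and R: "R > 0" and M: "\<And>i j. \<bar>M $ i $ j\<bar> \<le> 1 / 8"
begin

lemma deformed_packet_le: "norm (deform (cutoff_linear R M) (wave_packet a \<eta>) x) \<le> gaussian (a / 4) x"
  unfolding deform_def cutoff_linear_def norm_wave_packet
  using a by (intro gaussian_mono displaced_point_norm M cutoff_range) auto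

lemma linear_packet_le: "norm (wave_packet a \<eta> (x - transpose M *v x)) \<le> gaussian (a / 4) x"
  using gaussian_mono[OF less_imp_le[OF a] displaced_point_norm[OF M, of 1 x]] by simp

lemma continuous_deformed_packet: "continuous_on UNIV (deform (cutoff_linear R M) (wave_packet a \<eta>))"
  unfolding deform_def[abs_def] cutoff_linear_def
  by (intro continuous_on_compose2[OF continuous_on_wave_packet] continuous_intros continuous_on_transpose_mult) auto

lemma continuous_linear_packet: "continuous_on UNIV (\<lambda>x. wave_packet a \<eta> (x - transpose M *v x))"
  by (intro continuous_on_compose2[OF continuous_on_wave_packet] continuous_intros continuous_on_transpose_mult) auto

lemma integrable_dominated_by_gaussian:
  fixes f :: "real^2 \<Rightarrow> complex"
  assumes "continuous_on UNIV f" "\<And>x. norm (f x) \<le> gaussian (a / 4) x"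
  shows "integrable lborel f"
  by (rule Bochner_Integration.integrable_bound[OF integrable_gaussian[of "a / 4"]])
    (use a assms in \<open>auto intro: borel_measurable_continuous_onI\<close>)

lemma integrable_deformed_packet: "integrable lborel (deform (cutoff_linear R M) (wave_packet a \<eta>))"
  by (rule integrable_dominated_by_gaussian[OF continuous_deformed_packet deformed_packet_le])

lemma integrable_linear_packet: "integrable lborel (\<lambda>x. wave_packet a \<eta> (x - transpose M *v x))"
  by (rule integrable_dominated_by_gaussian[OF continuous_linear_packet linear_packet_le])

text \<open>
  On the ball of radius \<open>R\<close> the two packets coincide, and elsewhere each is at most \<open>gaussian (a/4)\<close>.
  Only moduli are compared there, so the bound is uniform in the frequency \<open>\<eta>\<close>.
\<close>

lemma energy_deformed_minus_linear_packet:
  "energy (\<lambda>x. deform (cutoff_linear R M) (wave_packet a \<eta>) x - wave_packet a \<eta> (x - transpose M *v x))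
     \<le> ennreal (16 * exp (- (pi * a * R\<^sup>2 / 4)) / a)"
proof -
  let ?h = "deform (cutoff_linear R M) (wave_packet a \<eta>)" and ?l = "\<lambda>x. wave_packet a \<eta> (x - transpose M *v x)"
  let ?g = "\<lambda>x. if norm x < R then 0 else gaussian (a / 4) x"
  have "energy (\<lambda>x. ?h x - ?l x) \<le> energy (\<lambda>x. 2 *\<^sub>R ?g x)"
  proof (rule energy_mono)
    fix x
    show "norm (?h x - ?l x) \<le> norm (2 *\<^sub>R ?g x)"
    proof (cases "norm x < R")
      case True
      then have "cutoff R x = 1" using R by (intro cutoff_eq_1) auto
      then show ?thesis by (simp add: deform_def cutoff_linear_def)
    next
      case False
      then show ?thesis
        using norm_triangle_ineq4[of "?h x" "?l x"] deformed_packet_le[of x] linear_packet_le[of x] by simp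
    qed
  qed
  also have "\<dots> = ennreal (2\<^sup>2) * energy ?g" by (rule energy_cmult) measurable
  also have "\<dots> \<le> ennreal (2\<^sup>2) * ennreal (exp (- (pi * (a / 4) * R\<^sup>2)) / (a / 4))"
    using a R by (intro mult_left_mono energy_gaussian_tail) auto
  also have "\<dots> = ennreal (2\<^sup>2 * (exp (- (pi * (a / 4) * R\<^sup>2)) / (a / 4)))"
    using a by (intro ennreal_mult[symmetric]) auto
  also have "2\<^sup>2 * (exp (- (pi * (a / 4) * R\<^sup>2)) / (a / 4)) = 16 * exp (- (pi * a * R\<^sup>2 / 4)) / a"
    by simp
  finally show ?thesis .
qed

text \<open>
  The deformed packet is the linear one, which misses the filter, plus a difference that is small
  already before filtering.
\<close>

lemma deformed_packet_filtered_energy: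
  assumes r: "r > 0" and \<psi>: "integrable lborel \<psi>" and le1: "\<And>\<xi>. norm (fourier \<psi> \<xi>) \<le> 1"
    and zero: "\<And>\<zeta>. norm (\<zeta> - \<eta>) < r \<Longrightarrow> fourier \<psi> ((mat 1 - M) *v \<zeta>) = 0"
  shows "energy (convolution (deform (cutoff_linear R M) (wave_packet a \<eta>)) \<psi>)
     \<le> ennreal (32 * exp (- (pi * a * R\<^sup>2 / 4)) / a + 4 * packet_tail a r)"
proof -
  let ?h = "deform (cutoff_linear R M) (wave_packet a \<eta>)" and ?l = "\<lambda>x. wave_packet a \<eta> (x - transpose M *v x)"
  let ?k = "\<lambda>x. ?h x - ?l x"
  note ih = integrable_deformed_packet and il = integrable_linear_packet
  have k: "integrable lborel ?k" by (intro Bochner_Integration.integrable_diff ih il)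
  have kb: "norm (?k x) \<le> 2" for x
    using norm_triangle_ineq4[of "?h x" "?l x"] deformed_packet_le[of x] linear_packet_le[of x] gaussian_le_1[of "a / 4" x] a by simp
  have l: "?l = (\<lambda>x. wave_packet a \<eta> (transpose (mat 1 - M) *v x))"
  proof -
    have "transpose (mat 1 - M) *v x = x - transpose M *v x" for x :: "real^2"
      by (simp add: vec_eq_iff forall_2 matrix_vector_mult_def transpose_def mat_def sum_2 algebra_simps)
    then show ?thesis by simp
  qed
  have hb: "norm (?h x) \<le> 1" for x using deformed_packet_le[of x] gaussian_le_1[of "a / 4" x] a by simp
  have lb: "norm (?l x) \<le> 1" for x using linear_packet_le[of x] gaussian_le_1[of "a / 4" x] a by simp
  have shift: "integrable lborel (\<lambda>y. g y * \<psi> (x - y))" if "continuous_on UNIV g" "\<And>x. norm (g x) \<le> 1" for g x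
    using that by (intro integrable_bounded_mult[where B=1] integrable_lborel_reflect \<psi>) (auto intro: borel_measurable_continuous_onI)
  have split: "convolution ?h \<psi> x = convolution ?k \<psi> x + convolution ?l \<psi> x" for x
    using Bochner_Integration.integral_diff[OF shift[OF continuous_deformed_packet hb, of x] shift[OF continuous_linear_packet lb, of x]]
    unfolding convolution_def left_diff_distrib by (simp only: diff_add_cancel)
  have "energy (convolution ?h \<psi>) \<le> 2 * energy (convolution ?k \<psi>) + 2 * energy (convolution ?l \<psi>)"
  proof (rule energy_triangle)
    show "norm (convolution ?h \<psi> x) \<le> norm (convolution ?k \<psi> x) + norm (convolution ?l \<psi> x)" for x
      unfolding split by (rule norm_triangle_ineq)
    show "convolution ?k \<psi> \<in> borel_measurable borel" "convolution ?l \<psi> \<in> borel_measurable borel"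
      using borel_measurable_integrable[OF integrable_convolution[OF k \<psi>]] borel_measurable_integrable[OF integrable_convolution[OF il \<psi>]] by simp_all
  qed
  also have "\<dots> \<le> 2 * ennreal (16 * exp (- (pi * a * R\<^sup>2 / 4)) / a) + 2 * ennreal (2 * packet_tail a r)"
  proof (intro add_mono mult_left_mono)
    have "energy (convolution ?k \<psi>) \<le> energy ?k"
      by (rule energy_convolution_le_energy[OF _ kb k \<psi> le1]) (intro continuous_intros continuous_deformed_packet continuous_linear_packet)
    then show "energy (convolution ?k \<psi>) \<le> ennreal (16 * exp (- (pi * a * R\<^sup>2 / 4)) / a)"
      using energy_deformed_minus_linear_packet by (rule order_trans)
    show "energy (convolution ?l \<psi>) \<le> ennreal (2 * packet_tail a r)"
      unfolding l
      by (rule linear_packet_misses_filter[OF a r \<psi> le1 det_near_identity[OF M] zero il[unfolded l]])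
  qed auto
  also have "\<dots> = ennreal (2 * (16 * exp (- (pi * a * R\<^sup>2 / 4)) / a)) + ennreal (2 * (2 * packet_tail a r))"
  proof -
    have e: "2 * ennreal x = ennreal (2 * x)" if "x \<ge> 0" for x
      using that by (metis ennreal_mult ennreal_numeral zero_le_numeral)
    show ?thesis using a by (intro arg_cong2[where f="(+)"] e) (auto simp: packet_tail_def)
  qed
  also have "\<dots> = ennreal (32 * exp (- (pi * a * R\<^sup>2 / 4)) / a + 4 * packet_tail a r)"
    using a by (subst ennreal_plus[symmetric]) (auto simp: packet_tail_def)
  finally show ?thesis .
qed

text \<open>
  The transform of the packet has energy \<open>1/(2a)\<close>, of which the multiplier retains at least the
  fraction \<open>A\<^sup>2\<close>. The budget keeps the three sources of error, namely the variation \<open>L\<close> of the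
  multiplier, the spectral tails and the truncation at radius \<open>R\<close>, below one eighth of
  \<open>A\<^sup>2/(2a)\<close> each. Three times the energy of the change is thus at least five eighths of
  \<open>A\<^sup>2/(2a)\<close>.
\<close>

lemma channel_change_lower_bound:
  assumes r: "r > 0" "r \<le> 15 / 16" and \<psi>: "integrable lborel \<psi>" and le1: "\<And>\<xi>. norm (fourier \<psi> \<xi>) \<le> 1"
    and chi: "integrable lborel chi" and one: "AE \<xi> in lborel. norm \<xi> < 15 / 16 \<longrightarrow> norm (fourier chi \<xi>) = 1"
    and zero: "\<And>\<zeta>. norm (\<zeta> - \<eta>) < r \<Longrightarrow> fourier \<psi> ((mat 1 - M) *v \<zeta>) = 0"
    and L: "L \<ge> 0" "\<And>\<xi>. norm (\<xi> - \<eta>) < r \<Longrightarrow> norm (fourier \<psi> \<xi> - fourier \<psi> \<eta>) \<le> L"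
    and A: "A \<ge> 0" "A \<le> norm (fourier \<psi> \<eta>)"
    and budget: "6 * L\<^sup>2 \<le> A\<^sup>2 / 8" "74 * exp (- (pi * r\<^sup>2 / a)) \<le> A\<^sup>2 / 8" "192 * exp (- (pi * a * R\<^sup>2 / 4)) \<le> A\<^sup>2 / 8"
  defines "S \<equiv> \<lambda>f. convolution (\<lambda>x. complex_of_real (cmod (convolution f \<psi> x))) chi"
  shows "ennreal (A\<^sup>2 / (12 * a)) \<le>
     energy (\<lambda>x. S (deform (cutoff_linear R M) (wave_packet a \<eta>)) x - S (wave_packet a \<eta>) x)"
proof -
  let ?f = "wave_packet a \<eta>" and ?h = "deform (cutoff_linear R M) (wave_packet a \<eta>)"
  let ?c = "fourier \<psi> \<eta>"
  let ?E = "energy (\<lambda>x. S ?h x - S ?f x)"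
  define P where "P = packet_tail a r"
  define X where "X = 32 * exp (- (pi * a * R\<^sup>2 / 4)) / a"
  have P: "P \<ge> 0" and X: "X \<ge> 0" using a by (auto simp: P_def X_def packet_tail_def)
  let ?g = "\<lambda>\<xi>. complex_of_real (norm ?c) * fourier (wave_packet a 0) \<xi>"
  have m0[measurable]: "fourier (wave_packet a 0) \<in> borel_measurable borel"
    by (intro fourier_measurable integrable_wave_packet a)
  have "AE \<xi> in lborel. norm \<xi> < r \<longrightarrow> norm (fourier chi \<xi>) = 1"
    using one by eventually_elim (use r in auto)
  from first_layer_energy_lower_bound[OF integrable_wave_packet[OF a] integrable_deformed_packet chi \<psi> this, of ?c \<eta>]
  have "energy (\<lambda>\<xi>. if norm \<xi> < r then ?g \<xi> else 0)
     \<le> 3 * ?E + 3 * energy (\<lambda>x. convolution ?f \<psi> x - ?c * ?f x) + 3 * energy (convolution ?h \<psi>)"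
    unfolding fourier_abs_wave_packet[OF a] S_def .
  also have "\<dots> \<le> 3 * ?E + 3 * ennreal (L\<^sup>2 / a + 8 * P) + 3 * ennreal (X + 4 * P)"
    unfolding P_def X_def
    by (intro add_mono mult_left_mono packet_filter_error deformed_packet_filtered_energy a r \<psi> le1 L zero order_refl) auto
  finally have 1: "energy (\<lambda>\<xi>. if norm \<xi> < r then ?g \<xi> else 0) \<le> 3 * ?E + 3 * ennreal (L\<^sup>2 / a + 8 * P) + 3 * ennreal (X + 4 * P)" .
  have "energy (\<lambda>\<xi>. if norm \<xi> < r then 0 else ?g \<xi>) \<le> energy (\<lambda>\<xi>. if norm (\<xi> - 0) < r then 0 else fourier (wave_packet a 0) \<xi>)"
    by (rule energy_mono) (auto simp: norm_mult le1 intro!: mult_left_le_one_le)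
  also have "\<dots> \<le> ennreal P" unfolding P_def using r by (intro energy_fourier_wave_packet_tail a) auto
  finally have 2: "energy (\<lambda>\<xi>. if norm \<xi> < r then 0 else ?g \<xi>) \<le> ennreal P" .
  have "ennreal (A\<^sup>2 / (2 * a)) \<le> ennreal ((norm ?c)\<^sup>2) * ennreal (1 / (2 * a))"
    using a A by (subst ennreal_mult[symmetric]) (auto intro!: ennreal_leI divide_right_mono power_mono)
  also have "\<dots> = energy (\<lambda>\<xi>. norm ?c *\<^sub>R fourier (wave_packet a 0) \<xi>)"
    by (simp add: energy_cmult energy_fourier_wave_packet[OF a])
  also have "\<dots> = energy ?g" by (rule energy_cong) (simp add: norm_mult)
  also have "\<dots> = energy (\<lambda>\<xi>. if norm \<xi> < r then ?g \<xi> else 0) + energy (\<lambda>\<xi>. if norm \<xi> < r then 0 else ?g \<xi>)"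
    by (rule energy_split) measurable
  also have "\<dots> \<le> (3 * ?E + 3 * ennreal (L\<^sup>2 / a + 8 * P) + 3 * ennreal (X + 4 * P)) + ennreal P"
    by (intro add_mono 1 2)
  finally have main: "ennreal (A\<^sup>2 / (2 * a)) \<le> (3 * ?E + 3 * ennreal (L\<^sup>2 / a + 8 * P) + 3 * ennreal (X + 4 * P)) + ennreal P" .
  show ?thesis
  proof (cases ?E)
    case (real e)
    have t: "3 * ennreal x = ennreal (3 * x)" if "x \<ge> 0" for x
      using that by (metis ennreal_mult ennreal_numeral zero_le_numeral)
    have n: "0 \<le> L\<^sup>2 / a + 8 * P" "0 \<le> X + 4 * P" using a P X by auto
    have "ennreal (A\<^sup>2 / (2 * a)) \<le> ennreal (3 * e + 3 * (L\<^sup>2 / a + 8 * P) + 3 * (X + 4 * P) + P)"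
      using main n P real(1) unfolding real(2) by (simp only: t ennreal_plus[symmetric] add_nonneg_nonneg mult_nonneg_nonneg zero_le_numeral)
    then have "A\<^sup>2 / (2 * a) \<le> 3 * e + 3 * (L\<^sup>2 / a + 8 * P) + 3 * (X + 4 * P) + P"
      using n P real(1) by (subst (asm) ennreal_le_iff) auto
    have regroup: "t \<le> 3 * e + 3 * y + 3 * X + 37 * P" if "t \<le> 3 * e + 3 * (y + 8 * P) + 3 * (X + 4 * P) + P" for t y :: real
      using that by (simp add: algebra_simps)
    from \<open>A\<^sup>2 / (2 * a) \<le> 3 * e + 3 * (L\<^sup>2 / a + 8 * P) + 3 * (X + 4 * P) + P\<close> have m: "A\<^sup>2 / (2 * a) \<le> 3 * e + 3 * (L\<^sup>2 / a) + 3 * X + 37 * P" by (rule regroup)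
    define T where "T = (A\<^sup>2 / 8) / (2 * a)"
    have "A\<^sup>2 / (12 * a) \<le> e"
    proof -
      have "3 * (L\<^sup>2 / a) \<le> T" using budget(1) a by (simp add: T_def field_simps)
      moreover have "3 * X \<le> T" using budget(3) a by (simp add: T_def X_def field_simps)
      moreover have "37 * P \<le> T" using budget(2) a by (simp add: T_def P_def packet_tail_def field_simps)
      moreover have "A\<^sup>2 / (2 * a) = 8 * T" by (simp add: T_def)
      moreover have "A\<^sup>2 / (12 * a) = (8 / 6) * T" by (simp add: T_def)
      moreover have "0 \<le> T" using a by (simp add: T_def)
      moreover have "(8 / 6) * T \<le> e" if "8 * T \<le> 3 * e + y + x + p" "y \<le> T" "x \<le> T" "p \<le> T" "0 \<le> T" for y x p
        using that by simp
      ultimately show ?thesis using m by metis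
    qed
    then show ?thesis using real by (simp add: ennreal_leI)
  qed simp
qed

end

section \<open>Instability along the active cores\<close>

lemma exp_minus_small: "\<delta> > 0 \<Longrightarrow> \<exists>y>0. exp (- y) \<le> (\<delta>::real)"
proof -
  assume d: "\<delta> > 0"
  have "exp (- max 1 (- ln \<delta>)) \<le> exp (ln \<delta>)" unfolding exp_le_cancel_iff by linarith
  also have "\<dots> = \<delta>" using d by simp
  finally show ?thesis by (intro exI[of _ "max 1 (- ln \<delta>)"]) simp
qed

lemma two_powr_neg_tendsto_0:
  fixes d :: real
  assumes "d > 0"
  shows "(\<lambda>j. 2 powr (- (d * real j))) \<longlonglongrightarrow> 0"
proof -
  have "(\<lambda>j. (2 powr (- d)) ^ j) \<longlonglongrightarrow> 0"
    using assms by (intro LIMSEQ_realpow_zero) (auto simp: powr_less_one)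
  moreover have "(2 powr (- d)) ^ j = 2 powr (- (d * real j))" for j
    by (simp add: powr_realpow[symmetric] powr_powr)
  ultimately show ?thesis by (simp only:)
qed

lemma active_core_multiplier_lipschitz:
  assumes \<psi>: "integrable lborel \<psi>" and wg: "weak_gradient_on (ball p r) (fourier \<psi>) g"
    and g: "Linfty_norm (ball p r) g \<le> ennreal C" "C \<ge> 0" and x: "norm (x - p) < r"
  shows "norm (fourier \<psi> x - fourier \<psi> p) \<le> 2 * C * norm (x - p)"
  by (rule weak_gradient_imp_lipschitz_from_center[OF continuous_on_fourier[OF \<psi>] wg g])
    (use x in \<open>simp add: dist_norm norm_minus_commute\<close>)

text \<open>
  The parameters are fixed in the order \<open>\<rho>\<close>, \<open>a\<close>, \<open>R\<close>, before any scale is chosen: \<open>\<rho>\<close> makes the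
  multiplier nearly constant on the ball of radius \<open>\<rho>\<close> about \<open>\<xi> j\<close>, \<open>a\<close> concentrates the packets
  spectrally on that ball, and \<open>R\<close> makes the plateau wide enough for the spatial extent of the
  packets. All constants are therefore independent of \<open>j\<close>, and large \<open>j\<close> serves only to make \<open>M j\<close>
  small.
\<close>

lemma scattering_instability:
  fixes \<alpha> \<beta> \<epsilon>\<^sub>0 r\<^sub>0 s :: real
  assumes ab: "\<alpha> \<le> 1" "\<beta> < 1" and e0: "0 < \<epsilon>\<^sub>0" "\<epsilon>\<^sub>0 < 1 / 32"
    and bank: "scattering_bank \<alpha> \<beta> \<epsilon>\<^sub>0 chi \<psi>"
    and sys: "active_core_system \<alpha> \<beta> \<epsilon>\<^sub>0 j\<^sub>0 r\<^sub>0 idx \<xi> M"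
    and AC: "active_core_condition j\<^sub>0 r\<^sub>0 idx \<xi> \<psi>"
    and reg: "core_regularity_condition j\<^sub>0 r\<^sub>0 idx \<xi> \<psi>"
    and s: "0 \<le> s"
  shows "\<exists>c K J. c > 0 \<and> K > 0 \<and> (\<forall>j\<ge>J. \<exists>f\<in>Hs_space s. \<exists>\<tau>\<in>Cc_infty.
      \<tau> \<noteq> (\<lambda>x. 0) \<and> Dsup_norm \<tau> < 1 \<and> 0 < Cm_norm m \<tau> \<and>
      Cm_norm m \<tau> \<le> ennreal (K * 2 powr (- ((1 - \<beta>) * real j))) \<and>
      Hs_norm s f \<le> ennreal (K * 2 powr (s * real j)) \<and>
      ennreal c \<le> scattering_change \<alpha> \<beta> chi \<psi> \<tau> f)"
proof -
  have r0: "0 < r\<^sub>0" using sys by (simp add: active_core_system_def)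
  have core: "idx j \<in> I_star \<alpha> \<beta>" "ball (\<xi> j) r\<^sub>0 \<subseteq> Q_set \<alpha> \<beta> \<epsilon>\<^sub>0 (Some (idx j))" if "j \<ge> j\<^sub>0" for j
    using sys that unfolding active_core_system_def by blast+
  have moved: "Q_set \<alpha> \<beta> \<epsilon>\<^sub>0 (Some (idx j)) \<inter> (*v) (mat 1 - M j) ` ball (\<xi> j) r\<^sub>0 = {}" if j: "j \<ge> j\<^sub>0" for j
  proof -
    have "Some (idx j) \<in> I_full \<alpha> \<beta>" using core(1)[OF j] by (simp add: I_full_def)
    moreover have "\<xi> j \<in> Q_set \<alpha> \<beta> \<epsilon>\<^sub>0 (Some (idx j)) \<inter> ball (\<xi> j) r\<^sub>0" using core(2)[OF j] r0 by auto
    ultimately show ?thesis using sys j r0 unfolding active_core_system_def by (metis empty_iff order_refl)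
  qed
  obtain A where A: "A > 0" "\<And>j \<eta>. j \<ge> j\<^sub>0 \<Longrightarrow> \<eta> \<in> ball (\<xi> j) r\<^sub>0 \<Longrightarrow> A \<le> cmod (fourier (\<psi> (idx j)) \<eta>)"
    using AC unfolding active_core_condition_def by blast
  obtain C where C: "C \<ge> 0" "\<And>j. j \<ge> j\<^sub>0 \<Longrightarrow> \<exists>g. weak_gradient_on (ball (\<xi> j) r\<^sub>0) (fourier (\<psi> (idx j))) g \<and> Linfty_norm (ball (\<xi> j) r\<^sub>0) g \<le> ennreal C"
  proof -
    obtain C0 where "C0 < \<infinity>" "\<forall>j\<ge>j\<^sub>0. \<exists>g. weak_gradient_on (ball (\<xi> j) r\<^sub>0) (fourier (\<psi> (idx j))) g \<and> Linfty_norm (ball (\<xi> j) r\<^sub>0) g \<le> C0"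
      using reg unfolding core_regularity_condition_def by blast
    then show thesis using that[of "enn2real C0"] by simp
  qed
  obtain C1 where C1: "C1 > 0" "\<And>j. j \<ge> j\<^sub>0 \<Longrightarrow> norm (\<xi> j) \<le> C1 * 2 ^ j"
  proof -
    have "comparable_from j\<^sub>0 (\<lambda>j. norm (\<xi> j)) (\<lambda>j. 2 ^ j)"
      using sys unfolding active_core_system_def by (elim conjE)
    then show thesis using that unfolding comparable_from_def by blast
  qed
  obtain c2 C2 where C2: "c2 > 0" "C2 > 0"
    "\<And>j. j \<ge> j\<^sub>0 \<Longrightarrow> c2 * 2 powr (- ((1 - \<beta>) * real j)) \<le> onorm ((*v) (M j))"
    "\<And>j. j \<ge> j\<^sub>0 \<Longrightarrow> onorm ((*v) (M j)) \<le> C2 * 2 powr (- ((1 - \<beta>) * real j))"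
  proof -
    have "comparable_from j\<^sub>0 (\<lambda>j. onorm ((*v) (M j))) (\<lambda>j. 2 powr (- ((1 - \<beta>) * real j)))"
      using sys unfolding active_core_system_def by (elim conjE)
    then show thesis using that unfolding comparable_from_def by blast
  qed
  \<comment> \<open>The last term gives \<open>L = 2C\<rho> \<le> A/8\<close>; the summand 1 covers the case \<open>C = 0\<close>.\<close>
  define \<rho> where "\<rho> = min (min r\<^sub>0 (15 / 16)) (A / (16 * (C + 1)))"
  have \<rho>: "\<rho> > 0" "\<rho> \<le> r\<^sub>0" "\<rho> \<le> 15 / 16" "\<rho> \<le> A / (16 * (C + 1))"
  proof -
    show "\<rho> > 0" using r0 A(1) C(1) by (simp add: \<rho>_def)
    show "\<rho> \<le> r\<^sub>0" "\<rho> \<le> 15 / 16" "\<rho> \<le> A / (16 * (C + 1))"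
      unfolding \<rho>_def by (meson min.cobounded1 min.cobounded2 order_trans)+
  qed
  define L where "L = 2 * C * \<rho>"
  have L: "0 \<le> L" "6 * L\<^sup>2 \<le> A\<^sup>2 / 8"
  proof -
    show "0 \<le> L" using C \<rho> by (simp add: L_def)
    have "C * \<rho> \<le> (C + 1) * (A / (16 * (C + 1)))" using C \<rho> A by (intro mult_mono) auto
    also have "\<dots> = A / 16" using C(1) by (simp add: field_simps)
    finally have "L \<le> A / 8" by (simp add: L_def)
    then have "L\<^sup>2 \<le> (A / 8)\<^sup>2" using \<open>0 \<le> L\<close> by (intro power_mono)
    then have "6 * L\<^sup>2 \<le> 6 * (A\<^sup>2 / 64)" by (simp add: power_divide)
    also have "\<dots> \<le> A\<^sup>2 / 8" by simp
    finally show "6 * L\<^sup>2 \<le> A\<^sup>2 / 8" .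
  qed
  obtain y1 where y1: "y1 > 0" "exp (- y1) \<le> A\<^sup>2 / 8 / 74" using exp_minus_small[of "A\<^sup>2 / 8 / 74"] A(1) by auto
  \<comment> \<open>This choice turns the exponent of the spectral tail into \<open>-y1\<close>, and that of \<open>R\<close> below turns the
    exponent of the spatial tail into \<open>-y2\<close>.\<close>
  define a where "a = pi * \<rho>\<^sup>2 / y1"
  have a: "a > 0" "74 * exp (- (pi * \<rho>\<^sup>2 / a)) \<le> A\<^sup>2 / 8"
    using y1 \<rho>(1) by (auto simp: a_def)
  obtain y2 where y2: "y2 > 0" "exp (- y2) \<le> A\<^sup>2 / 8 / 192" using exp_minus_small[of "A\<^sup>2 / 8 / 192"] A(1) by auto
  define R where "R = sqrt (4 * y2 / (pi * a))"
  have R: "R > 0" "192 * exp (- (pi * a * R\<^sup>2 / 4)) \<le> A\<^sup>2 / 8"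
    using y2 a(1) by (auto simp: R_def)
  obtain C3 where C3: "C3 > 0" "\<And>M \<mu>. (\<And>i j. \<bar>M $ i $ j\<bar> \<le> \<mu>) \<Longrightarrow> Cm_norm m (cutoff_linear R M) \<le> ennreal (C3 * \<mu>)"
    using Cm_norm_cutoff_linear[OF R(1), of m] by blast
  obtain C4 where C4: "C4 > 0" "\<And>M \<mu>. (\<And>i j. \<bar>M $ i $ j\<bar> \<le> \<mu>) \<Longrightarrow> Dsup_norm (cutoff_linear R M) \<le> ennreal (C4 * \<mu>)"
    using Dsup_norm_cutoff_linear[OF R(1)] by blast
  obtain K5 where K5: "K5 > 0" "\<And>\<eta>. Hs_norm s (wave_packet a \<eta>) \<le> ennreal (K5 * (1 + (norm \<eta>)\<^sup>2) powr (s / 2))"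
    by (rule Hs_norm_wave_packet[OF a(1) s]) (rule that)
  define \<mu> where "\<mu> j = C2 * 2 powr (- ((1 - \<beta>) * real j))" for j :: nat
  have "(\<lambda>j. 2 powr (- ((1 - \<beta>) * real j))) \<longlonglongrightarrow> 0"
    using ab(2) by (intro two_powr_neg_tendsto_0) simp
  then have "\<mu> \<longlonglongrightarrow> C2 * 0" unfolding \<mu>_def[abs_def] by (intro tendsto_intros)
  then have "\<forall>\<^sub>F j in sequentially. \<mu> j < min (1 / 8) (1 / C4)"
    using C4(1) by (intro order_tendstoD(2)) auto
  then obtain J1 where J1: "\<And>j. j \<ge> J1 \<Longrightarrow> \<mu> j < min (1 / 8) (1 / C4)" by (auto simp: eventually_sequentially)
  define K where "K = max (C3 * C2) (K5 * (1 + C1\<^sup>2) powr (s / 2))"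
  have K: "K > 0" using C3 C2 by (auto simp: K_def less_max_iff_disj)
  define c where "c = sqrt (A\<^sup>2 / (12 * a))"
  have c: "c > 0" using A a by (simp add: c_def)
  have "\<exists>f\<in>Hs_space s. \<exists>\<tau>\<in>Cc_infty.
      \<tau> \<noteq> (\<lambda>x. 0) \<and> Dsup_norm \<tau> < 1 \<and> 0 < Cm_norm m \<tau> \<and>
      Cm_norm m \<tau> \<le> ennreal (K * 2 powr (- ((1 - \<beta>) * real j))) \<and>
      Hs_norm s f \<le> ennreal (K * 2 powr (s * real j)) \<and>
      ennreal c \<le> scattering_change \<alpha> \<beta> chi \<psi> \<tau> f" if j: "j \<ge> max j\<^sub>0 J1" for j
  proof (intro bexI conjI)
    let ?f = "wave_packet a (\<xi> j)" and ?\<tau> = "cutoff_linear R (M j)"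
    have j0: "j \<ge> j\<^sub>0" and j1: "\<mu> j < 1 / 8" "\<mu> j < 1 / C4" using j J1[of j] by auto
    have Mj: "\<bar>M j $ i $ k\<bar> \<le> \<mu> j" for i k
      using matrix_component_le_onorm[of "M j" i k] C2(4)[OF j0] by (simp add: \<mu>_def)
    have Mj8: "\<bar>M j $ i $ k\<bar> \<le> 1 / 8" for i k using Mj[of i k] j1 by linarith
    show "?\<tau> \<in> Cc_infty" by (rule cutoff_linear_in_Cc_infty[OF R(1)])
    have "M j \<noteq> 0"
    proof
      assume "M j = 0"
      then have "(*v) (M j) = (\<lambda>x. 0)" by (simp add: fun_eq_iff)
      then have "onorm ((*v) (M j)) = 0" by (simp add: onorm_zero)
      moreover have "0 < c2 * 2 powr (- ((1 - \<beta>) * real j))" using C2(1) by simp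
      ultimately show False using C2(3)[OF j0] by linarith
    qed
    then obtain x where x: "?\<tau> x \<noteq> 0" by (rule cutoff_linear_nonzero[OF R(1)])
    then show "?\<tau> \<noteq> (\<lambda>x. 0)" by auto
    show "0 < Cm_norm m ?\<tau>"
      by (rule Cm_norm_pos[OF smooth_continuous_on[OF smooth_cutoff_linear] x])
    have "Dsup_norm ?\<tau> \<le> ennreal (C4 * \<mu> j)" by (rule C4(2)[OF Mj])
    also have "\<dots> < ennreal 1" using j1(2) C4(1) by (intro ennreal_lessI) (auto simp: field_simps)
    finally show "Dsup_norm ?\<tau> < 1" by simp
    have "Cm_norm m ?\<tau> \<le> ennreal (C3 * \<mu> j)" by (rule C3(2)[OF Mj])
    also have "C3 * \<mu> j = (C3 * C2) * 2 powr (- ((1 - \<beta>) * real j))" by (simp add: \<mu>_def)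
    also have "ennreal \<dots> \<le> ennreal (K * 2 powr (- ((1 - \<beta>) * real j)))"
      by (intro ennreal_leI mult_right_mono) (auto simp: K_def)
    finally show "Cm_norm m ?\<tau> \<le> ennreal (K * 2 powr (- ((1 - \<beta>) * real j)))" .
    have "(1 + (norm (\<xi> j))\<^sup>2) powr (s / 2) \<le> ((1 + C1\<^sup>2) * (2 powr real j)\<^sup>2) powr (s / 2)"
    proof (rule powr_mono2)
      have "(norm (\<xi> j))\<^sup>2 \<le> (C1 * 2 powr real j)\<^sup>2"
        using C1(2)[OF j0] by (intro power_mono) (auto simp: powr_realpow)
      moreover have "1 \<le> (2 powr real j)\<^sup>2" by (intro one_le_power ge_one_powr_ge_zero) auto
      ultimately show "1 + (norm (\<xi> j))\<^sup>2 \<le> (1 + C1\<^sup>2) * (2 powr real j)\<^sup>2"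
        unfolding power_mult_distrib distrib_right by linarith
    qed (use s in \<open>auto simp: add_nonneg_nonneg\<close>)
    also have "\<dots> = (1 + C1\<^sup>2) powr (s / 2) * 2 powr (s * real j)"
    proof -
      have "((2::real) powr real j)\<^sup>2 = 2 powr (2 * real j)" by (simp add: power2_eq_square flip: powr_add)
      then have "(((2::real) powr real j)\<^sup>2) powr (s / 2) = 2 powr (s * real j)" by (simp add: powr_powr mult.commute)
      then show ?thesis by (subst powr_mult) (auto simp: add_nonneg_nonneg)
    qed
    finally have "K5 * (1 + (norm (\<xi> j))\<^sup>2) powr (s / 2) \<le> K5 * ((1 + C1\<^sup>2) powr (s / 2) * 2 powr (s * real j))"
      using K5(1) by (intro mult_left_mono) auto
    also have "\<dots> \<le> K * 2 powr (s * real j)"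
      unfolding mult.assoc[symmetric] by (intro mult_right_mono) (auto simp: K_def)
    finally have "ennreal (K5 * (1 + (norm (\<xi> j))\<^sup>2) powr (s / 2)) \<le> ennreal (K * 2 powr (s * real j))" by (rule ennreal_leI)
    with K5(2)[of "\<xi> j"] show Hs: "Hs_norm s ?f \<le> ennreal (K * 2 powr (s * real j))" by (rule order_trans)
    have "L2_norm ?f < top" by (simp add: L2_norm_finite_iff energy_wave_packet[OF a(1)])
    moreover have "Hs_norm s ?f < top" using Hs by (rule le_less_trans) simp
    ultimately show "?f \<in> Hs_space s" by (simp add: Hs_space_def L2_space_def)
    have \<psi>: "integrable lborel (\<psi> (idx j))" "supp (fourier (\<psi> (idx j))) \<subseteq> Q_set \<alpha> \<beta> \<epsilon>\<^sub>0 (Some (idx j))" and chi: "integrable lborel chi"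
      using bank core(1)[OF j0] by (auto simp: scattering_bank_def)
    obtain g where g: "weak_gradient_on (ball (\<xi> j) r\<^sub>0) (fourier (\<psi> (idx j))) g" "Linfty_norm (ball (\<xi> j) r\<^sub>0) g \<le> ennreal C"
      using C(2)[OF j0] by blast
    have Lj: "norm (fourier (\<psi> (idx j)) \<zeta> - fourier (\<psi> (idx j)) (\<xi> j)) \<le> L" if "norm (\<zeta> - \<xi> j) < \<rho>" for \<zeta>
    proof -
      have "norm (fourier (\<psi> (idx j)) \<zeta> - fourier (\<psi> (idx j)) (\<xi> j)) \<le> 2 * C * norm (\<zeta> - \<xi> j)"
        using that \<rho>(2) by (intro active_core_multiplier_lipschitz[OF \<psi>(1) g C(1)]) auto
      also have "\<dots> \<le> L" unfolding L_def using that C(1) by (intro mult_left_mono) auto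
      finally show ?thesis .
    qed
    have zero: "fourier (\<psi> (idx j)) ((mat 1 - M j) *v \<zeta>) = 0" if "norm (\<zeta> - \<xi> j) < \<rho>" for \<zeta>
    proof (rule fourier_eq_0_outside_supp[OF _ \<psi>(2)])
      have "\<zeta> \<in> ball (\<xi> j) r\<^sub>0" using that \<rho>(2) by (simp add: dist_norm norm_minus_commute)
      then show "(mat 1 - M j) *v \<zeta> \<notin> Q_set \<alpha> \<beta> \<epsilon>\<^sub>0 (Some (idx j))" using moved[OF j0] by blast
    qed
    have "\<xi> j \<in> ball (\<xi> j) r\<^sub>0" using r0 by simp
    then have Aj: "A \<le> norm (fourier (\<psi> (idx j)) (\<xi> j))" by (rule A(2)[OF j0])
    have "ennreal (c\<^sup>2) \<le> energy (\<lambda>x. scattering1 chi \<psi> (deform ?\<tau> ?f) (idx j) x - scattering1 chi \<psi> ?f (idx j) x)"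
      unfolding scattering1_def
      using channel_change_lower_bound[OF a(1) R(1) Mj8 \<rho>(1,3) \<psi>(1) bank_multiplier_le_1[OF bank core(1)[OF j0]] chi
        bank_chi_eq_1_near_0[OF bank ab(1) e0] zero L(1) Lj less_imp_le[OF A(1)] Aj L(2) a(2) R(2)] a(1)
      by (simp add: c_def)
    then show "ennreal c \<le> scattering_change \<alpha> \<beta> chi \<psi> ?\<tau> ?f"
      unfolding scattering_change_def using c by (intro ell2_L2_norm_ge[OF core(1)[OF j0]]) auto
  qed
  then show ?thesis using c K by blast
qed

theorem corollary1p2:
  fixes \<alpha> \<beta> \<epsilon>\<^sub>0 r\<^sub>0 s :: real
    and j\<^sub>0 m :: nat
    and chi :: "real^2 \<Rightarrow> complex"
    and \<psi> :: "tile \<Rightarrow> real^2 \<Rightarrow> complex"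
    and idx :: "nat \<Rightarrow> tile"
    and \<xi> :: "nat \<Rightarrow> real^2"
    and M :: "nat \<Rightarrow> real^2^2"
  assumes "0 \<le> \<beta>" and "\<beta> \<le> \<alpha>" and "\<alpha> \<le> 1" and "\<beta> < 1"
    and "0 < \<epsilon>\<^sub>0" and "\<epsilon>\<^sub>0 < 1 / 32"
    and "scattering_bank \<alpha> \<beta> \<epsilon>\<^sub>0 chi \<psi>"
    and "active_core_system \<alpha> \<beta> \<epsilon>\<^sub>0 j\<^sub>0 r\<^sub>0 idx \<xi> M"
    and "active_core_condition j\<^sub>0 r\<^sub>0 idx \<xi> \<psi>"
    and "core_regularity_condition j\<^sub>0 r\<^sub>0 idx \<xi> \<psi>"
    and "0 \<le> s"
  shows "(\<forall>\<omega> :: real \<Rightarrow> real.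
            (\<forall>t\<in>{0<..1}. 0 \<le> \<omega> t) \<longrightarrow>
            mono_on {0<..1} \<omega> \<longrightarrow>
            (\<omega> \<longlongrightarrow> 0) (at_right 0) \<longrightarrow>
            (\<exists>C<\<infinity>. \<forall>f\<in>Hs_space s. \<forall>\<tau>\<in>Cc_infty.
                \<tau> \<noteq> (\<lambda>x. 0) \<longrightarrow> Cm_norm m \<tau> \<le> 1 \<longrightarrow> Dsup_norm \<tau> < 1 \<longrightarrow>
                scattering_change \<alpha> \<beta> chi \<psi> \<tau> f
                  \<le> C * ennreal (\<omega> (enn2real (Cm_norm m \<tau>))) * Hs_norm s f) \<longrightarrow>
            Limsup (at_right 0) (\<lambda>t. ereal (\<omega> t / t powr (s / (1 - \<beta>)))) > 0)
       \<and> (s < 1 - \<beta> \<longrightarrow>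
            \<not> (\<exists>C<\<infinity>. \<forall>f\<in>Hs_space s. \<forall>\<tau>\<in>Cc_infty.
                Dsup_norm \<tau> < 1 \<longrightarrow>
                scattering_change \<alpha> \<beta> chi \<psi> \<tau> f \<le> C * Cm_norm m \<tau> * Hs_norm s f))"
proof -
  obtain c K J where c: "c > 0" and K: "K > 0" and
    bad: "\<And>j. j \<ge> J \<Longrightarrow> \<exists>f\<in>Hs_space s. \<exists>\<tau>\<in>Cc_infty.
      \<tau> \<noteq> (\<lambda>x. 0) \<and> Dsup_norm \<tau> < 1 \<and> 0 < Cm_norm m \<tau> \<and>
      Cm_norm m \<tau> \<le> ennreal (K * 2 powr (- ((1 - \<beta>) * real j))) \<and>
      Hs_norm s f \<le> ennreal (K * 2 powr (s * real j)) \<and>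
      ennreal c \<le> scattering_change \<alpha> \<beta> chi \<psi> \<tau> f"
    using scattering_instability[OF assms(3-11), of m] by blast
  define t where "t j = K * 2 powr (- ((1 - \<beta>) * real j))" for j :: nat
  have t0: "t j > 0" for j using K by (simp add: t_def)
  have tlim: "t \<longlonglongrightarrow> 0"
    using tendsto_mult_left[OF two_powr_neg_tendsto_0[of "1 - \<beta>"], of K] assms(4) by (simp add: t_def[abs_def])
  show ?thesis
  proof (intro conjI allI impI notI)
    fix \<omega> :: "real \<Rightarrow> real"
    assume \<omega>0: "\<forall>t\<in>{0<..1}. 0 \<le> \<omega> t" and mono: "mono_on {0<..1} \<omega>"
    assume "\<exists>C<\<infinity>. \<forall>f\<in>Hs_space s. \<forall>\<tau>\<in>Cc_infty.
                \<tau> \<noteq> (\<lambda>x. 0) \<longrightarrow> Cm_norm m \<tau> \<le> 1 \<longrightarrow> Dsup_norm \<tau> < 1 \<longrightarrow>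
                scattering_change \<alpha> \<beta> chi \<psi> \<tau> f
                  \<le> C * ennreal (\<omega> (enn2real (Cm_norm m \<tau>))) * Hs_norm s f"
    then obtain C where "C < \<infinity>" and C: "\<And>f \<tau>. f \<in> Hs_space s \<Longrightarrow> \<tau> \<in> Cc_infty \<Longrightarrow>
                \<tau> \<noteq> (\<lambda>x. 0) \<Longrightarrow> Cm_norm m \<tau> \<le> 1 \<Longrightarrow> Dsup_norm \<tau> < 1 \<Longrightarrow>
                scattering_change \<alpha> \<beta> chi \<psi> \<tau> f
                  \<le> C * ennreal (\<omega> (enn2real (Cm_norm m \<tau>))) * Hs_norm s f"
      by blast
    from \<open>C < \<infinity>\<close> obtain C' where C': "C = ennreal C'" "C' \<ge> 0" by (cases C) auto
    let ?p = "s / (1 - \<beta>)"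
    define d where "d = c / ((C' + 1) * K * K powr ?p)"
    have d: "d > 0" using c K C' by (simp add: d_def)
    \<comment> \<open>Monotonicity replaces the exact norm of the deformation by its bound \<open>t j\<close>.\<close>
    have ratio: "d \<le> \<omega> (t j) / t j powr ?p" if j: "j \<ge> J" and t1: "t j \<le> 1" for j
    proof -
      obtain f \<tau> where f: "f \<in> Hs_space s" and \<tau>: "\<tau> \<in> Cc_infty" "\<tau> \<noteq> (\<lambda>x. 0)" "Dsup_norm \<tau> < 1"
          "0 < Cm_norm m \<tau>" "Cm_norm m \<tau> \<le> ennreal (t j)"
        and Hs: "Hs_norm s f \<le> ennreal (K * 2 powr (s * real j))"
        and low: "ennreal c \<le> scattering_change \<alpha> \<beta> chi \<psi> \<tau> f"
        using bad[OF j] unfolding t_def by blast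
      have \<tau>1: "Cm_norm m \<tau> \<le> 1" using \<tau>(5) t1 by (metis ennreal_1 ennreal_leI order_trans)
      obtain x where x: "Cm_norm m \<tau> = ennreal x" "0 < x" "x \<le> t j"
        using \<tau>(4,5) t0[of j] by (cases "Cm_norm m \<tau>") (auto simp: top_unique)
      have \<omega>x: "0 \<le> \<omega> x" "\<omega> x \<le> \<omega> (t j)"
        using \<omega>0 x t1 mono t0[of j] by (auto intro: mono_onD)
      have "ennreal c \<le> C * ennreal (\<omega> x) * Hs_norm s f"
        using C[OF f \<tau>(1,2) \<tau>1 \<tau>(3)] low x by simp
      also have "\<dots> \<le> ennreal (C' + 1) * ennreal (\<omega> (t j)) * ennreal (K * 2 powr (s * real j))"
        unfolding C'(1) by (intro mult_mono Hs ennreal_leI \<omega>x) auto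
      also have "\<dots> = ennreal ((C' + 1) * \<omega> (t j) * (K * 2 powr (s * real j)))"
        using C' \<omega>x K by (simp add: ennreal_mult)
      finally have "c \<le> (C' + 1) * \<omega> (t j) * (K * 2 powr (s * real j))"
        using C' \<omega>x K by (subst (asm) ennreal_le_iff) auto
      then have "c * 2 powr (- (s * real j)) \<le> (C' + 1) * \<omega> (t j) * (K * 2 powr (s * real j)) * 2 powr (- (s * real j))"
        by (rule mult_right_mono) simp
      also have "\<dots> = (C' + 1) * K * \<omega> (t j)"
        by (simp add: powr_minus field_simps)
      finally have 1: "c * 2 powr (- (s * real j)) \<le> (C' + 1) * K * \<omega> (t j)" .
      have "(2 powr (- ((1 - \<beta>) * real j))) powr ?p = 2 powr (- (s * real j))"
      proof -
        have "- ((1 - \<beta>) * real j) * ?p = - (s * real j)" using assms(4) by simp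
        then show ?thesis by (simp only: powr_powr)
      qed
      then have tp: "t j powr ?p = K powr ?p * 2 powr (- (s * real j))"
        unfolding t_def using K by (subst powr_mult) auto
      have "d * t j powr ?p = c * 2 powr (- (s * real j)) / ((C' + 1) * K)"
        unfolding tp d_def using K C' by simp
      also have "\<dots> \<le> \<omega> (t j)"
      proof -
        have "(C' + 1) * K > 0" using K C' by simp
        moreover have "c * 2 powr (- (s * real j)) \<le> \<omega> (t j) * ((C' + 1) * K)"
          using 1 by (simp only: mult.commute[of "\<omega> (t j)"])
        ultimately show ?thesis by (simp only: pos_divide_le_eq)
      qed
      finally show ?thesis using t0[of j] by (simp add: field_simps)
    qed
    show "Limsup (at_right 0) (\<lambda>t. ereal (\<omega> t / t powr ?p)) > 0"
    proof (rule ccontr)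
      assume "\<not> Limsup (at_right 0) (\<lambda>t. ereal (\<omega> t / t powr ?p)) > 0"
      then have "Limsup (at_right 0) (\<lambda>t. ereal (\<omega> t / t powr ?p)) < ereal d"
        using d by (simp add: not_less le_less_trans)
      then have "\<forall>\<^sub>F t in at_right 0. ereal (\<omega> t / t powr ?p) < ereal d" by (rule Limsup_lessD)
      moreover have "filterlim t (at_right 0) sequentially"
        using tlim t0 by (intro tendsto_imp_filterlim_at_right) auto
      ultimately have "\<forall>\<^sub>F j in sequentially. ereal (\<omega> (t j) / t j powr ?p) < ereal d"
        by (rule eventually_compose_filterlim)
      moreover have "\<forall>\<^sub>F j in sequentially. t j < 1" using tlim by (rule order_tendstoD) simp
      ultimately have "\<forall>\<^sub>F j in sequentially. False"
        using eventually_ge_at_top[of J]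
      proof eventually_elim
        case (elim j)
        then show ?case using ratio[of j] by simp
      qed
      then show False by simp
    qed
  next
    assume sb: "s < 1 - \<beta>"
    assume "\<exists>C<\<infinity>. \<forall>f\<in>Hs_space s. \<forall>\<tau>\<in>Cc_infty. Dsup_norm \<tau> < 1 \<longrightarrow>
                scattering_change \<alpha> \<beta> chi \<psi> \<tau> f \<le> C * Cm_norm m \<tau> * Hs_norm s f"
    then obtain C where "C < \<infinity>" and C: "\<And>f \<tau>. f \<in> Hs_space s \<Longrightarrow> \<tau> \<in> Cc_infty \<Longrightarrow> Dsup_norm \<tau> < 1 \<Longrightarrow>
                scattering_change \<alpha> \<beta> chi \<psi> \<tau> f \<le> C * Cm_norm m \<tau> * Hs_norm s f"
      by blast
    from \<open>C < \<infinity>\<close> obtain C' where C': "C = ennreal C'" "C' \<ge> 0" by (cases C) auto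
    have up: "c \<le> C' * K * K * 2 powr (- ((1 - \<beta> - s) * real j))" if j: "j \<ge> J" for j
    proof -
      obtain f \<tau> where f: "f \<in> Hs_space s" and \<tau>: "\<tau> \<in> Cc_infty" "Dsup_norm \<tau> < 1" "Cm_norm m \<tau> \<le> ennreal (t j)"
        and Hs: "Hs_norm s f \<le> ennreal (K * 2 powr (s * real j))"
        and low: "ennreal c \<le> scattering_change \<alpha> \<beta> chi \<psi> \<tau> f"
        using bad[OF j] unfolding t_def by blast
      have "ennreal c \<le> C * Cm_norm m \<tau> * Hs_norm s f" using C[OF f \<tau>(1,2)] low by (rule order_trans[rotated])
      also have "\<dots> \<le> ennreal C' * ennreal (t j) * ennreal (K * 2 powr (s * real j))"
        unfolding C'(1) by (intro mult_mono Hs \<tau>(3)) auto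
      also have "\<dots> = ennreal (C' * t j * (K * 2 powr (s * real j)))"
        using C' K t0[of j] by (simp add: ennreal_mult less_imp_le)
      finally have "c \<le> C' * t j * (K * 2 powr (s * real j))"
        using C' K t0[of j] by (subst (asm) ennreal_le_iff) (auto simp: less_imp_le)
      also have "\<dots> = C' * K * K * (2 powr (- ((1 - \<beta>) * real j)) * 2 powr (s * real j))"
        by (simp add: t_def mult_ac)
      also have "2 powr (- ((1 - \<beta>) * real j)) * 2 powr (s * real j) = 2 powr (- ((1 - \<beta> - s) * real j))"
        by (simp add: algebra_simps flip: powr_add)
      finally show ?thesis .
    qed
    have "(\<lambda>j. C' * K * K * 2 powr (- ((1 - \<beta> - s) * real j))) \<longlonglongrightarrow> C' * K * K * 0"
      using sb by (intro tendsto_intros two_powr_neg_tendsto_0) simp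
    then have "c \<le> C' * K * K * 0"
      by (rule tendsto_lowerbound) (auto simp: eventually_sequentially intro!: exI[of _ J] up)
    then show False using c by simp
  qed
qed

end
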